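(* Let $\mathcal{C},\mathcal{D}$ be two monoidal categories and $U\colon\mathcal{D}\to\mathcal{C}$ be a strong monoidal functor. Assume that the functor $U$ has a left adjoint $F$. Then $F$ is (canonically) a comonoidal functor and the monad $T=UF$ on $\mathcal{C}$ has a canonical structure of a bimonad. The canonical functor $K\colon\mathcal{D}\to T\text{-}\mathcal{C}$ is strong monoidal and satisfies $U_TK=U$ as monoidal functors and $KF=F_T$ as comonoidal functors. Furthermore, if $\mathcal{C}$ and $\mathcal{D}$ are left (resp. right) autonomous, then $T$ is a left (resp. right) Hopf monad.
   Context: Conventions: categories are small, monoidal categories $(\mathcal{C},\otimes,\mathbf 1)$ are strict; composition of $f$ followed by $g$ is written $gf$; "functorial" means natural. (Co)monoidal functors: a monoidal functor $(F,F_2,F_0)$ has natural $F_2(X,Y)\colon F(X)\otimes F(Y)\to F(X\otimes Y)$ and $F_0\colon\mathbf 1\to F(\mathbf 1)$ satisfying the usual associativity and unit axioms; it is strong if $F_2,F_0$ are isomorphisms and strict if they are identities. A comonoidal functor has natural $F_2(X,Y)\colon F(X\otimes Y)\to F(X)\otimes F(Y)$, $F_0\colon F(\mathbf 1)\to\mathbf 1$ satisfying the dual axioms. A strong monoidal functor is regarded as strong comonoidal via $F_2^{-1},F_0^{-1}$. Composites $GF$ of comonoidal functors are comonoidal via $(GF)_2=G_2\,G(F_2)$, $(GF)_0=G_0\,G(F_0)$. A natural transformation $\varphi\colon F\to G$ of comonoidal functors is comonoidal if $G_2(X,Y)\varphi_{X\otimes Y}=(\varphi_X\otimes\varphi_Y)F_2(X,Y)$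 and $G_0\varphi_{\mathbf 1}=F_0$. Monads: a monad on $\mathcal{C}$ is $(T,\mu\colon T^2\to T,\eta\colon 1_{\mathcal C}\to T)$ with the usual associativity and unit axioms. A $T$-module is $(M,r)$ with $r\colon T(M)\to M$, $rT(r)=r\mu_M$, $r\eta_M=\mathrm{id}_M$; morphisms $f\colon(M,r)\to(N,s)$ satisfy $fr=sT(f)$. $T\text{-}\mathcal{C}$ is the category of $T$-modules, $U_T\colon T\text{-}\mathcal{C}\to\mathcal{C}$, $(M,r)\mapsto M$, the forgetful functor and $F_T\colon\mathcal{C}\to T\text{-}\mathcal{C}$, $X\mapsto(T(X),\mu_X)$ its left adjoint. Bimonads: a bimonad is a monad $(T,\mu,\eta)$ on a monoidal category with a comonoidal structure $(T_2,T_0)$ on $T$ such that $\mu$ and $\eta$ are comonoidal. Then $T\text{-}\mathcal{C}$ is monoidal with $(M,r)\otimes(N,s)=(M\otimes N,(r\otimes s)T_2(M,N))$, unit $(\mathbf 1,T_0)$; $U_T$ is strict monoidal, and $F_T$ is comonoidal with $(F_T)_2=T_2$ and $(F_T)_0=T_0$. The data in the theorem: let $\eta\colon1_{\mathcal C}\to UF$ and $\varepsilon\colon FU\to1_{\mathcal D}$ be the adjunction morphisms. The monad $T=UF$ has product $\mu=U(\varepsilon_F)$ and unit $\eta$. The canonical functor $K$ is $K(A)=(U(A),U(\varepsilon_A))$, $K(f)=U(f)$; it is the unique functor with $U_TK=U$ and $KF=F_T$. The canonical comonoidal structure on $F$ is $F_2(X,Y)=\varepsilon_{F(X)\otimes F(Y)}\,F(U_2(F(X),F(Y)))\,F(\eta_X\otimes\eta_Y)$,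 $F_0=\varepsilon_{\mathbf 1_{\mathcal D}}F(U_0)$, and the canonical comonoidal structure on $T=UF$ is that of the composite of the comonoidal functor $F$ with $U$, regarded as comonoidal. Hopf monads: a monoidal category is left (resp. right) autonomous if each object $X$ has a (chosen) left dual $({}^\vee X,\mathrm{ev}_X\colon{}^\vee X\otimes X\to\mathbf 1,\mathrm{coev}_X\colon\mathbf 1\to X\otimes{}^\vee X)$ (resp. right dual $(X^\vee,\widetilde{\mathrm{ev}}_X\colon X\otimes X^\vee\to\mathbf 1,\widetilde{\mathrm{coev}}_X\colon\mathbf 1\to X^\vee\otimes X)$). A left (resp. right) Hopf monad is a bimonad on a left (resp. right) autonomous category having a left (resp. right) antipode. A left antipode is a functorial family $s^l_X\colon T({}^\vee T(X))\to{}^\vee X$ with $T_0T(\mathrm{ev}_X)T({}^\vee\eta_X\otimes\mathrm{id}_X)=\mathrm{ev}_{T(X)}(s^l_{T(X)}T({}^\vee\mu_X)\otimes\mathrm{id}_{T(X)})T_2({}^\vee T(X),X)$ and $(\eta_X\otimes\mathrm{id}_{{}^\vee X})\mathrm{coev}_XT_0=(\mu_X\otimes s^l_X)T_2(T(X),{}^\vee T(X))T(\mathrm{coev}_{T(X)})$. A right antipode is a functorial family $s^r_X\colon T(T(X)^\vee)\to X^\vee$ with $T_0T(\widetilde{\mathrm{ev}}_X)T(\mathrm{id}_X\otimes\eta_X^\vee)=\widetilde{\mathrm{ev}}_{T(X)}(\mathrm{id}_{T(X)}\otimes s^r_{T(X)}T(\mu_X^\vee))T_2(X,T(X)^\vee)$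 and $(\mathrm{id}_{X^\vee}\otimes\eta_X)\widetilde{\mathrm{coev}}_XT_0=(s^r_X\otimes\mu_X)T_2(T(X)^\vee,T(X))T(\widetilde{\mathrm{coev}}_{T(X)})$. *)

theory Defs
  imports Main
begin

section \<open>Small categories\<close>

text \<open>
  Objects and arrows of a small category form sets inside the types \<open>'o\<close> and \<open>'a\<close>; all axioms are
  relative to these sets and all operations are arbitrary outside of them.
  \<open>g \<cdot> f\<close> is \<open>f\<close> followed by \<open>g\<close>.
\<close>

record ('o, 'a) cat =
  Ob :: "'o set"
  Ar :: "'a set"
  Dom :: "'a \<Rightarrow> 'o"
  Cod :: "'a \<Rightarrow> 'o"
  ident :: "'o \<Rightarrow> 'a"
  comp_ar :: "'a \<Rightarrow> 'a \<Rightarrow> 'a"  (infixl "\<cdot>\<index>" 65)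

definition hom :: "('o, 'a, 'z) cat_scheme \<Rightarrow> 'o \<Rightarrow> 'o \<Rightarrow> 'a set" where
  "hom C X Y = {f \<in> Ar C. Dom C f = X \<and> Cod C f = Y}"

locale category =
  fixes C :: "('o, 'a, 'z) cat_scheme" (structure)
  assumes Dom_in: "f \<in> Ar C \<Longrightarrow> Dom C f \<in> Ob C"
    and Cod_in: "f \<in> Ar C \<Longrightarrow> Cod C f \<in> Ob C"
    and ident_in: "X \<in> Ob C \<Longrightarrow> ident C X \<in> hom C X X"
    and comp_in: "f \<in> hom C X Y \<Longrightarrow> g \<in> hom C Y Z \<Longrightarrow> g \<cdot> f \<in> hom C X Z"
    and comp_ident_right: "f \<in> hom C X Y \<Longrightarrow> f \<cdot> ident C X = f"
    and comp_ident_left: "f \<in> hom C X Y \<Longrightarrow> ident C Y \<cdot> f = f"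
    and comp_assoc: "f \<in> hom C W X \<Longrightarrow> g \<in> hom C X Y \<Longrightarrow> h \<in> hom C Y Z \<Longrightarrow>
      (h \<cdot> g) \<cdot> f = h \<cdot> (g \<cdot> f)"

definition is_inverse :: "('o, 'a, 'z) cat_scheme \<Rightarrow> 'a \<Rightarrow> 'a \<Rightarrow> bool" where
  "is_inverse C f g \<longleftrightarrow> g \<in> hom C (Cod C f) (Dom C f) \<and>
     g \<cdot>\<^bsub>C\<^esub> f = ident C (Dom C f) \<and> f \<cdot>\<^bsub>C\<^esub> g = ident C (Cod C f)"

definition is_iso :: "('o, 'a, 'z) cat_scheme \<Rightarrow> 'a \<Rightarrow> bool" where
  "is_iso C f \<longleftrightarrow> f \<in> Ar C \<and> (\<exists>g. is_inverse C f g)"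

definition inv_ar :: "('o, 'a, 'z) cat_scheme \<Rightarrow> 'a \<Rightarrow> 'a" where
  "inv_ar C f = (THE g. is_inverse C f g)"

section \<open>Strict monoidal categories\<close>

text \<open>\<open>\<otimes>\<close> is the tensor product of objects, \<open>\<boxtimes>\<close> that of arrows.\<close>

record ('o, 'a) moncat = "('o, 'a) cat" +
  tensor_ob :: "'o \<Rightarrow> 'o \<Rightarrow> 'o"  (infixl "\<otimes>\<index>" 70)
  tensor_ar :: "'a \<Rightarrow> 'a \<Rightarrow> 'a"  (infixl "\<boxtimes>\<index>" 70)
  unit_ob :: "'o"  ("\<one>\<index>")

locale strict_monoidal_category = category C
  for C :: "('o, 'a, 'z) moncat_scheme" (structure) +
  assumes tensor_ob_in: "X \<in> Ob C \<Longrightarrow> Y \<in> Ob C \<Longrightarrow> X \<otimes> Y \<in> Ob C"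
    and unit_ob_in: "\<one> \<in> Ob C"
    and tensor_ar_in: "f \<in> hom C X X' \<Longrightarrow> g \<in> hom C Y Y' \<Longrightarrow> f \<boxtimes> g \<in> hom C (X \<otimes> Y) (X' \<otimes> Y')"
    and tensor_ident: "X \<in> Ob C \<Longrightarrow> Y \<in> Ob C \<Longrightarrow> ident C X \<boxtimes> ident C Y = ident C (X \<otimes> Y)"
    and interchange: "f \<in> hom C X X' \<Longrightarrow> f' \<in> hom C X' X'' \<Longrightarrow> g \<in> hom C Y Y' \<Longrightarrow> g' \<in> hom C Y' Y'' \<Longrightarrow>
      (f' \<cdot> f) \<boxtimes> (g' \<cdot> g) = (f' \<boxtimes> g') \<cdot> (f \<boxtimes> g)"
    and tensor_ob_assoc: "X \<in> Ob C \<Longrightarrow> Y \<in> Ob C \<Longrightarrow> Z \<in> Ob C \<Longrightarrow> (X \<otimes> Y) \<otimes> Z = X \<otimes> (Y \<otimes> Z)"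
    and tensor_ar_assoc: "f \<in> Ar C \<Longrightarrow> g \<in> Ar C \<Longrightarrow> h \<in> Ar C \<Longrightarrow> (f \<boxtimes> g) \<boxtimes> h = f \<boxtimes> (g \<boxtimes> h)"
    and unit_ob_left: "X \<in> Ob C \<Longrightarrow> \<one> \<otimes> X = X"
    and unit_ob_right: "X \<in> Ob C \<Longrightarrow> X \<otimes> \<one> = X"
    and unit_ar_left: "f \<in> Ar C \<Longrightarrow> ident C \<one> \<boxtimes> f = f"
    and unit_ar_right: "f \<in> Ar C \<Longrightarrow> f \<boxtimes> ident C \<one> = f"

section \<open>Functors, natural transformations, adjunctions\<close>

record ('o, 'a, 'p, 'b) func =
  obj :: "'o \<Rightarrow> 'p"
  arr :: "'a \<Rightarrow> 'b"

locale cat_functor = source: category C + target: category D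
  for C :: "('o, 'a, 'y) cat_scheme" and D :: "('p, 'b, 'z) cat_scheme" +
  fixes F :: "('o, 'a, 'p, 'b, 'x) func_scheme"
  assumes obj_in: "X \<in> Ob C \<Longrightarrow> obj F X \<in> Ob D"
    and arr_in: "f \<in> hom C X Y \<Longrightarrow> arr F f \<in> hom D (obj F X) (obj F Y)"
    and arr_ident: "X \<in> Ob C \<Longrightarrow> arr F (ident C X) = ident D (obj F X)"
    and arr_comp: "f \<in> hom C X Y \<Longrightarrow> g \<in> hom C Y Z \<Longrightarrow> arr F (g \<cdot>\<^bsub>C\<^esub> f) = arr F g \<cdot>\<^bsub>D\<^esub> arr F f"

definition id_func :: "('o, 'a, 'o, 'a) func" where
  "id_func = \<lparr>obj = (\<lambda>X. X), arr = (\<lambda>f. f)\<rparr>"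

definition comp_func ::
    "('p, 'b, 'q, 'c, 'y) func_scheme \<Rightarrow> ('o, 'a, 'p, 'b, 'x) func_scheme \<Rightarrow> ('o, 'a, 'q, 'c) func" where
  "comp_func G F = \<lparr>obj = (\<lambda>X. obj G (obj F X)), arr = (\<lambda>f. arr G (arr F f))\<rparr>"

locale nat_trans = F: cat_functor C D F + G: cat_functor C D G
  for C :: "('o, 'a, 'y) cat_scheme" and D :: "('p, 'b, 'z) cat_scheme"
    and F :: "('o, 'a, 'p, 'b, 'x) func_scheme" and G :: "('o, 'a, 'p, 'b, 'w) func_scheme" +
  fixes \<phi> :: "'o \<Rightarrow> 'b"
  assumes component_in: "X \<in> Ob C \<Longrightarrow> \<phi> X \<in> hom D (obj F X) (obj G X)"
    and natural: "f \<in> hom C X Y \<Longrightarrow> \<phi> Y \<cdot>\<^bsub>D\<^esub> arr F f = arr G f \<cdot>\<^bsub>D\<^esub> \<phi> X"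

locale adjunction =
  unit: nat_trans C C id_func "comp_func U F" \<eta> +
  counit: nat_trans D D "comp_func F U" id_func \<epsilon> +
  left: cat_functor C D F + right: cat_functor D C U
  for C :: "('o, 'a, 'y) cat_scheme" and D :: "('p, 'b, 'z) cat_scheme"
    and F :: "('o, 'a, 'p, 'b, 'x) func_scheme" and U :: "('p, 'b, 'o, 'a, 'w) func_scheme"
    and \<eta> :: "'o \<Rightarrow> 'a" and \<epsilon> :: "'p \<Rightarrow> 'b" +
  assumes triangle_left: "X \<in> Ob C \<Longrightarrow> \<epsilon> (obj F X) \<cdot>\<^bsub>D\<^esub> arr F (\<eta> X) = ident D (obj F X)"
    and triangle_right: "A \<in> Ob D \<Longrightarrow> arr U (\<epsilon> A) \<cdot>\<^bsub>C\<^esub> \<eta> (obj U A) = ident C (obj U A)"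

section \<open>Monoidal and comonoidal functors\<close>

text \<open>
  The same record carries a monoidal structure (\<open>str2 F X Y : F X \<otimes> F Y \<rightarrow> F (X \<otimes> Y)\<close>,
  \<open>str0 F : \<one> \<rightarrow> F \<one>\<close>) or a comonoidal structure (arrows in the opposite directions); the
  locales below say which of the two is meant.
\<close>

record ('o, 'a, 'p, 'b) mfunc = "('o, 'a, 'p, 'b) func" +
  str2 :: "'o \<Rightarrow> 'o \<Rightarrow> 'b"
  str0 :: "'b"

definition with_str ::
    "('o, 'a, 'p, 'b, 'x) func_scheme \<Rightarrow> ('o \<Rightarrow> 'o \<Rightarrow> 'b) \<Rightarrow> 'b \<Rightarrow> ('o, 'a, 'p, 'b) mfunc" where
  "with_str F F2 F0 = \<lparr>obj = obj F, arr = arr F, str2 = F2, str0 = F0\<rparr>"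

text \<open>Equality of functors with (co)monoidal structure, tested on the objects and arrows of the source only.\<close>

definition mfunc_eq ::
    "('o, 'a, 'z) moncat_scheme \<Rightarrow> ('o, 'a, 'p, 'b) mfunc \<Rightarrow> ('o, 'a, 'p, 'b) mfunc \<Rightarrow> bool" where
  "mfunc_eq C F G \<longleftrightarrow>
     (\<forall>X\<in>Ob C. obj F X = obj G X) \<and> (\<forall>f\<in>Ar C. arr F f = arr G f) \<and>
     (\<forall>X\<in>Ob C. \<forall>Y\<in>Ob C. str2 F X Y = str2 G X Y) \<and> str0 F = str0 G"

locale monoidal_functor =
  source: strict_monoidal_category C + target: strict_monoidal_category D + cat_functor C D F
  for C :: "('o, 'a, 'y) moncat_scheme" and D :: "('p, 'b, 'z) moncat_scheme"
    and F :: "('o, 'a, 'p, 'b) mfunc" +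
  assumes str2_in: "X \<in> Ob C \<Longrightarrow> Y \<in> Ob C \<Longrightarrow>
      str2 F X Y \<in> hom D (obj F X \<otimes>\<^bsub>D\<^esub> obj F Y) (obj F (X \<otimes>\<^bsub>C\<^esub> Y))"
    and str0_in: "str0 F \<in> hom D \<one>\<^bsub>D\<^esub> (obj F \<one>\<^bsub>C\<^esub>)"
    and str2_natural: "f \<in> hom C X X' \<Longrightarrow> g \<in> hom C Y Y' \<Longrightarrow>
      arr F (f \<boxtimes>\<^bsub>C\<^esub> g) \<cdot>\<^bsub>D\<^esub> str2 F X Y = str2 F X' Y' \<cdot>\<^bsub>D\<^esub> (arr F f \<boxtimes>\<^bsub>D\<^esub> arr F g)"
    and str_assoc: "X \<in> Ob C \<Longrightarrow> Y \<in> Ob C \<Longrightarrow> Z \<in> Ob C \<Longrightarrow>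
      str2 F (X \<otimes>\<^bsub>C\<^esub> Y) Z \<cdot>\<^bsub>D\<^esub> (str2 F X Y \<boxtimes>\<^bsub>D\<^esub> ident D (obj F Z)) =
      str2 F X (Y \<otimes>\<^bsub>C\<^esub> Z) \<cdot>\<^bsub>D\<^esub> (ident D (obj F X) \<boxtimes>\<^bsub>D\<^esub> str2 F Y Z)"
    and str_unit_right: "X \<in> Ob C \<Longrightarrow>
      str2 F X \<one>\<^bsub>C\<^esub> \<cdot>\<^bsub>D\<^esub> (ident D (obj F X) \<boxtimes>\<^bsub>D\<^esub> str0 F) = ident D (obj F X)"
    and str_unit_left: "X \<in> Ob C \<Longrightarrow>
      str2 F \<one>\<^bsub>C\<^esub> X \<cdot>\<^bsub>D\<^esub> (str0 F \<boxtimes>\<^bsub>D\<^esub> ident D (obj F X)) = ident D (obj F X)"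

locale strong_monoidal_functor = monoidal_functor +
  assumes str2_iso: "X \<in> Ob C \<Longrightarrow> Y \<in> Ob C \<Longrightarrow> is_iso D (str2 F X Y)"
    and str0_iso: "is_iso D (str0 F)"

locale comonoidal_functor =
  source: strict_monoidal_category C + target: strict_monoidal_category D + cat_functor C D F
  for C :: "('o, 'a, 'y) moncat_scheme" and D :: "('p, 'b, 'z) moncat_scheme"
    and F :: "('o, 'a, 'p, 'b) mfunc" +
  assumes str2_in: "X \<in> Ob C \<Longrightarrow> Y \<in> Ob C \<Longrightarrow>
      str2 F X Y \<in> hom D (obj F (X \<otimes>\<^bsub>C\<^esub> Y)) (obj F X \<otimes>\<^bsub>D\<^esub> obj F Y)"
    and str0_in: "str0 F \<in> hom D (obj F \<one>\<^bsub>C\<^esub>) \<one>\<^bsub>D\<^esub>"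
    and str2_natural: "f \<in> hom C X X' \<Longrightarrow> g \<in> hom C Y Y' \<Longrightarrow>
      str2 F X' Y' \<cdot>\<^bsub>D\<^esub> arr F (f \<boxtimes>\<^bsub>C\<^esub> g) = (arr F f \<boxtimes>\<^bsub>D\<^esub> arr F g) \<cdot>\<^bsub>D\<^esub> str2 F X Y"
    and str_coassoc: "X \<in> Ob C \<Longrightarrow> Y \<in> Ob C \<Longrightarrow> Z \<in> Ob C \<Longrightarrow>
      (str2 F X Y \<boxtimes>\<^bsub>D\<^esub> ident D (obj F Z)) \<cdot>\<^bsub>D\<^esub> str2 F (X \<otimes>\<^bsub>C\<^esub> Y) Z =
      (ident D (obj F X) \<boxtimes>\<^bsub>D\<^esub> str2 F Y Z) \<cdot>\<^bsub>D\<^esub> str2 F X (Y \<otimes>\<^bsub>C\<^esub> Z)"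
    and str_counit_right: "X \<in> Ob C \<Longrightarrow>
      (ident D (obj F X) \<boxtimes>\<^bsub>D\<^esub> str0 F) \<cdot>\<^bsub>D\<^esub> str2 F X \<one>\<^bsub>C\<^esub> = ident D (obj F X)"
    and str_counit_left: "X \<in> Ob C \<Longrightarrow>
      (str0 F \<boxtimes>\<^bsub>D\<^esub> ident D (obj F X)) \<cdot>\<^bsub>D\<^esub> str2 F \<one>\<^bsub>C\<^esub> X = ident D (obj F X)"

text \<open>A strong monoidal functor regarded as a (strong) comonoidal functor; \<open>D\<close> is the target category.\<close>

definition as_comonoidal ::
    "('p, 'b, 'z) moncat_scheme \<Rightarrow> ('o, 'a, 'p, 'b) mfunc \<Rightarrow> ('o, 'a, 'p, 'b) mfunc" where
  "as_comonoidal D F = with_str F (\<lambda>X Y. inv_ar D (str2 F X Y)) (inv_ar D (str0 F))"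

text \<open>\<open>E\<close> is the target category of \<open>G\<close>.\<close>

definition comp_monoidal ::
    "('q, 'c, 'z) moncat_scheme \<Rightarrow> ('p, 'b, 'q, 'c) mfunc \<Rightarrow> ('o, 'a, 'p, 'b) mfunc \<Rightarrow> ('o, 'a, 'q, 'c) mfunc"
  where "comp_monoidal E G F = with_str (comp_func G F)
     (\<lambda>X Y. arr G (str2 F X Y) \<cdot>\<^bsub>E\<^esub> str2 G (obj F X) (obj F Y))
     (arr G (str0 F) \<cdot>\<^bsub>E\<^esub> str0 G)"

definition comp_comonoidal ::
    "('q, 'c, 'z) moncat_scheme \<Rightarrow> ('p, 'b, 'q, 'c) mfunc \<Rightarrow> ('o, 'a, 'p, 'b) mfunc \<Rightarrow> ('o, 'a, 'q, 'c) mfunc"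
  where "comp_comonoidal E G F = with_str (comp_func G F)
     (\<lambda>X Y. str2 G (obj F X) (obj F Y) \<cdot>\<^bsub>E\<^esub> arr G (str2 F X Y))
     (str0 G \<cdot>\<^bsub>E\<^esub> arr G (str0 F))"

definition id_mfunc :: "('o, 'a, 'z) moncat_scheme \<Rightarrow> ('o, 'a, 'o, 'a) mfunc" where
  "id_mfunc C = with_str id_func (\<lambda>X Y. ident C (X \<otimes>\<^bsub>C\<^esub> Y)) (ident C \<one>\<^bsub>C\<^esub>)"

locale comonoidal_nat_trans =
  F: comonoidal_functor C D F + G: comonoidal_functor C D G + nat_trans C D F G \<phi>
  for C :: "('o, 'a, 'y) moncat_scheme" and D :: "('p, 'b, 'z) moncat_scheme"
    and F G :: "('o, 'a, 'p, 'b) mfunc" and \<phi> :: "'o \<Rightarrow> 'b" +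
  assumes component_str2: "X \<in> Ob C \<Longrightarrow> Y \<in> Ob C \<Longrightarrow>
      str2 G X Y \<cdot>\<^bsub>D\<^esub> \<phi> (X \<otimes>\<^bsub>C\<^esub> Y) = (\<phi> X \<boxtimes>\<^bsub>D\<^esub> \<phi> Y) \<cdot>\<^bsub>D\<^esub> str2 F X Y"
    and component_str0: "str0 G \<cdot>\<^bsub>D\<^esub> \<phi> \<one>\<^bsub>C\<^esub> = str0 F"

section \<open>Monads, bimonads and their modules\<close>

locale monad =
  unit: nat_trans C C id_func T \<eta> + mult: nat_trans C C "comp_func T T" T \<mu>
  for C :: "('o, 'a, 'z) cat_scheme" and T :: "('o, 'a, 'o, 'a, 'x) func_scheme"
    and \<mu> :: "'o \<Rightarrow> 'a" and \<eta> :: "'o \<Rightarrow> 'a" +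
  assumes monad_assoc: "X \<in> Ob C \<Longrightarrow> \<mu> X \<cdot>\<^bsub>C\<^esub> arr T (\<mu> X) = \<mu> X \<cdot>\<^bsub>C\<^esub> \<mu> (obj T X)"
    and monad_unit_left: "X \<in> Ob C \<Longrightarrow> \<mu> X \<cdot>\<^bsub>C\<^esub> \<eta> (obj T X) = ident C (obj T X)"
    and monad_unit_right: "X \<in> Ob C \<Longrightarrow> \<mu> X \<cdot>\<^bsub>C\<^esub> arr T (\<eta> X) = ident C (obj T X)"

locale bimonad =
  monad C T \<mu> \<eta> +
  comonoidal_functor C C T +
  mult: comonoidal_nat_trans C C "comp_comonoidal C T T" T \<mu> +
  unit: comonoidal_nat_trans C C "id_mfunc C" T \<eta>
  for C :: "('o, 'a, 'z) moncat_scheme" and T :: "('o, 'a, 'o, 'a) mfunc"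
    and \<mu> :: "'o \<Rightarrow> 'a" and \<eta> :: "'o \<Rightarrow> 'a"

text \<open>
  An arrow of the category of modules is a triple of its source module, the underlying arrow of
  \<open>C\<close> and its target module, since an arrow of \<open>C\<close> does not determine the actions.
\<close>

type_synonym ('o, 'a) module_ob = "'o \<times> 'a"
type_synonym ('o, 'a) module_ar = "('o \<times> 'a) \<times> 'a \<times> ('o \<times> 'a)"

definition T_modules ::
    "('o, 'a, 'z) moncat_scheme \<Rightarrow> ('o, 'a, 'o, 'a) mfunc \<Rightarrow> ('o \<Rightarrow> 'a) \<Rightarrow> ('o \<Rightarrow> 'a) \<Rightarrow>
      ('o, 'a) module_ob set" where
  "T_modules C T \<mu> \<eta> =
     {(M, r). M \<in> Ob C \<and> r \<in> hom C (obj T M) M \<and>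
       r \<cdot>\<^bsub>C\<^esub> arr T r = r \<cdot>\<^bsub>C\<^esub> \<mu> M \<and> r \<cdot>\<^bsub>C\<^esub> \<eta> M = ident C M}"

definition tensor_module ::
    "('o, 'a, 'z) moncat_scheme \<Rightarrow> ('o, 'a, 'o, 'a) mfunc \<Rightarrow>
      ('o, 'a) module_ob \<Rightarrow> ('o, 'a) module_ob \<Rightarrow> ('o, 'a) module_ob" where
  "tensor_module C T = (\<lambda>(M, r) (N, s). (M \<otimes>\<^bsub>C\<^esub> N, (r \<boxtimes>\<^bsub>C\<^esub> s) \<cdot>\<^bsub>C\<^esub> str2 T M N))"

definition module_cat ::
    "('o, 'a, 'z) moncat_scheme \<Rightarrow> ('o, 'a, 'o, 'a) mfunc \<Rightarrow> ('o \<Rightarrow> 'a) \<Rightarrow> ('o \<Rightarrow> 'a) \<Rightarrow>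
      (('o, 'a) module_ob, ('o, 'a) module_ar) moncat" where
  "module_cat C T \<mu> \<eta> =
    \<lparr>Ob = T_modules C T \<mu> \<eta>,
     Ar = {((M, r), f, (N, s)). (M, r) \<in> T_modules C T \<mu> \<eta> \<and> (N, s) \<in> T_modules C T \<mu> \<eta> \<and>
            f \<in> hom C M N \<and> f \<cdot>\<^bsub>C\<^esub> r = s \<cdot>\<^bsub>C\<^esub> arr T f},
     Dom = (\<lambda>(m, f, n). m),
     Cod = (\<lambda>(m, f, n). n),
     ident = (\<lambda>(M, r). ((M, r), ident C M, (M, r))),
     comp_ar = (\<lambda>(n', g, p) (m, f, n). (m, g \<cdot>\<^bsub>C\<^esub> f, p)),
     tensor_ob = tensor_module C T,
     tensor_ar = (\<lambda>(m, f, n) (m', f', n').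
        (tensor_module C T m m', f \<boxtimes>\<^bsub>C\<^esub> f', tensor_module C T n n')),
     unit_ob = (\<one>\<^bsub>C\<^esub>, str0 T)\<rparr>"

definition forgetful ::
    "('o, 'a, 'z) moncat_scheme \<Rightarrow> (('o, 'a) module_ob, ('o, 'a) module_ar, 'o, 'a) mfunc" where
  "forgetful C = \<lparr>obj = (\<lambda>(M, r). M), arr = (\<lambda>(m, f, n). f),
     str2 = (\<lambda>(M, r) (N, s). ident C (M \<otimes>\<^bsub>C\<^esub> N)), str0 = ident C \<one>\<^bsub>C\<^esub>\<rparr>"

definition free_module ::
    "('o, 'a, 'z) moncat_scheme \<Rightarrow> ('o, 'a, 'o, 'a) mfunc \<Rightarrow> ('o \<Rightarrow> 'a) \<Rightarrow>
      ('o, 'a, ('o, 'a) module_ob, ('o, 'a) module_ar) mfunc" where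
  "free_module C T \<mu> =
    \<lparr>obj = (\<lambda>X. (obj T X, \<mu> X)),
     arr = (\<lambda>f. ((obj T (Dom C f), \<mu> (Dom C f)), arr T f, (obj T (Cod C f), \<mu> (Cod C f)))),
     str2 = (\<lambda>X Y. ((obj T (X \<otimes>\<^bsub>C\<^esub> Y), \<mu> (X \<otimes>\<^bsub>C\<^esub> Y)), str2 T X Y,
                     tensor_module C T (obj T X, \<mu> X) (obj T Y, \<mu> Y))),
     str0 = ((obj T \<one>\<^bsub>C\<^esub>, \<mu> \<one>\<^bsub>C\<^esub>), str0 T, (\<one>\<^bsub>C\<^esub>, str0 T))\<rparr>"

section \<open>Structures induced by an adjunction with strong monoidal right adjoint\<close>

definition left_adjoint_comonoidal ::
    "('o, 'a, 'y) moncat_scheme \<Rightarrow> ('p, 'b, 'z) moncat_scheme \<Rightarrow> ('o, 'a, 'p, 'b) func \<Rightarrow>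
      ('p, 'b, 'o, 'a) mfunc \<Rightarrow> ('o \<Rightarrow> 'a) \<Rightarrow> ('p \<Rightarrow> 'b) \<Rightarrow> ('o, 'a, 'p, 'b) mfunc" where
  "left_adjoint_comonoidal C D F U \<eta> \<epsilon> = with_str F
     (\<lambda>X Y. \<epsilon> (obj F X \<otimes>\<^bsub>D\<^esub> obj F Y) \<cdot>\<^bsub>D\<^esub> arr F (str2 U (obj F X) (obj F Y)) \<cdot>\<^bsub>D\<^esub> arr F (\<eta> X \<boxtimes>\<^bsub>C\<^esub> \<eta> Y))
     (\<epsilon> \<one>\<^bsub>D\<^esub> \<cdot>\<^bsub>D\<^esub> arr F (str0 U))"

definition adjunction_mult ::
    "('o, 'a, 'p, 'b, 'x) func_scheme \<Rightarrow> ('p, 'b, 'o, 'a, 'w) func_scheme \<Rightarrow> ('p \<Rightarrow> 'b) \<Rightarrow> 'o \<Rightarrow> 'a" where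
  "adjunction_mult F U \<epsilon> X = arr U (\<epsilon> (obj F X))"

definition comparison_functor ::
    "('p, 'b, 'z) cat_scheme \<Rightarrow> ('p, 'b, 'o, 'a, 'w) func_scheme \<Rightarrow> ('p \<Rightarrow> 'b) \<Rightarrow>
      ('p, 'b, ('o, 'a) module_ob, ('o, 'a) module_ar) func" where
  "comparison_functor D U \<epsilon> =
    \<lparr>obj = (\<lambda>A. (obj U A, arr U (\<epsilon> A))),
     arr = (\<lambda>f. ((obj U (Dom D f), arr U (\<epsilon> (Dom D f))), arr U f,
                 (obj U (Cod D f), arr U (\<epsilon> (Cod D f)))))\<rparr>"

section \<open>Duals and Hopf monads\<close>

text \<open>A choice of duals; used both for left and for right duals.\<close>

record ('o, 'a) duals =
  dual :: "'o \<Rightarrow> 'o"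
  ev :: "'o \<Rightarrow> 'a"
  coev :: "'o \<Rightarrow> 'a"

locale left_autonomous = strict_monoidal_category C
  for C :: "('o, 'a, 'z) moncat_scheme" (structure) +
  fixes d :: "('o, 'a) duals"
  assumes dual_in: "X \<in> Ob C \<Longrightarrow> dual d X \<in> Ob C"
    and ev_in: "X \<in> Ob C \<Longrightarrow> ev d X \<in> hom C (dual d X \<otimes> X) \<one>"
    and coev_in: "X \<in> Ob C \<Longrightarrow> coev d X \<in> hom C \<one> (X \<otimes> dual d X)"
    and zigzag: "X \<in> Ob C \<Longrightarrow>
      (ident C X \<boxtimes> ev d X) \<cdot> (coev d X \<boxtimes> ident C X) = ident C X"
    and zigzag_dual: "X \<in> Ob C \<Longrightarrow>
      (ev d X \<boxtimes> ident C (dual d X)) \<cdot> (ident C (dual d X) \<boxtimes> coev d X) = ident C (dual d X)"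

locale right_autonomous = strict_monoidal_category C
  for C :: "('o, 'a, 'z) moncat_scheme" (structure) +
  fixes d :: "('o, 'a) duals"
  assumes dual_in: "X \<in> Ob C \<Longrightarrow> dual d X \<in> Ob C"
    and ev_in: "X \<in> Ob C \<Longrightarrow> ev d X \<in> hom C (X \<otimes> dual d X) \<one>"
    and coev_in: "X \<in> Ob C \<Longrightarrow> coev d X \<in> hom C \<one> (dual d X \<otimes> X)"
    and zigzag: "X \<in> Ob C \<Longrightarrow>
      (ev d X \<boxtimes> ident C X) \<cdot> (ident C X \<boxtimes> coev d X) = ident C X"
    and zigzag_dual: "X \<in> Ob C \<Longrightarrow>
      (ident C (dual d X) \<boxtimes> ev d X) \<cdot> (coev d X \<boxtimes> ident C (dual d X)) = ident C (dual d X)"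

text \<open>For \<open>f : X \<rightarrow> Y\<close>, the left and right dual arrows from the dual of \<open>Y\<close> to the dual of \<open>X\<close>.\<close>

definition left_dual_ar :: "('o, 'a, 'z) moncat_scheme \<Rightarrow> ('o, 'a) duals \<Rightarrow> 'a \<Rightarrow> 'a" where
  "left_dual_ar C d f =
     (ev d (Cod C f) \<boxtimes>\<^bsub>C\<^esub> ident C (dual d (Dom C f))) \<cdot>\<^bsub>C\<^esub>
     (ident C (dual d (Cod C f)) \<boxtimes>\<^bsub>C\<^esub> f \<boxtimes>\<^bsub>C\<^esub> ident C (dual d (Dom C f))) \<cdot>\<^bsub>C\<^esub>
     (ident C (dual d (Cod C f)) \<boxtimes>\<^bsub>C\<^esub> coev d (Dom C f))"

definition right_dual_ar :: "('o, 'a, 'z) moncat_scheme \<Rightarrow> ('o, 'a) duals \<Rightarrow> 'a \<Rightarrow> 'a" where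
  "right_dual_ar C d f =
     (ident C (dual d (Dom C f)) \<boxtimes>\<^bsub>C\<^esub> ev d (Cod C f)) \<cdot>\<^bsub>C\<^esub>
     (ident C (dual d (Dom C f)) \<boxtimes>\<^bsub>C\<^esub> f \<boxtimes>\<^bsub>C\<^esub> ident C (dual d (Cod C f))) \<cdot>\<^bsub>C\<^esub>
     (coev d (Dom C f) \<boxtimes>\<^bsub>C\<^esub> ident C (dual d (Cod C f)))"

locale left_antipode = bimonad C T \<mu> \<eta> + left_autonomous C d
  for C :: "('o, 'a, 'z) moncat_scheme" (structure) and d :: "('o, 'a) duals"
    and T :: "('o, 'a, 'o, 'a) mfunc" and \<mu> :: "'o \<Rightarrow> 'a" and \<eta> :: "'o \<Rightarrow> 'a" +
  fixes s :: "'o \<Rightarrow> 'a"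
  assumes antipode_in: "X \<in> Ob C \<Longrightarrow> s X \<in> hom C (obj T (dual d (obj T X))) (dual d X)"
    and antipode_natural: "f \<in> hom C X Y \<Longrightarrow>
      s X \<cdot> arr T (left_dual_ar C d (arr T f)) = left_dual_ar C d f \<cdot> s Y"
    and antipode_ev: "X \<in> Ob C \<Longrightarrow>
      str0 T \<cdot> arr T (ev d X) \<cdot> arr T (left_dual_ar C d (\<eta> X) \<boxtimes> ident C X) =
      ev d (obj T X) \<cdot> ((s (obj T X) \<cdot> arr T (left_dual_ar C d (\<mu> X))) \<boxtimes> ident C (obj T X)) \<cdot>
        str2 T (dual d (obj T X)) X"
    and antipode_coev: "X \<in> Ob C \<Longrightarrow>
      (\<eta> X \<boxtimes> ident C (dual d X)) \<cdot> coev d X \<cdot> str0 T =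
      (\<mu> X \<boxtimes> s X) \<cdot> str2 T (obj T X) (dual d (obj T X)) \<cdot> arr T (coev d (obj T X))"

locale right_antipode = bimonad C T \<mu> \<eta> + right_autonomous C d
  for C :: "('o, 'a, 'z) moncat_scheme" (structure) and d :: "('o, 'a) duals"
    and T :: "('o, 'a, 'o, 'a) mfunc" and \<mu> :: "'o \<Rightarrow> 'a" and \<eta> :: "'o \<Rightarrow> 'a" +
  fixes s :: "'o \<Rightarrow> 'a"
  assumes antipode_in: "X \<in> Ob C \<Longrightarrow> s X \<in> hom C (obj T (dual d (obj T X))) (dual d X)"
    and antipode_natural: "f \<in> hom C X Y \<Longrightarrow>
      s X \<cdot> arr T (right_dual_ar C d (arr T f)) = right_dual_ar C d f \<cdot> s Y"
    and antipode_ev: "X \<in> Ob C \<Longrightarrow>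
      str0 T \<cdot> arr T (ev d X) \<cdot> arr T (ident C X \<boxtimes> right_dual_ar C d (\<eta> X)) =
      ev d (obj T X) \<cdot> (ident C (obj T X) \<boxtimes> (s (obj T X) \<cdot> arr T (right_dual_ar C d (\<mu> X)))) \<cdot>
        str2 T X (dual d (obj T X))"
    and antipode_coev: "X \<in> Ob C \<Longrightarrow>
      (ident C (dual d X) \<boxtimes> \<eta> X) \<cdot> coev d X \<cdot> str0 T =
      (s X \<boxtimes> \<mu> X) \<cdot> str2 T (dual d (obj T X)) (obj T X) \<cdot> arr T (coev d (obj T X))"

definition left_Hopf_monad ::
    "('o, 'a, 'z) moncat_scheme \<Rightarrow> ('o, 'a) duals \<Rightarrow> ('o, 'a, 'o, 'a) mfunc \<Rightarrow>
      ('o \<Rightarrow> 'a) \<Rightarrow> ('o \<Rightarrow> 'a) \<Rightarrow> bool" where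
  "left_Hopf_monad C d T \<mu> \<eta> \<longleftrightarrow>
     bimonad C T \<mu> \<eta> \<and> left_autonomous C d \<and> (\<exists>s. left_antipode C d T \<mu> \<eta> s)"

definition right_Hopf_monad ::
    "('o, 'a, 'z) moncat_scheme \<Rightarrow> ('o, 'a) duals \<Rightarrow> ('o, 'a, 'o, 'a) mfunc \<Rightarrow>
      ('o \<Rightarrow> 'a) \<Rightarrow> ('o \<Rightarrow> 'a) \<Rightarrow> bool" where
  "right_Hopf_monad C d T \<mu> \<eta> \<longleftrightarrow>
     bimonad C T \<mu> \<eta> \<and> right_autonomous C d \<and> (\<exists>s. right_antipode C d T \<mu> \<eta> s)"

end

theory Submission
  imports Defs
begin

text \<open>
  An arrow \<open>F X \<rightarrow> A\<close> is determined by its transpose \<open>X \<rightarrow> U A\<close>, and the transposes of \<open>F\<^sub>2(X, Y)\<close> and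
  \<open>F\<^sub>0\<close> are \<open>U\<^sub>2(F X, F Y) (\<eta>\<^sub>X \<otimes> \<eta>\<^sub>Y)\<close> and \<open>U\<^sub>0\<close>. Transposing therefore turns the comonoidal axioms
  of \<open>F\<close> into the monoidal axioms of \<open>U\<close>. Likewise
  \<open>(\<epsilon>\<^sub>A \<otimes> \<epsilon>\<^sub>B) F\<^sub>2(U A, U B) = \<epsilon> F(U\<^sub>2(A, B))\<close>; this says that \<open>\<mu>\<close> is comonoidal, and also that
  \<open>U\<^sub>2\<close> is a morphism of modules, so that \<open>(U\<^sub>2, U\<^sub>0)\<close> is the monoidal structure of \<open>K\<close>.

  For the antipode, \<open>U\<close> maps the dual of \<open>F X\<close> to a dual of \<open>T X\<close>, which is isomorphic to the chosen one
  by some \<open>\<alpha>\<close>. The antipode is \<open>\<alpha>\<close> carried across the adjunction, followed by the dual of \<open>\<eta>\<^sub>X\<close>; its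
  axioms reduce to identities between transposes in \<open>D\<close>. The right-handed case is the left-handed one for the
  reversed tensor products.
\<close>

section \<open>Calculus in strict monoidal categories\<close>

text \<open>Two features shape the work: \<open>U\<close> is strong but not strict, and duals are
  chosen. The first puts an inverse of \<open>U_2\<close> into \<open>T_2\<close>, so equations
  involving \<open>T_2\<close> are compared after cancelling that inverse. The second means that the
  image of a chosen dual is not the chosen dual of the image. Duality data are therefore treated for
  arbitrary pairs, and an arrow into a dual is identified by its composite with the evaluation: the
  comparison \<open>\<alpha>\<close>, the dualised unit \<open>\<tau>\<close> and dual arrows each
  have one characterising evaluation equation. Coevaluation equations for \<open>\<alpha>\<close>
  and \<open>\<tau>\<close> then follow because mates with respect to evaluations are mates with
  respect to coevaluations.

  The structure of \<open>K\<close> leaves no choice: the forgetful functor is strict and module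
  morphisms are compared by their underlying arrows, so \<open>K_2\<close> and \<open>K_0\<close>
  must lie over \<open>U_2\<close> and \<open>U_0\<close>. The axioms are inherited from
  \<open>U\<close>, and invertibility too, since the inverse of a module morphism is again one. The
  underlying arrow of the inverse of \<open>K_2\<close> composed with \<open>K(F_2)\<close> is
  \<open>T_2\<close> by definition, which settles \<open>KF = F_T\<close>.\<close>

lemma in_hom_iff [simp]: "f \<in> hom C X Y \<longleftrightarrow> f \<in> Ar C \<and> Dom C f = X \<and> Cod C f = Y"
  by (auto simp: hom_def)

context category
begin

declare Dom_in [simp] Cod_in [simp]

lemma ident_simps [simp]:
  assumes "X \<in> Ob C"
  shows "ident C X \<in> Ar C" "Dom C (ident C X) = X" "Cod C (ident C X) = X"
  using ident_in[OF assms] by auto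

lemma comp_simps [simp]:
  assumes "f \<in> Ar C" "g \<in> Ar C" "Dom C g = Cod C f"
  shows "g \<cdot> f \<in> Ar C" "Dom C (g \<cdot> f) = Dom C f" "Cod C (g \<cdot> f) = Cod C g"
  using comp_in[of f "Dom C f" "Cod C f" g "Cod C g"] assms by auto

lemma comp_ident [simp]:
  "f \<in> Ar C \<Longrightarrow> Dom C f = X \<Longrightarrow> f \<cdot> ident C X = f"
  "f \<in> Ar C \<Longrightarrow> Cod C f = X \<Longrightarrow> ident C X \<cdot> f = f"
  using comp_ident_right[of f "Dom C f" "Cod C f"] comp_ident_left[of f "Dom C f" "Cod C f"] by auto

text \<open>As a rewrite rule it nests composites to the right, against the left-associated syntax
  of \<open>\<cdot>\<close>. Hence the \<open>_assoc\<close> variants of later rules, which act at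
  the head of a longer composite.\<close>

lemma comp_assoc_simp [simp]:
  assumes "f \<in> Ar C" "g \<in> Ar C" "h \<in> Ar C" "Dom C g = Cod C f" "Dom C h = Cod C g"
  shows "h \<cdot> g \<cdot> f = h \<cdot> (g \<cdot> f)"
  using comp_assoc[of f "Dom C f" "Cod C f" g "Cod C g" h "Cod C h"] assms by auto

lemma is_inverse_iff:
  "is_inverse C f g \<longleftrightarrow> g \<in> Ar C \<and> Dom C g = Cod C f \<and> Cod C g = Dom C f \<and>
     g \<cdot> f = ident C (Dom C f) \<and> f \<cdot> g = ident C (Cod C f)"
  by (auto simp: is_inverse_def)

lemma is_inverse_unique:
  assumes "f \<in> Ar C" "is_inverse C f g" "is_inverse C f h"
  shows "g = h"
proof -
  have "g = (g \<cdot> f) \<cdot> h" using assms unfolding is_inverse_iff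
    by (metis comp_assoc_simp comp_ident(1))
  also have "\<dots> = h" using assms unfolding is_inverse_iff by (simp del: comp_assoc_simp)
  finally show ?thesis .
qed

lemma inv_ar_eqI: "f \<in> Ar C \<Longrightarrow> is_inverse C f g \<Longrightarrow> inv_ar C f = g"
  unfolding inv_ar_def using is_inverse_unique by blast

lemma is_inverse_inv_ar: "is_iso C f \<Longrightarrow> is_inverse C f (inv_ar C f)"
  by (metis inv_ar_eqI is_iso_def)

lemma iso_in_Ar: "is_iso C f \<Longrightarrow> f \<in> Ar C"
  by (simp add: is_iso_def)

lemma inv_ar_simps [simp]:
  assumes "is_iso C f"
  shows "inv_ar C f \<in> Ar C" "Dom C (inv_ar C f) = Cod C f" "Cod C (inv_ar C f) = Dom C f"
    "inv_ar C f \<cdot> f = ident C (Dom C f)" "f \<cdot> inv_ar C f = ident C (Cod C f)"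
  using is_inverse_inv_ar[OF assms] by (auto simp: is_inverse_iff)

lemma inv_ar_cancel [simp]:
  assumes "is_iso C f" "g \<in> Ar C"
  shows "Cod C g = Dom C f \<Longrightarrow> inv_ar C f \<cdot> (f \<cdot> g) = g"
    "Cod C g = Cod C f \<Longrightarrow> f \<cdot> (inv_ar C f \<cdot> g) = g"
proof -
  have f: "f \<in> Ar C" using assms iso_in_Ar by blast
  show "Cod C g = Dom C f \<Longrightarrow> inv_ar C f \<cdot> (f \<cdot> g) = g"
    using assms f comp_assoc_simp[of g f "inv_ar C f"] by (simp del: comp_assoc_simp)
  show "Cod C g = Cod C f \<Longrightarrow> f \<cdot> (inv_ar C f \<cdot> g) = g"
    using assms f comp_assoc_simp[of g "inv_ar C f" f] by (simp del: comp_assoc_simp)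
qed

lemma iso_monic:
  assumes "is_iso C f" "g \<in> Ar C" "h \<in> Ar C" "Cod C g = Dom C f" "Cod C h = Dom C f"
    "f \<cdot> g = f \<cdot> h"
  shows "g = h"
  using assms inv_ar_cancel(1) by metis

text \<open>Carries an equation between two-factor composites to the head of a right-nested
  composite; the \<open>_assoc\<close> forms of interchange and naturality come from it.\<close>

lemma comp_left_assoc: "f \<in> Ar C \<Longrightarrow> g \<in> Ar C \<Longrightarrow> h \<in> Ar C \<Longrightarrow>
    Dom C g = Cod C f \<Longrightarrow> Dom C h = Cod C g \<Longrightarrow> k = h \<cdot> g \<Longrightarrow> h \<cdot> (g \<cdot> f) = k \<cdot> f"
  by simp

end

context strict_monoidal_category
begin

declare tensor_ob_in [simp] unit_ob_in [simp] tensor_ident [simp] tensor_ob_assoc [simp]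
  unit_ob_left [simp] unit_ob_right [simp] unit_ar_left [simp] unit_ar_right [simp]

lemma tensor_ar_simps [simp]:
  assumes "f \<in> Ar C" "g \<in> Ar C"
  shows "f \<boxtimes> g \<in> Ar C" "Dom C (f \<boxtimes> g) = Dom C f \<otimes> Dom C g" "Cod C (f \<boxtimes> g) = Cod C f \<otimes> Cod C g"
  using tensor_ar_in[of f "Dom C f" "Cod C f" g "Dom C g" "Cod C g"] assms by auto

text \<open>Interchange oriented so that consecutive tensor products fuse into one. Steps that have
  to split a tensor product or slide arrows past each other disable it locally or prove the split
  equation from its fused side.\<close>

lemma comp_tensor [simp]:
  assumes "f \<in> Ar C" "f' \<in> Ar C" "g \<in> Ar C" "g' \<in> Ar C" "Dom C f' = Cod C f" "Dom C g' = Cod C g"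
  shows "(f' \<boxtimes> g') \<cdot> (f \<boxtimes> g) = (f' \<cdot> f) \<boxtimes> (g' \<cdot> g)"
  using interchange[of f "Dom C f" "Cod C f" f' "Cod C f'" g "Dom C g" "Cod C g" g' "Cod C g'"] assms
  by auto

lemma comp_tensor_assoc [simp]:
  assumes "f \<in> Ar C" "f' \<in> Ar C" "g \<in> Ar C" "g' \<in> Ar C" "Dom C f' = Cod C f" "Dom C g' = Cod C g"
    "h \<in> Ar C" "Cod C h = Dom C f \<otimes> Dom C g"
  shows "(f' \<boxtimes> g') \<cdot> ((f \<boxtimes> g) \<cdot> h) = ((f' \<cdot> f) \<boxtimes> (g' \<cdot> g)) \<cdot> h"
  by (rule comp_left_assoc) (use assms in auto)

end

section \<open>Functors with structure\<close>

lemma func_simps [simp]: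
  "obj id_func X = X" "arr id_func f = f"
  "obj (comp_func G F) X = obj G (obj F X)" "arr (comp_func G F) f = arr G (arr F f)"
  by (simp_all add: id_func_def comp_func_def)

lemma with_str_simps [simp]:
  "obj (with_str F F2 F0) = obj F" "arr (with_str F F2 F0) = arr F"
  "str2 (with_str F F2 F0) = F2" "str0 (with_str F F2 F0) = F0"
  by (simp_all add: with_str_def)

lemma mfunc_simps [simp]:
  "obj (as_comonoidal D F) = obj F" "arr (as_comonoidal D F) = arr F"
  "str2 (as_comonoidal D F) X Y = inv_ar D (str2 F X Y)"
  "str0 (as_comonoidal D F) = inv_ar D (str0 F)"
  "obj (comp_monoidal E G H) X = obj G (obj H X)" "arr (comp_monoidal E G H) f = arr G (arr H f)"
  "str2 (comp_monoidal E G H) X Y = arr G (str2 H X Y) \<cdot>\<^bsub>E\<^esub> str2 G (obj H X) (obj H Y)"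
  "str0 (comp_monoidal E G H) = arr G (str0 H) \<cdot>\<^bsub>E\<^esub> str0 G"
  "obj (comp_comonoidal E G H) X = obj G (obj H X)" "arr (comp_comonoidal E G H) f = arr G (arr H f)"
  "str2 (comp_comonoidal E G H) X Y = str2 G (obj H X) (obj H Y) \<cdot>\<^bsub>E\<^esub> arr G (str2 H X Y)"
  "str0 (comp_comonoidal E G H) = str0 G \<cdot>\<^bsub>E\<^esub> arr G (str0 H)"
  "obj (id_mfunc C) X = X" "arr (id_mfunc C) h = h"
  "str2 (id_mfunc C) X Y = ident C (X \<otimes>\<^bsub>C\<^esub> Y)" "str0 (id_mfunc C) = ident C \<one>\<^bsub>C\<^esub>"
  by (simp_all add: as_comonoidal_def comp_monoidal_def comp_comonoidal_def id_mfunc_def)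

context cat_functor
begin

declare obj_in [simp] arr_ident [simp]

lemma arr_simps [simp]:
  assumes "f \<in> Ar C"
  shows "arr F f \<in> Ar D" "Dom D (arr F f) = obj F (Dom C f)" "Cod D (arr F f) = obj F (Cod C f)"
  using arr_in[of f "Dom C f" "Cod C f"] assms by auto

lemma arr_comp_simp [simp]:
  assumes "f \<in> Ar C" "g \<in> Ar C" "Dom C g = Cod C f"
  shows "arr F (g \<cdot>\<^bsub>C\<^esub> f) = arr F g \<cdot>\<^bsub>D\<^esub> arr F f"
  using arr_comp[of f "Dom C f" "Cod C f" g "Cod C g"] assms by auto

end

lemma cat_functor_comp:
  "cat_functor C D F \<Longrightarrow> cat_functor D E G \<Longrightarrow> cat_functor C E (comp_func G F)"
proof -
  assume "cat_functor C D F" "cat_functor D E G"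
  then interpret F: cat_functor C D F + G: cat_functor D E G by auto
  show ?thesis by unfold_locales auto
qed

context nat_trans
begin

lemma component_simps [simp]:
  assumes "X \<in> Ob C"
  shows "\<phi> X \<in> Ar D" "Dom D (\<phi> X) = obj F X" "Cod D (\<phi> X) = obj G X"
  using component_in[of X] assms by auto

lemma naturality:
  "f \<in> Ar C \<Longrightarrow> Dom C f = X \<Longrightarrow> Cod C f = Y \<Longrightarrow> \<phi> Y \<cdot>\<^bsub>D\<^esub> arr F f = arr G f \<cdot>\<^bsub>D\<^esub> \<phi> X"
  using natural[of f X Y] by simp

lemma naturality_assoc:
  "f \<in> Ar C \<Longrightarrow> Dom C f = X \<Longrightarrow> Cod C f = Y \<Longrightarrow> h \<in> Ar D \<Longrightarrow> Cod D h = obj F X \<Longrightarrow>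
    \<phi> Y \<cdot>\<^bsub>D\<^esub> (arr F f \<cdot>\<^bsub>D\<^esub> h) = arr G f \<cdot>\<^bsub>D\<^esub> (\<phi> X \<cdot>\<^bsub>D\<^esub> h)"
  using F.target.comp_left_assoc[of h "arr F f" "\<phi> Y" "arr G f \<cdot>\<^bsub>D\<^esub> \<phi> X"] naturality[of f X Y]
  by auto

end

context monoidal_functor
begin

lemma str_simps [simp]:
  "X \<in> Ob C \<Longrightarrow> Y \<in> Ob C \<Longrightarrow> str2 F X Y \<in> Ar D"
  "X \<in> Ob C \<Longrightarrow> Y \<in> Ob C \<Longrightarrow> Dom D (str2 F X Y) = obj F X \<otimes>\<^bsub>D\<^esub> obj F Y"
  "X \<in> Ob C \<Longrightarrow> Y \<in> Ob C \<Longrightarrow> Cod D (str2 F X Y) = obj F (X \<otimes>\<^bsub>C\<^esub> Y)"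
  "str0 F \<in> Ar D" "Dom D (str0 F) = \<one>\<^bsub>D\<^esub>" "Cod D (str0 F) = obj F \<one>\<^bsub>C\<^esub>"
  using str2_in[of X Y] str0_in by auto

lemma str2_naturality:
  "f \<in> Ar C \<Longrightarrow> g \<in> Ar C \<Longrightarrow> Dom C f = X \<Longrightarrow> Dom C g = Y \<Longrightarrow>
    arr F (f \<boxtimes>\<^bsub>C\<^esub> g) \<cdot>\<^bsub>D\<^esub> str2 F X Y = str2 F (Cod C f) (Cod C g) \<cdot>\<^bsub>D\<^esub> (arr F f \<boxtimes>\<^bsub>D\<^esub> arr F g)"
  using str2_natural[of f X "Cod C f" g Y "Cod C g"] by auto

lemma str2_naturality_assoc:
  "f \<in> Ar C \<Longrightarrow> g \<in> Ar C \<Longrightarrow> Dom C f = X \<Longrightarrow> Dom C g = Y \<Longrightarrow>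
    h \<in> Ar D \<Longrightarrow> Cod D h = obj F X \<otimes>\<^bsub>D\<^esub> obj F Y \<Longrightarrow>
    arr F (f \<boxtimes>\<^bsub>C\<^esub> g) \<cdot>\<^bsub>D\<^esub> (str2 F X Y \<cdot>\<^bsub>D\<^esub> h) =
      str2 F (Cod C f) (Cod C g) \<cdot>\<^bsub>D\<^esub> ((arr F f \<boxtimes>\<^bsub>D\<^esub> arr F g) \<cdot>\<^bsub>D\<^esub> h)"
  using target.comp_left_assoc[of h "str2 F X Y" "arr F (f \<boxtimes>\<^bsub>C\<^esub> g)"] str2_naturality[of f g X Y]
  by auto

end

context comonoidal_functor
begin

lemma str_simps [simp]:
  "X \<in> Ob C \<Longrightarrow> Y \<in> Ob C \<Longrightarrow> str2 F X Y \<in> Ar D"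
  "X \<in> Ob C \<Longrightarrow> Y \<in> Ob C \<Longrightarrow> Dom D (str2 F X Y) = obj F (X \<otimes>\<^bsub>C\<^esub> Y)"
  "X \<in> Ob C \<Longrightarrow> Y \<in> Ob C \<Longrightarrow> Cod D (str2 F X Y) = obj F X \<otimes>\<^bsub>D\<^esub> obj F Y"
  "str0 F \<in> Ar D" "Dom D (str0 F) = obj F \<one>\<^bsub>C\<^esub>" "Cod D (str0 F) = \<one>\<^bsub>D\<^esub>"
  using str2_in[of X Y] str0_in by auto

lemma str2_naturality:
  "f \<in> Ar C \<Longrightarrow> g \<in> Ar C \<Longrightarrow> Cod C f = X \<Longrightarrow> Cod C g = Y \<Longrightarrow>
    str2 F X Y \<cdot>\<^bsub>D\<^esub> arr F (f \<boxtimes>\<^bsub>C\<^esub> g) = (arr F f \<boxtimes>\<^bsub>D\<^esub> arr F g) \<cdot>\<^bsub>D\<^esub> str2 F (Dom C f) (Dom C g)"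
  using str2_natural[of f "Dom C f" X g "Dom C g" Y] by auto

lemma str2_naturality_assoc:
  "f \<in> Ar C \<Longrightarrow> g \<in> Ar C \<Longrightarrow> Cod C f = X \<Longrightarrow> Cod C g = Y \<Longrightarrow>
    h \<in> Ar D \<Longrightarrow> Cod D h = obj F (Dom C f \<otimes>\<^bsub>C\<^esub> Dom C g) \<Longrightarrow>
    str2 F X Y \<cdot>\<^bsub>D\<^esub> (arr F (f \<boxtimes>\<^bsub>C\<^esub> g) \<cdot>\<^bsub>D\<^esub> h) =
      (arr F f \<boxtimes>\<^bsub>D\<^esub> arr F g) \<cdot>\<^bsub>D\<^esub> (str2 F (Dom C f) (Dom C g) \<cdot>\<^bsub>D\<^esub> h)"
  using target.comp_left_assoc[of h "arr F (f \<boxtimes>\<^bsub>C\<^esub> g)" "str2 F X Y"] str2_naturality[of f g X Y]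
  by auto

end

text \<open>For coassociativity, the two sides are inverses of the two sides of
  \<open>str_assoc\<close>, and inverses are unique. The counit laws likewise exhibit an inverse of
  an identity arrow.\<close>

lemma (in strong_monoidal_functor) comonoidal_functor_as_comonoidal:
  "comonoidal_functor C D (as_comonoidal D F)"
proof
  note str2_iso [simp] str0_iso [simp]
  show "str2 (as_comonoidal D F) X Y \<in> hom D (obj (as_comonoidal D F) (X \<otimes>\<^bsub>C\<^esub> Y))
      (obj (as_comonoidal D F) X \<otimes>\<^bsub>D\<^esub> obj (as_comonoidal D F) Y)"
    if "X \<in> Ob C" "Y \<in> Ob C" for X Y
    using that by simp
  show "str0 (as_comonoidal D F) \<in> hom D (obj (as_comonoidal D F) \<one>\<^bsub>C\<^esub>) \<one>\<^bsub>D\<^esub>"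
    by simp
  show "str2 (as_comonoidal D F) X' Y' \<cdot>\<^bsub>D\<^esub> arr (as_comonoidal D F) (f \<boxtimes>\<^bsub>C\<^esub> g) =
      (arr (as_comonoidal D F) f \<boxtimes>\<^bsub>D\<^esub> arr (as_comonoidal D F) g) \<cdot>\<^bsub>D\<^esub> str2 (as_comonoidal D F) X Y"
    if fg: "f \<in> hom C X X'" "g \<in> hom C Y Y'" for f X X' g Y Y'
  proof -
    let ?V = "inv_ar D (str2 F X Y)" and ?V' = "inv_ar D (str2 F X' Y')"
    have X [simp]: "X \<in> Ob C" "X' \<in> Ob C" "Y \<in> Ob C" "Y' \<in> Ob C" using fg by auto
    \<comment> \<open>Inserting \<open>str2 F X Y\<close> followed by its inverse creates the place
      where naturality of \<open>str2 F\<close> applies.\<close>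
    have "?V' \<cdot>\<^bsub>D\<^esub> arr F (f \<boxtimes>\<^bsub>C\<^esub> g) = ?V' \<cdot>\<^bsub>D\<^esub> (arr F (f \<boxtimes>\<^bsub>C\<^esub> g) \<cdot>\<^bsub>D\<^esub> (str2 F X Y \<cdot>\<^bsub>D\<^esub> ?V))"
      using fg X by auto
    also have "\<dots> = (arr F f \<boxtimes>\<^bsub>D\<^esub> arr F g) \<cdot>\<^bsub>D\<^esub> ?V"
      using fg X by (simp add: str2_naturality_assoc del: target.inv_ar_simps(5))
    finally show ?thesis by simp
  qed
  show "(str2 (as_comonoidal D F) X Y \<boxtimes>\<^bsub>D\<^esub> ident D (obj (as_comonoidal D F) Z)) \<cdot>\<^bsub>D\<^esub>
        str2 (as_comonoidal D F) (X \<otimes>\<^bsub>C\<^esub> Y) Z =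
      (ident D (obj (as_comonoidal D F) X) \<boxtimes>\<^bsub>D\<^esub> str2 (as_comonoidal D F) Y Z) \<cdot>\<^bsub>D\<^esub>
        str2 (as_comonoidal D F) X (Y \<otimes>\<^bsub>C\<^esub> Z)"
    if [simp]: "X \<in> Ob C" "Y \<in> Ob C" "Z \<in> Ob C" for X Y Z
  proof -
    let ?u = "str2 F (X \<otimes>\<^bsub>C\<^esub> Y) Z \<cdot>\<^bsub>D\<^esub> (str2 F X Y \<boxtimes>\<^bsub>D\<^esub> ident D (obj F Z))"
    have "is_inverse D ?u ((inv_ar D (str2 F X Y) \<boxtimes>\<^bsub>D\<^esub> ident D (obj F Z)) \<cdot>\<^bsub>D\<^esub>
        inv_ar D (str2 F (X \<otimes>\<^bsub>C\<^esub> Y) Z))"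
      by (simp add: target.is_inverse_iff)
    moreover have "is_inverse D ?u ((ident D (obj F X) \<boxtimes>\<^bsub>D\<^esub> inv_ar D (str2 F Y Z)) \<cdot>\<^bsub>D\<^esub>
        inv_ar D (str2 F X (Y \<otimes>\<^bsub>C\<^esub> Z)))"
      unfolding str_assoc[OF that] by (simp add: target.is_inverse_iff)
    moreover have "?u \<in> Ar D" by simp
    ultimately show ?thesis using target.is_inverse_unique by fastforce
  qed
  show "(ident D (obj (as_comonoidal D F) X) \<boxtimes>\<^bsub>D\<^esub> str0 (as_comonoidal D F)) \<cdot>\<^bsub>D\<^esub>
      str2 (as_comonoidal D F) X \<one>\<^bsub>C\<^esub> = ident D (obj (as_comonoidal D F) X)"
    if [simp]: "X \<in> Ob C" for X
  proof -
    have "is_inverse D (str2 F X \<one>\<^bsub>C\<^esub> \<cdot>\<^bsub>D\<^esub> (ident D (obj F X) \<boxtimes>\<^bsub>D\<^esub> str0 F))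
        ((ident D (obj F X) \<boxtimes>\<^bsub>D\<^esub> inv_ar D (str0 F)) \<cdot>\<^bsub>D\<^esub> inv_ar D (str2 F X \<one>\<^bsub>C\<^esub>))"
      by (simp add: target.is_inverse_iff)
    then show ?thesis by (simp add: str_unit_right target.is_inverse_iff)
  qed
  show "(str0 (as_comonoidal D F) \<boxtimes>\<^bsub>D\<^esub> ident D (obj (as_comonoidal D F) X)) \<cdot>\<^bsub>D\<^esub>
      str2 (as_comonoidal D F) \<one>\<^bsub>C\<^esub> X = ident D (obj (as_comonoidal D F) X)"
    if [simp]: "X \<in> Ob C" for X
  proof -
    have "is_inverse D (str2 F \<one>\<^bsub>C\<^esub> X \<cdot>\<^bsub>D\<^esub> (str0 F \<boxtimes>\<^bsub>D\<^esub> ident D (obj F X)))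
        ((inv_ar D (str0 F) \<boxtimes>\<^bsub>D\<^esub> ident D (obj F X)) \<cdot>\<^bsub>D\<^esub> inv_ar D (str2 F \<one>\<^bsub>C\<^esub> X))"
      by (simp add: target.is_inverse_iff)
    then show ?thesis by (simp add: str_unit_left target.is_inverse_iff)
  qed
qed auto

text \<open>Naturality of \<open>str2 G\<close> moves it to the left of the images under
  \<open>G\<close>. Each axiom then splits into the axiom of \<open>G\<close> and the image under
  \<open>G\<close> of the axiom of \<open>F\<close>.\<close>

lemma comonoidal_functor_comp:
  assumes "comonoidal_functor C D F" "comonoidal_functor D E G"
  shows "comonoidal_functor C E (comp_comonoidal E G F)"
proof -
  interpret F: comonoidal_functor C D F by fact
  interpret G: comonoidal_functor D E G by fact
  show ?thesis
  proof
    show "str2 (comp_comonoidal E G F) X' Y' \<cdot>\<^bsub>E\<^esub> arr (comp_comonoidal E G F) (f \<boxtimes>\<^bsub>C\<^esub> g) =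
        (arr (comp_comonoidal E G F) f \<boxtimes>\<^bsub>E\<^esub> arr (comp_comonoidal E G F) g) \<cdot>\<^bsub>E\<^esub>
          str2 (comp_comonoidal E G F) X Y"
      if fg: "f \<in> hom C X X'" "g \<in> hom C Y Y'" for f X X' g Y Y'
    proof -
      have [simp]: "X \<in> Ob C" "X' \<in> Ob C" "Y \<in> Ob C" "Y' \<in> Ob C" using fg by auto
      have "arr G (str2 F X' Y') \<cdot>\<^bsub>E\<^esub> arr G (arr F (f \<boxtimes>\<^bsub>C\<^esub> g)) =
          arr G (str2 F X' Y' \<cdot>\<^bsub>D\<^esub> arr F (f \<boxtimes>\<^bsub>C\<^esub> g))"
        using fg by simp
      also have "\<dots> = arr G (arr F f \<boxtimes>\<^bsub>D\<^esub> arr F g) \<cdot>\<^bsub>E\<^esub> arr G (str2 F X Y)"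
        using fg by (simp add: F.str2_naturality)
      finally show ?thesis using fg by (simp add: G.str2_naturality_assoc)
    qed
    show "(str2 (comp_comonoidal E G F) X Y \<boxtimes>\<^bsub>E\<^esub> ident E (obj (comp_comonoidal E G F) Z)) \<cdot>\<^bsub>E\<^esub>
        str2 (comp_comonoidal E G F) (X \<otimes>\<^bsub>C\<^esub> Y) Z =
      (ident E (obj (comp_comonoidal E G F) X) \<boxtimes>\<^bsub>E\<^esub> str2 (comp_comonoidal E G F) Y Z) \<cdot>\<^bsub>E\<^esub>
        str2 (comp_comonoidal E G F) X (Y \<otimes>\<^bsub>C\<^esub> Z)"
      if [simp]: "X \<in> Ob C" "Y \<in> Ob C" "Z \<in> Ob C" for X Y Z
    proof -
      let ?G2 = "str2 G" and ?F2 = "str2 F" and ?i = "\<lambda>X. ident E (obj G (obj F X))"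
      have "((?G2 (obj F X) (obj F Y) \<cdot>\<^bsub>E\<^esub> arr G (?F2 X Y)) \<boxtimes>\<^bsub>E\<^esub> ?i Z) \<cdot>\<^bsub>E\<^esub>
          (?G2 (obj F (X \<otimes>\<^bsub>C\<^esub> Y)) (obj F Z) \<cdot>\<^bsub>E\<^esub> arr G (?F2 (X \<otimes>\<^bsub>C\<^esub> Y) Z)) =
        (?G2 (obj F X) (obj F Y) \<boxtimes>\<^bsub>E\<^esub> ?i Z) \<cdot>\<^bsub>E\<^esub> ?G2 (obj F X \<otimes>\<^bsub>D\<^esub> obj F Y) (obj F Z) \<cdot>\<^bsub>E\<^esub>
          arr G ((?F2 X Y \<boxtimes>\<^bsub>D\<^esub> ident D (obj F Z)) \<cdot>\<^bsub>D\<^esub> ?F2 (X \<otimes>\<^bsub>C\<^esub> Y) Z)"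
        by (simp add: G.str2_naturality_assoc)
      also have "\<dots> = (?i X \<boxtimes>\<^bsub>E\<^esub> ?G2 (obj F Y) (obj F Z)) \<cdot>\<^bsub>E\<^esub> ?G2 (obj F X) (obj F Y \<otimes>\<^bsub>D\<^esub> obj F Z) \<cdot>\<^bsub>E\<^esub>
          arr G ((ident D (obj F X) \<boxtimes>\<^bsub>D\<^esub> ?F2 Y Z) \<cdot>\<^bsub>D\<^esub> ?F2 X (Y \<otimes>\<^bsub>C\<^esub> Z))"
        by (subst G.str_coassoc, simp_all only: F.str_coassoc that F.obj_in)
      also have "\<dots> = (?i X \<boxtimes>\<^bsub>E\<^esub> (?G2 (obj F Y) (obj F Z) \<cdot>\<^bsub>E\<^esub> arr G (?F2 Y Z))) \<cdot>\<^bsub>E\<^esub>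
          (?G2 (obj F X) (obj F (Y \<otimes>\<^bsub>C\<^esub> Z)) \<cdot>\<^bsub>E\<^esub> arr G (?F2 X (Y \<otimes>\<^bsub>C\<^esub> Z)))"
        by (simp add: G.str2_naturality_assoc)
      finally show ?thesis by simp
    qed
    show "(ident E (obj (comp_comonoidal E G F) X) \<boxtimes>\<^bsub>E\<^esub> str0 (comp_comonoidal E G F)) \<cdot>\<^bsub>E\<^esub>
        str2 (comp_comonoidal E G F) X \<one>\<^bsub>C\<^esub> = ident E (obj (comp_comonoidal E G F) X)"
      if [simp]: "X \<in> Ob C" for X
    proof -
      let ?A = "obj F X"
      have "(ident E (obj G ?A) \<boxtimes>\<^bsub>E\<^esub> (str0 G \<cdot>\<^bsub>E\<^esub> arr G (str0 F))) \<cdot>\<^bsub>E\<^esub>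
          (str2 G ?A (obj F \<one>\<^bsub>C\<^esub>) \<cdot>\<^bsub>E\<^esub> arr G (str2 F X \<one>\<^bsub>C\<^esub>)) =
        ((ident E (obj G ?A) \<boxtimes>\<^bsub>E\<^esub> str0 G) \<cdot>\<^bsub>E\<^esub> str2 G ?A \<one>\<^bsub>D\<^esub>) \<cdot>\<^bsub>E\<^esub>
          arr G ((ident D ?A \<boxtimes>\<^bsub>D\<^esub> str0 F) \<cdot>\<^bsub>D\<^esub> str2 F X \<one>\<^bsub>C\<^esub>)"
        by (simp add: G.str2_naturality_assoc)
      also have "\<dots> = ident E (obj G ?A)"
        by (simp only: G.str_counit_right F.str_counit_right F.obj_in that) simp
      finally show ?thesis by simp
    qed
    show "(str0 (comp_comonoidal E G F) \<boxtimes>\<^bsub>E\<^esub> ident E (obj (comp_comonoidal E G F) X)) \<cdot>\<^bsub>E\<^esub>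
        str2 (comp_comonoidal E G F) \<one>\<^bsub>C\<^esub> X = ident E (obj (comp_comonoidal E G F) X)"
      if [simp]: "X \<in> Ob C" for X
    proof -
      let ?A = "obj F X"
      have "((str0 G \<cdot>\<^bsub>E\<^esub> arr G (str0 F)) \<boxtimes>\<^bsub>E\<^esub> ident E (obj G ?A)) \<cdot>\<^bsub>E\<^esub>
          (str2 G (obj F \<one>\<^bsub>C\<^esub>) ?A \<cdot>\<^bsub>E\<^esub> arr G (str2 F \<one>\<^bsub>C\<^esub> X)) =
        ((str0 G \<boxtimes>\<^bsub>E\<^esub> ident E (obj G ?A)) \<cdot>\<^bsub>E\<^esub> str2 G \<one>\<^bsub>D\<^esub> ?A) \<cdot>\<^bsub>E\<^esub>
          arr G ((str0 F \<boxtimes>\<^bsub>D\<^esub> ident D ?A) \<cdot>\<^bsub>D\<^esub> str2 F \<one>\<^bsub>C\<^esub> X)"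
        by (simp add: G.str2_naturality_assoc)
      also have "\<dots> = ident E (obj G ?A)"
        by (simp only: G.str_counit_left F.str_counit_left F.obj_in that) simp
      finally show ?thesis by simp
    qed
  qed auto
qed

section \<open>Modules over a bimonad\<close>

lemma module_cat_simps [simp]:
  "Ob (module_cat C T \<mu> \<eta>) = T_modules C T \<mu> \<eta>"
  "Dom (module_cat C T \<mu> \<eta>) (m, f, n) = m" "Cod (module_cat C T \<mu> \<eta>) (m, f, n) = n"
  "ident (module_cat C T \<mu> \<eta>) m = (m, ident C (fst m), m)"
  "comp_ar (module_cat C T \<mu> \<eta>) (n', g, p) (m, f, n) = (m, g \<cdot>\<^bsub>C\<^esub> f, p)"
  "tensor_ob (module_cat C T \<mu> \<eta>) = tensor_module C T"
  "tensor_ar (module_cat C T \<mu> \<eta>) (m, f, n) (m', f', n') =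
     (tensor_module C T m m', f \<boxtimes>\<^bsub>C\<^esub> f', tensor_module C T n n')"
  "unit_ob (module_cat C T \<mu> \<eta>) = (\<one>\<^bsub>C\<^esub>, str0 T)"
  by (simp_all add: module_cat_def split_beta)

lemma module_cat_Ar:
  "(m, f, n) \<in> Ar (module_cat C T \<mu> \<eta>) \<longleftrightarrow> m \<in> T_modules C T \<mu> \<eta> \<and> n \<in> T_modules C T \<mu> \<eta> \<and>
     f \<in> hom C (fst m) (fst n) \<and> f \<cdot>\<^bsub>C\<^esub> snd m = snd n \<cdot>\<^bsub>C\<^esub> arr T f"
  by (cases m; cases n) (simp add: module_cat_def)

lemma T_modules_iff:
  "m \<in> T_modules C T \<mu> \<eta> \<longleftrightarrow> fst m \<in> Ob C \<and> snd m \<in> hom C (obj T (fst m)) (fst m) \<and>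
     snd m \<cdot>\<^bsub>C\<^esub> arr T (snd m) = snd m \<cdot>\<^bsub>C\<^esub> \<mu> (fst m) \<and> snd m \<cdot>\<^bsub>C\<^esub> \<eta> (fst m) = ident C (fst m)"
  by (cases m) (simp add: T_modules_def)

lemma tensor_module_simps [simp]:
  "fst (tensor_module C T m n) = fst m \<otimes>\<^bsub>C\<^esub> fst n"
  "snd (tensor_module C T m n) = (snd m \<boxtimes>\<^bsub>C\<^esub> snd n) \<cdot>\<^bsub>C\<^esub> str2 T (fst m) (fst n)"
  by (simp_all add: tensor_module_def split_beta)

context bimonad
begin

lemma mult_str2:
  assumes "X \<in> Ob C" "Y \<in> Ob C"
  shows "str2 T X Y \<cdot>\<^bsub>C\<^esub> \<mu> (X \<otimes>\<^bsub>C\<^esub> Y) =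
    (\<mu> X \<boxtimes>\<^bsub>C\<^esub> \<mu> Y) \<cdot>\<^bsub>C\<^esub> (str2 T (obj T X) (obj T Y) \<cdot>\<^bsub>C\<^esub> arr T (str2 T X Y))"
  using mult.component_str2[OF assms] by simp

lemma unit_str2:
  assumes "X \<in> Ob C" "Y \<in> Ob C"
  shows "str2 T X Y \<cdot>\<^bsub>C\<^esub> \<eta> (X \<otimes>\<^bsub>C\<^esub> Y) = \<eta> X \<boxtimes>\<^bsub>C\<^esub> \<eta> Y"
  using unit.component_str2[OF assms] assms by simp

text \<open>The associativity of the tensor action is the compatibility of \<open>\<mu>\<close> with
  \<open>T_2\<close>, its unit law that of \<open>\<eta>\<close>.\<close>

lemma tensor_module_in:
  assumes "m \<in> T_modules C T \<mu> \<eta>" "n \<in> T_modules C T \<mu> \<eta>"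
  shows "tensor_module C T m n \<in> T_modules C T \<mu> \<eta>"
proof -
  obtain M r N s where mn: "m = (M, r)" "n = (N, s)" by fastforce
  then have [simp]: "M \<in> Ob C" "N \<in> Ob C" "r \<in> Ar C" "Dom C r = obj T M" "Cod C r = M"
    "s \<in> Ar C" "Dom C s = obj T N" "Cod C s = N"
    and r: "r \<cdot>\<^bsub>C\<^esub> arr T r = r \<cdot>\<^bsub>C\<^esub> \<mu> M" "r \<cdot>\<^bsub>C\<^esub> \<eta> M = ident C M"
    and s: "s \<cdot>\<^bsub>C\<^esub> arr T s = s \<cdot>\<^bsub>C\<^esub> \<mu> N" "s \<cdot>\<^bsub>C\<^esub> \<eta> N = ident C N"
    using assms by (auto simp: T_modules_def)
  have "(r \<boxtimes>\<^bsub>C\<^esub> s) \<cdot>\<^bsub>C\<^esub> str2 T M N \<cdot>\<^bsub>C\<^esub> arr T ((r \<boxtimes>\<^bsub>C\<^esub> s) \<cdot>\<^bsub>C\<^esub> str2 T M N) =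
      (r \<boxtimes>\<^bsub>C\<^esub> s) \<cdot>\<^bsub>C\<^esub> str2 T M N \<cdot>\<^bsub>C\<^esub> \<mu> (M \<otimes>\<^bsub>C\<^esub> N)"
    by (simp add: mult_str2 str2_naturality_assoc r s)
  moreover have "(r \<boxtimes>\<^bsub>C\<^esub> s) \<cdot>\<^bsub>C\<^esub> str2 T M N \<cdot>\<^bsub>C\<^esub> \<eta> (M \<otimes>\<^bsub>C\<^esub> N) = ident C (M \<otimes>\<^bsub>C\<^esub> N)"
    by (simp add: unit_str2 r s)
  ultimately show ?thesis unfolding mn by (simp add: T_modules_iff)
qed

lemma unit_module_in: "(\<one>\<^bsub>C\<^esub>, str0 T) \<in> T_modules C T \<mu> \<eta>"
  using mult.component_str0 unit.component_str0 by (simp add: T_modules_iff)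

text \<open>The underlying objects agree because \<open>C\<close> is strict, the actions by
  coassociativity of \<open>T_2\<close>. An equality of modules, not just an isomorphism, is what
  makes the category of modules strict.\<close>

lemma tensor_module_assoc:
  assumes "m \<in> T_modules C T \<mu> \<eta>" "n \<in> T_modules C T \<mu> \<eta>" "p \<in> T_modules C T \<mu> \<eta>"
  shows "tensor_module C T (tensor_module C T m n) p = tensor_module C T m (tensor_module C T n p)"
proof -
  obtain M r N s P t where mnp: "m = (M, r)" "n = (N, s)" "p = (P, t)" by fastforce
  then have [simp]: "M \<in> Ob C" "N \<in> Ob C" "P \<in> Ob C" "r \<in> Ar C" "Dom C r = obj T M" "Cod C r = M"
    "s \<in> Ar C" "Dom C s = obj T N" "Cod C s = N" "t \<in> Ar C" "Dom C t = obj T P" "Cod C t = P"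
    using assms by (auto simp: T_modules_def)
  have "(((r \<boxtimes>\<^bsub>C\<^esub> s) \<cdot>\<^bsub>C\<^esub> str2 T M N) \<boxtimes>\<^bsub>C\<^esub> t) \<cdot>\<^bsub>C\<^esub> str2 T (M \<otimes>\<^bsub>C\<^esub> N) P =
      ((r \<boxtimes>\<^bsub>C\<^esub> s) \<boxtimes>\<^bsub>C\<^esub> t) \<cdot>\<^bsub>C\<^esub> ((str2 T M N \<boxtimes>\<^bsub>C\<^esub> ident C (obj T P)) \<cdot>\<^bsub>C\<^esub> str2 T (M \<otimes>\<^bsub>C\<^esub> N) P)"
    by simp
  also have "\<dots> = (r \<boxtimes>\<^bsub>C\<^esub> (s \<boxtimes>\<^bsub>C\<^esub> t)) \<cdot>\<^bsub>C\<^esub>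
      ((ident C (obj T M) \<boxtimes>\<^bsub>C\<^esub> str2 T N P) \<cdot>\<^bsub>C\<^esub> str2 T M (N \<otimes>\<^bsub>C\<^esub> P))"
    by (simp only: source.tensor_ar_assoc str_coassoc \<open>r \<in> Ar C\<close> \<open>s \<in> Ar C\<close> \<open>t \<in> Ar C\<close>
        \<open>M \<in> Ob C\<close> \<open>N \<in> Ob C\<close> \<open>P \<in> Ob C\<close>)
  also have "\<dots> = (r \<boxtimes>\<^bsub>C\<^esub> ((s \<boxtimes>\<^bsub>C\<^esub> t) \<cdot>\<^bsub>C\<^esub> str2 T N P)) \<cdot>\<^bsub>C\<^esub> str2 T M (N \<otimes>\<^bsub>C\<^esub> P)"
    by simp
  finally show ?thesis unfolding mnp tensor_module_def by simp
qed

lemma tensor_unit_module: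
  assumes "m \<in> T_modules C T \<mu> \<eta>"
  shows "tensor_module C T m (\<one>\<^bsub>C\<^esub>, str0 T) = m" "tensor_module C T (\<one>\<^bsub>C\<^esub>, str0 T) m = m"
proof -
  obtain M r where m: "m = (M, r)" by fastforce
  then have [simp]: "M \<in> Ob C" "r \<in> Ar C" "Dom C r = obj T M" "Cod C r = M"
    using assms by (auto simp: T_modules_def)
  have "(r \<boxtimes>\<^bsub>C\<^esub> str0 T) \<cdot>\<^bsub>C\<^esub> str2 T M \<one>\<^bsub>C\<^esub> =
      (r \<boxtimes>\<^bsub>C\<^esub> ident C \<one>\<^bsub>C\<^esub>) \<cdot>\<^bsub>C\<^esub> ((ident C (obj T M) \<boxtimes>\<^bsub>C\<^esub> str0 T) \<cdot>\<^bsub>C\<^esub> str2 T M \<one>\<^bsub>C\<^esub>)"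
    by (simp del: source.unit_ar_right)
  also have "\<dots> = r" unfolding str_counit_right[OF \<open>M \<in> Ob C\<close>] by simp
  finally show "tensor_module C T m (\<one>\<^bsub>C\<^esub>, str0 T) = m" by (simp add: m tensor_module_def)
  have "(str0 T \<boxtimes>\<^bsub>C\<^esub> r) \<cdot>\<^bsub>C\<^esub> str2 T \<one>\<^bsub>C\<^esub> M =
      (ident C \<one>\<^bsub>C\<^esub> \<boxtimes>\<^bsub>C\<^esub> r) \<cdot>\<^bsub>C\<^esub> ((str0 T \<boxtimes>\<^bsub>C\<^esub> ident C (obj T M)) \<cdot>\<^bsub>C\<^esub> str2 T \<one>\<^bsub>C\<^esub> M)"
    by (simp del: source.unit_ar_left)
  also have "\<dots> = r" unfolding str_counit_left[OF \<open>M \<in> Ob C\<close>] by simp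
  finally show "tensor_module C T (\<one>\<^bsub>C\<^esub>, str0 T) m = m" by (simp add: m tensor_module_def)
qed

lemma tensor_module_ar:
  assumes "(m, f, n) \<in> Ar (module_cat C T \<mu> \<eta>)" "(m', f', n') \<in> Ar (module_cat C T \<mu> \<eta>)"
  shows "(tensor_module C T m m', f \<boxtimes>\<^bsub>C\<^esub> f', tensor_module C T n n') \<in> Ar (module_cat C T \<mu> \<eta>)"
proof -
  have [simp]: "f \<in> Ar C" "Dom C f = fst m" "Cod C f = fst n"
    "f' \<in> Ar C" "Dom C f' = fst m'" "Cod C f' = fst n'"
    "fst m \<in> Ob C" "fst n \<in> Ob C" "fst m' \<in> Ob C" "fst n' \<in> Ob C"
    "snd m \<in> Ar C" "Dom C (snd m) = obj T (fst m)" "Cod C (snd m) = fst m"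
    "snd n \<in> Ar C" "Dom C (snd n) = obj T (fst n)" "Cod C (snd n) = fst n"
    "snd m' \<in> Ar C" "Dom C (snd m') = obj T (fst m')" "Cod C (snd m') = fst m'"
    "snd n' \<in> Ar C" "Dom C (snd n') = obj T (fst n')" "Cod C (snd n') = fst n'"
    and f: "f \<cdot>\<^bsub>C\<^esub> snd m = snd n \<cdot>\<^bsub>C\<^esub> arr T f" "f' \<cdot>\<^bsub>C\<^esub> snd m' = snd n' \<cdot>\<^bsub>C\<^esub> arr T f'"
    using assms by (auto simp: module_cat_Ar T_modules_iff)
  have "(f \<boxtimes>\<^bsub>C\<^esub> f') \<cdot>\<^bsub>C\<^esub> ((snd m \<boxtimes>\<^bsub>C\<^esub> snd m') \<cdot>\<^bsub>C\<^esub> str2 T (fst m) (fst m')) =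
    (snd n \<boxtimes>\<^bsub>C\<^esub> snd n') \<cdot>\<^bsub>C\<^esub> str2 T (fst n) (fst n') \<cdot>\<^bsub>C\<^esub> arr T (f \<boxtimes>\<^bsub>C\<^esub> f')"
    by (simp add: str2_naturality f)
  then show ?thesis using assms by (simp add: module_cat_Ar tensor_module_in)
qed

lemma module_cat_ArE:
  assumes "f \<in> Ar (module_cat C T \<mu> \<eta>)"
  obtains m a n where "f = (m, a, n)" "m \<in> T_modules C T \<mu> \<eta>" "n \<in> T_modules C T \<mu> \<eta>"
    "a \<in> Ar C" "Dom C a = fst m" "Cod C a = fst n" "a \<cdot>\<^bsub>C\<^esub> snd m = snd n \<cdot>\<^bsub>C\<^esub> arr T a"
    "fst m \<in> Ob C" "fst n \<in> Ob C"
  using assms by (cases f) (auto simp: module_cat_Ar T_modules_iff)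

lemma module_ident_in: "m \<in> T_modules C T \<mu> \<eta> \<Longrightarrow> (m, ident C (fst m), m) \<in> Ar (module_cat C T \<mu> \<eta>)"
  by (auto simp: module_cat_Ar T_modules_iff)

lemma module_comp_in:
  assumes "(m, a, n) \<in> Ar (module_cat C T \<mu> \<eta>)" "(n, b, p) \<in> Ar (module_cat C T \<mu> \<eta>)"
  shows "(m, b \<cdot>\<^bsub>C\<^esub> a, p) \<in> Ar (module_cat C T \<mu> \<eta>)"
proof -
  have [simp]: "a \<in> Ar C" "Dom C a = fst m" "Cod C a = fst n"
    "b \<in> Ar C" "Dom C b = fst n" "Cod C b = fst p" "fst m \<in> Ob C" "fst n \<in> Ob C" "fst p \<in> Ob C"
    "snd m \<in> Ar C" "Dom C (snd m) = obj T (fst m)" "Cod C (snd m) = fst m"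
    "snd n \<in> Ar C" "Dom C (snd n) = obj T (fst n)" "Cod C (snd n) = fst n"
    "snd p \<in> Ar C" "Dom C (snd p) = obj T (fst p)" "Cod C (snd p) = fst p"
    and ab: "a \<cdot>\<^bsub>C\<^esub> snd m = snd n \<cdot>\<^bsub>C\<^esub> arr T a" "b \<cdot>\<^bsub>C\<^esub> snd n = snd p \<cdot>\<^bsub>C\<^esub> arr T b"
    using assms by (auto simp: module_cat_Ar T_modules_iff)
  have "b \<cdot>\<^bsub>C\<^esub> a \<cdot>\<^bsub>C\<^esub> snd m = (b \<cdot>\<^bsub>C\<^esub> snd n) \<cdot>\<^bsub>C\<^esub> arr T a" by (simp add: ab(1))
  also have "\<dots> = snd p \<cdot>\<^bsub>C\<^esub> arr T (b \<cdot>\<^bsub>C\<^esub> a)" unfolding ab(2) by simp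
  finally show ?thesis using assms by (simp add: module_cat_Ar)
qed

lemma category_module_cat: "category (module_cat C T \<mu> \<eta>)"
proof
  let ?M = "module_cat C T \<mu> \<eta>"
  show "Dom ?M f \<in> Ob ?M" "Cod ?M f \<in> Ob ?M" if "f \<in> Ar ?M" for f
    using that by (auto elim: module_cat_ArE)
  show "ident ?M X \<in> hom ?M X X" if "X \<in> Ob ?M" for X
    using that module_ident_in by simp
  show "g \<cdot>\<^bsub>?M\<^esub> f \<in> hom ?M X Z" if "f \<in> hom ?M X Y" "g \<in> hom ?M Y Z" for f g X Y Z
    using that module_comp_in by (cases f; cases g) auto
  show "f \<cdot>\<^bsub>?M\<^esub> ident ?M X = f" "ident ?M Y \<cdot>\<^bsub>?M\<^esub> f = f" if "f \<in> hom ?M X Y" for f X Y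
    using that by (auto elim!: module_cat_ArE)
  show "h \<cdot>\<^bsub>?M\<^esub> g \<cdot>\<^bsub>?M\<^esub> f = h \<cdot>\<^bsub>?M\<^esub> (g \<cdot>\<^bsub>?M\<^esub> f)"
    if "f \<in> hom ?M W X" "g \<in> hom ?M X Y" "h \<in> hom ?M Y Z" for f g h W X Y Z
    using that unfolding in_hom_iff by (elim conjE module_cat_ArE) simp
qed

lemma strict_monoidal_category_module_cat: "strict_monoidal_category (module_cat C T \<mu> \<eta>)"
proof -
  let ?M = "module_cat C T \<mu> \<eta>"
  interpret M: category ?M by (rule category_module_cat)
  show ?thesis
  proof
    show "X \<otimes>\<^bsub>?M\<^esub> Y \<in> Ob ?M" if "X \<in> Ob ?M" "Y \<in> Ob ?M" for X Y
      using that by (simp add: tensor_module_in)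
    show "\<one>\<^bsub>?M\<^esub> \<in> Ob ?M" by (simp add: unit_module_in)
    show "f \<boxtimes>\<^bsub>?M\<^esub> g \<in> hom ?M (X \<otimes>\<^bsub>?M\<^esub> Y) (X' \<otimes>\<^bsub>?M\<^esub> Y')"
      if "f \<in> hom ?M X X'" "g \<in> hom ?M Y Y'" for f g X X' Y Y'
      using that tensor_module_ar by (cases f; cases g) auto
    show "ident ?M X \<boxtimes>\<^bsub>?M\<^esub> ident ?M Y = ident ?M (X \<otimes>\<^bsub>?M\<^esub> Y)" if "X \<in> Ob ?M" "Y \<in> Ob ?M" for X Y
      using that by (simp add: T_modules_iff)
    show "(f' \<cdot>\<^bsub>?M\<^esub> f) \<boxtimes>\<^bsub>?M\<^esub> (g' \<cdot>\<^bsub>?M\<^esub> g) = (f' \<boxtimes>\<^bsub>?M\<^esub> g') \<cdot>\<^bsub>?M\<^esub> (f \<boxtimes>\<^bsub>?M\<^esub> g)"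
      if "f \<in> hom ?M X X'" "f' \<in> hom ?M X' X''" "g \<in> hom ?M Y Y'" "g' \<in> hom ?M Y' Y''"
      for f f' g g' X X' X'' Y Y' Y''
      using that unfolding in_hom_iff by (elim conjE module_cat_ArE) simp
    show "X \<otimes>\<^bsub>?M\<^esub> Y \<otimes>\<^bsub>?M\<^esub> Z = X \<otimes>\<^bsub>?M\<^esub> (Y \<otimes>\<^bsub>?M\<^esub> Z)"
      if "X \<in> Ob ?M" "Y \<in> Ob ?M" "Z \<in> Ob ?M" for X Y Z
      using that by (simp add: tensor_module_assoc)
    show "f \<boxtimes>\<^bsub>?M\<^esub> g \<boxtimes>\<^bsub>?M\<^esub> h = f \<boxtimes>\<^bsub>?M\<^esub> (g \<boxtimes>\<^bsub>?M\<^esub> h)" if "f \<in> Ar ?M" "g \<in> Ar ?M" "h \<in> Ar ?M" for f g h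
      using that by (elim module_cat_ArE) (simp add: tensor_module_assoc source.tensor_ar_assoc)
    show "\<one>\<^bsub>?M\<^esub> \<otimes>\<^bsub>?M\<^esub> X = X" "X \<otimes>\<^bsub>?M\<^esub> \<one>\<^bsub>?M\<^esub> = X" if "X \<in> Ob ?M" for X
      using that by (simp_all add: tensor_unit_module)
    show "ident ?M \<one>\<^bsub>?M\<^esub> \<boxtimes>\<^bsub>?M\<^esub> f = f" "f \<boxtimes>\<^bsub>?M\<^esub> ident ?M \<one>\<^bsub>?M\<^esub> = f" if "f \<in> Ar ?M" for f
      using that by (elim module_cat_ArE; simp add: tensor_unit_module)+
  qed
qed

end

section \<open>The adjunction\<close>

locale strong_monoidal_adjunction =
  U: strong_monoidal_functor D C U + adj: adjunction C D F U \<eta> \<epsilon>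
  for C :: "('o, 'a) moncat" and D :: "('p, 'b) moncat"
    and U :: "('p, 'b, 'o, 'a) mfunc" and F :: "('o, 'a, 'p, 'b) func"
    and \<eta> :: "'o \<Rightarrow> 'a" and \<epsilon> :: "'p \<Rightarrow> 'b"
begin

declare U.str2_iso [simp] U.str0_iso [simp]

definition F' where "F' = left_adjoint_comonoidal C D F U \<eta> \<epsilon>"
definition T where "T = comp_comonoidal C (as_comonoidal C U) F'"
definition \<mu> where "\<mu> = adjunction_mult F U \<epsilon>"

lemma F'_simps [simp]: "obj F' = obj F" "arr F' = arr F"
  by (simp_all add: F'_def left_adjoint_comonoidal_def)

lemma T_simps [simp]:
  "obj T X = obj U (obj F X)" "arr T f = arr U (arr F f)"
  "str2 T X Y = inv_ar C (str2 U (obj F X) (obj F Y)) \<cdot>\<^bsub>C\<^esub> arr U (str2 F' X Y)"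
  "str0 T = inv_ar C (str0 U) \<cdot>\<^bsub>C\<^esub> arr U (str0 F')"
  by (simp_all add: T_def)

lemma \<mu>_simp [simp]: "\<mu> X = arr U (\<epsilon> (obj F X))"
  by (simp add: \<mu>_def adjunction_mult_def)

section \<open>Transposition across the adjunction\<close>

lemma transpose_inject:
  assumes "f \<in> Ar D" "g \<in> Ar D" "Dom D f = obj F X" "Dom D g = obj F X" "Cod D f = Cod D g"
    "X \<in> Ob C" "arr U f \<cdot>\<^bsub>C\<^esub> \<eta> X = arr U g \<cdot>\<^bsub>C\<^esub> \<eta> X"
  shows "f = g"
proof -
  \<comment> \<open>Recovers \<open>h\<close> from its transpose: naturality of
    \<open>\<epsilon>\<close> at \<open>h\<close>, then the triangle identity at
    \<open>X\<close>.\<close>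
  have *: "h = \<epsilon> (Cod D h) \<cdot>\<^bsub>D\<^esub> arr F (arr U h \<cdot>\<^bsub>C\<^esub> \<eta> X)" if "h \<in> Ar D" "Dom D h = obj F X" for h
  proof -
    have "\<epsilon> (Cod D h) \<cdot>\<^bsub>D\<^esub> arr F (arr U h \<cdot>\<^bsub>C\<^esub> \<eta> X) = h \<cdot>\<^bsub>D\<^esub> (\<epsilon> (obj F X) \<cdot>\<^bsub>D\<^esub> arr F (\<eta> X))"
      using that assms(6) adj.counit.naturality_assoc[of h "obj F X" "Cod D h" "arr F (\<eta> X)"] by simp
    then show ?thesis using that assms(6) by (simp add: adj.triangle_left)
  qed
  show ?thesis using *[of f] *[of g] assms by simp
qed

text \<open>Naturality of \<open>\<eta>\<close> at \<open>h\<close> and the other triangle identity.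
  It evaluates the transposes of arrows that are themselves built by transposing, namely
  \<open>F_2\<close>, \<open>F_0\<close> and later \<open>\<beta>\<close>.\<close>

lemma transpose_simp:
  assumes "A \<in> Ob D" "h \<in> Ar C" "Cod C h = obj U A" "Dom C h = X"
  shows "arr U (\<epsilon> A) \<cdot>\<^bsub>C\<^esub> (arr U (arr F h) \<cdot>\<^bsub>C\<^esub> \<eta> X) = h"
proof -
  have "arr U (\<epsilon> A) \<cdot>\<^bsub>C\<^esub> (arr U (arr F h) \<cdot>\<^bsub>C\<^esub> \<eta> X) = arr U (\<epsilon> A) \<cdot>\<^bsub>C\<^esub> \<eta> (obj U A) \<cdot>\<^bsub>C\<^esub> h"
    using assms adj.unit.naturality[of h X "obj U A"] by auto
  then show ?thesis using assms by (simp add: adj.triangle_right del: U.target.comp_assoc_simp)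
qed

lemma F2_simps [simp]:
  assumes "X \<in> Ob C" "Y \<in> Ob C"
  shows "str2 F' X Y \<in> Ar D" "Dom D (str2 F' X Y) = obj F (X \<otimes>\<^bsub>C\<^esub> Y)"
    "Cod D (str2 F' X Y) = obj F X \<otimes>\<^bsub>D\<^esub> obj F Y"
  using assms by (simp_all add: F'_def left_adjoint_comonoidal_def)

lemma F0_simps [simp]:
  "str0 F' \<in> Ar D" "Dom D (str0 F') = obj F \<one>\<^bsub>C\<^esub>" "Cod D (str0 F') = \<one>\<^bsub>D\<^esub>"
  by (simp_all add: F'_def left_adjoint_comonoidal_def)

lemma F2_transpose:
  assumes [simp]: "X \<in> Ob C" "Y \<in> Ob C"
  shows "arr U (str2 F' X Y) \<cdot>\<^bsub>C\<^esub> \<eta> (X \<otimes>\<^bsub>C\<^esub> Y) = str2 U (obj F X) (obj F Y) \<cdot>\<^bsub>C\<^esub> (\<eta> X \<boxtimes>\<^bsub>C\<^esub> \<eta> Y)"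
proof -
  have "str2 F' X Y = \<epsilon> (obj F X \<otimes>\<^bsub>D\<^esub> obj F Y) \<cdot>\<^bsub>D\<^esub> arr F (str2 U (obj F X) (obj F Y) \<cdot>\<^bsub>C\<^esub> (\<eta> X \<boxtimes>\<^bsub>C\<^esub> \<eta> Y))"
    by (simp add: F'_def left_adjoint_comonoidal_def)
  then show ?thesis by (simp add: transpose_simp del: adj.left.arr_comp_simp)
qed

lemma F0_transpose: "arr U (str0 F') \<cdot>\<^bsub>C\<^esub> \<eta> \<one>\<^bsub>C\<^esub> = str0 U"
  by (simp add: F'_def left_adjoint_comonoidal_def transpose_simp)

section \<open>The comonoidal axioms of the left adjoint\<close>

sublocale F': comonoidal_functor C D F'
proof
  show "str2 F' X' Y' \<cdot>\<^bsub>D\<^esub> arr F' (f \<boxtimes>\<^bsub>C\<^esub> g) = (arr F' f \<boxtimes>\<^bsub>D\<^esub> arr F' g) \<cdot>\<^bsub>D\<^esub> str2 F' X Y"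
    if fg: "f \<in> hom C X X'" "g \<in> hom C Y Y'" for f X X' g Y Y'
  proof (rule transpose_inject)
    have [simp]: "X \<in> Ob C" "X' \<in> Ob C" "Y \<in> Ob C" "Y' \<in> Ob C" using fg by auto
    have "arr U (str2 F' X' Y' \<cdot>\<^bsub>D\<^esub> arr F (f \<boxtimes>\<^bsub>C\<^esub> g)) \<cdot>\<^bsub>C\<^esub> \<eta> (X \<otimes>\<^bsub>C\<^esub> Y) =
        arr U (str2 F' X' Y') \<cdot>\<^bsub>C\<^esub> \<eta> (X' \<otimes>\<^bsub>C\<^esub> Y') \<cdot>\<^bsub>C\<^esub> (f \<boxtimes>\<^bsub>C\<^esub> g)"
      using fg adj.unit.naturality[of "f \<boxtimes>\<^bsub>C\<^esub> g" "X \<otimes>\<^bsub>C\<^esub> Y" "X' \<otimes>\<^bsub>C\<^esub> Y'"] by simp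
    also have "\<dots> = str2 U (obj F X') (obj F Y') \<cdot>\<^bsub>C\<^esub> ((\<eta> X' \<cdot>\<^bsub>C\<^esub> f) \<boxtimes>\<^bsub>C\<^esub> (\<eta> Y' \<cdot>\<^bsub>C\<^esub> g))"
      unfolding F2_transpose[OF \<open>X' \<in> Ob C\<close> \<open>Y' \<in> Ob C\<close>] using fg by simp
    also have "\<dots> = arr U ((arr F f \<boxtimes>\<^bsub>D\<^esub> arr F g) \<cdot>\<^bsub>D\<^esub> str2 F' X Y) \<cdot>\<^bsub>C\<^esub> \<eta> (X \<otimes>\<^bsub>C\<^esub> Y)"
      using fg adj.unit.naturality[of f X X'] adj.unit.naturality[of g Y Y']
      by (simp add: F2_transpose U.str2_naturality_assoc)
    finally show "arr U (str2 F' X' Y' \<cdot>\<^bsub>D\<^esub> arr F' (f \<boxtimes>\<^bsub>C\<^esub> g)) \<cdot>\<^bsub>C\<^esub> \<eta> (X \<otimes>\<^bsub>C\<^esub> Y) =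
      arr U ((arr F' f \<boxtimes>\<^bsub>D\<^esub> arr F' g) \<cdot>\<^bsub>D\<^esub> str2 F' X Y) \<cdot>\<^bsub>C\<^esub> \<eta> (X \<otimes>\<^bsub>C\<^esub> Y)"
      by simp
  qed (use fg in auto)
  show "(str2 F' X Y \<boxtimes>\<^bsub>D\<^esub> ident D (obj F' Z)) \<cdot>\<^bsub>D\<^esub> str2 F' (X \<otimes>\<^bsub>C\<^esub> Y) Z =
      (ident D (obj F' X) \<boxtimes>\<^bsub>D\<^esub> str2 F' Y Z) \<cdot>\<^bsub>D\<^esub> str2 F' X (Y \<otimes>\<^bsub>C\<^esub> Z)"
    if [simp]: "X \<in> Ob C" "Y \<in> Ob C" "Z \<in> Ob C" for X Y Z
  proof (rule transpose_inject)
    let ?U = "\<lambda>X. obj U (obj F X)"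
    have "arr U ((str2 F' X Y \<boxtimes>\<^bsub>D\<^esub> ident D (obj F Z)) \<cdot>\<^bsub>D\<^esub> str2 F' (X \<otimes>\<^bsub>C\<^esub> Y) Z) \<cdot>\<^bsub>C\<^esub> \<eta> (X \<otimes>\<^bsub>C\<^esub> Y \<otimes>\<^bsub>C\<^esub> Z) =
      arr U (str2 F' X Y \<boxtimes>\<^bsub>D\<^esub> ident D (obj F Z)) \<cdot>\<^bsub>C\<^esub>
        (arr U (str2 F' (X \<otimes>\<^bsub>C\<^esub> Y) Z) \<cdot>\<^bsub>C\<^esub> \<eta> ((X \<otimes>\<^bsub>C\<^esub> Y) \<otimes>\<^bsub>C\<^esub> Z))"
      by simp
    also have "\<dots> = str2 U (obj F X \<otimes>\<^bsub>D\<^esub> obj F Y) (obj F Z) \<cdot>\<^bsub>C\<^esub>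
        ((arr U (str2 F' X Y) \<cdot>\<^bsub>C\<^esub> \<eta> (X \<otimes>\<^bsub>C\<^esub> Y)) \<boxtimes>\<^bsub>C\<^esub> \<eta> Z)"
      by (subst F2_transpose) (simp_all add: U.str2_naturality_assoc)
    also have "\<dots> = (str2 U (obj F X \<otimes>\<^bsub>D\<^esub> obj F Y) (obj F Z) \<cdot>\<^bsub>C\<^esub>
        (str2 U (obj F X) (obj F Y) \<boxtimes>\<^bsub>C\<^esub> ident C (?U Z))) \<cdot>\<^bsub>C\<^esub> ((\<eta> X \<boxtimes>\<^bsub>C\<^esub> \<eta> Y) \<boxtimes>\<^bsub>C\<^esub> \<eta> Z)"
      by (subst F2_transpose) simp_all
    \<comment> \<open>Here the associativity axiom of \<open>U\<close> enters; the surrounding steps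
      only expand and refold transposes of \<open>F_2\<close>.\<close>
    also have "\<dots> = (str2 U (obj F X) (obj F Y \<otimes>\<^bsub>D\<^esub> obj F Z) \<cdot>\<^bsub>C\<^esub>
        (ident C (?U X) \<boxtimes>\<^bsub>C\<^esub> str2 U (obj F Y) (obj F Z))) \<cdot>\<^bsub>C\<^esub> (\<eta> X \<boxtimes>\<^bsub>C\<^esub> (\<eta> Y \<boxtimes>\<^bsub>C\<^esub> \<eta> Z))"
      by (subst U.str_assoc) (simp_all add: U.target.tensor_ar_assoc)
    also have "\<dots> = str2 U (obj F X) (obj F Y \<otimes>\<^bsub>D\<^esub> obj F Z) \<cdot>\<^bsub>C\<^esub>
        (\<eta> X \<boxtimes>\<^bsub>C\<^esub> (arr U (str2 F' Y Z) \<cdot>\<^bsub>C\<^esub> \<eta> (Y \<otimes>\<^bsub>C\<^esub> Z)))"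
      by (subst F2_transpose) simp_all
    also have "\<dots> = arr U (ident D (obj F X) \<boxtimes>\<^bsub>D\<^esub> str2 F' Y Z) \<cdot>\<^bsub>C\<^esub>
        (arr U (str2 F' X (Y \<otimes>\<^bsub>C\<^esub> Z)) \<cdot>\<^bsub>C\<^esub> \<eta> (X \<otimes>\<^bsub>C\<^esub> (Y \<otimes>\<^bsub>C\<^esub> Z)))"
      by (subst F2_transpose[of X]) (simp_all add: U.str2_naturality_assoc)
    finally show "arr U ((str2 F' X Y \<boxtimes>\<^bsub>D\<^esub> ident D (obj F' Z)) \<cdot>\<^bsub>D\<^esub> str2 F' (X \<otimes>\<^bsub>C\<^esub> Y) Z) \<cdot>\<^bsub>C\<^esub>
        \<eta> (X \<otimes>\<^bsub>C\<^esub> Y \<otimes>\<^bsub>C\<^esub> Z) = arr U ((ident D (obj F' X) \<boxtimes>\<^bsub>D\<^esub> str2 F' Y Z) \<cdot>\<^bsub>D\<^esub> str2 F' X (Y \<otimes>\<^bsub>C\<^esub> Z)) \<cdot>\<^bsub>C\<^esub>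
        \<eta> (X \<otimes>\<^bsub>C\<^esub> Y \<otimes>\<^bsub>C\<^esub> Z)"
      by simp
  qed auto
  show "(ident D (obj F' X) \<boxtimes>\<^bsub>D\<^esub> str0 F') \<cdot>\<^bsub>D\<^esub> str2 F' X \<one>\<^bsub>C\<^esub> = ident D (obj F' X)"
    if [simp]: "X \<in> Ob C" for X
  proof (rule transpose_inject[of _ _ X])
    have "arr U ((ident D (obj F X) \<boxtimes>\<^bsub>D\<^esub> str0 F') \<cdot>\<^bsub>D\<^esub> str2 F' X \<one>\<^bsub>C\<^esub>) \<cdot>\<^bsub>C\<^esub> \<eta> X =
        arr U (ident D (obj F X) \<boxtimes>\<^bsub>D\<^esub> str0 F') \<cdot>\<^bsub>C\<^esub> (arr U (str2 F' X \<one>\<^bsub>C\<^esub>) \<cdot>\<^bsub>C\<^esub> \<eta> (X \<otimes>\<^bsub>C\<^esub> \<one>\<^bsub>C\<^esub>))"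
      by simp
    also have "\<dots> = str2 U (obj F X) \<one>\<^bsub>D\<^esub> \<cdot>\<^bsub>C\<^esub> (\<eta> X \<boxtimes>\<^bsub>C\<^esub> (arr U (str0 F') \<cdot>\<^bsub>C\<^esub> \<eta> \<one>\<^bsub>C\<^esub>))"
      by (subst F2_transpose) (simp_all add: U.str2_naturality_assoc)
    also have "\<dots> = (str2 U (obj F X) \<one>\<^bsub>D\<^esub> \<cdot>\<^bsub>C\<^esub> (ident C (obj U (obj F X)) \<boxtimes>\<^bsub>C\<^esub> str0 U)) \<cdot>\<^bsub>C\<^esub> (\<eta> X \<boxtimes>\<^bsub>C\<^esub> ident C \<one>\<^bsub>C\<^esub>)"
      by (simp add: F0_transpose del: U.target.unit_ar_right)
    also have "\<dots> = \<eta> X" by (subst U.str_unit_right) simp_all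
    finally show "arr U ((ident D (obj F' X) \<boxtimes>\<^bsub>D\<^esub> str0 F') \<cdot>\<^bsub>D\<^esub> str2 F' X \<one>\<^bsub>C\<^esub>) \<cdot>\<^bsub>C\<^esub> \<eta> X =
        arr U (ident D (obj F' X)) \<cdot>\<^bsub>C\<^esub> \<eta> X"
      by simp
  qed auto
  show "(str0 F' \<boxtimes>\<^bsub>D\<^esub> ident D (obj F' X)) \<cdot>\<^bsub>D\<^esub> str2 F' \<one>\<^bsub>C\<^esub> X = ident D (obj F' X)"
    if [simp]: "X \<in> Ob C" for X
  proof (rule transpose_inject[of _ _ X])
    have "arr U ((str0 F' \<boxtimes>\<^bsub>D\<^esub> ident D (obj F X)) \<cdot>\<^bsub>D\<^esub> str2 F' \<one>\<^bsub>C\<^esub> X) \<cdot>\<^bsub>C\<^esub> \<eta> X =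
        arr U (str0 F' \<boxtimes>\<^bsub>D\<^esub> ident D (obj F X)) \<cdot>\<^bsub>C\<^esub> (arr U (str2 F' \<one>\<^bsub>C\<^esub> X) \<cdot>\<^bsub>C\<^esub> \<eta> (\<one>\<^bsub>C\<^esub> \<otimes>\<^bsub>C\<^esub> X))"
      by simp
    also have "\<dots> = str2 U \<one>\<^bsub>D\<^esub> (obj F X) \<cdot>\<^bsub>C\<^esub> ((arr U (str0 F') \<cdot>\<^bsub>C\<^esub> \<eta> \<one>\<^bsub>C\<^esub>) \<boxtimes>\<^bsub>C\<^esub> \<eta> X)"
      by (subst F2_transpose) (simp_all add: U.str2_naturality_assoc)
    also have "\<dots> = (str2 U \<one>\<^bsub>D\<^esub> (obj F X) \<cdot>\<^bsub>C\<^esub> (str0 U \<boxtimes>\<^bsub>C\<^esub> ident C (obj U (obj F X)))) \<cdot>\<^bsub>C\<^esub> (ident C \<one>\<^bsub>C\<^esub> \<boxtimes>\<^bsub>C\<^esub> \<eta> X)"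
      by (simp add: F0_transpose del: U.target.unit_ar_left)
    also have "\<dots> = \<eta> X" by (subst U.str_unit_left) simp_all
    finally show "arr U ((str0 F' \<boxtimes>\<^bsub>D\<^esub> ident D (obj F' X)) \<cdot>\<^bsub>D\<^esub> str2 F' \<one>\<^bsub>C\<^esub> X) \<cdot>\<^bsub>C\<^esub> \<eta> X =
        arr U (ident D (obj F' X)) \<cdot>\<^bsub>C\<^esub> \<eta> X"
      by simp
  qed auto
qed auto

text \<open>Both sides have transpose \<open>str2 U A B\<close>. On the left, the units produced by
  \<open>F2_transpose\<close> cancel against the two counits by the triangle identity.\<close>

lemma counit_F2:
  assumes [simp]: "A \<in> Ob D" "B \<in> Ob D"
  shows "(\<epsilon> A \<boxtimes>\<^bsub>D\<^esub> \<epsilon> B) \<cdot>\<^bsub>D\<^esub> str2 F' (obj U A) (obj U B) = \<epsilon> (A \<otimes>\<^bsub>D\<^esub> B) \<cdot>\<^bsub>D\<^esub> arr F (str2 U A B)"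
proof (rule transpose_inject[of _ _ "obj U A \<otimes>\<^bsub>C\<^esub> obj U B"])
  show "arr U ((\<epsilon> A \<boxtimes>\<^bsub>D\<^esub> \<epsilon> B) \<cdot>\<^bsub>D\<^esub> str2 F' (obj U A) (obj U B)) \<cdot>\<^bsub>C\<^esub> \<eta> (obj U A \<otimes>\<^bsub>C\<^esub> obj U B) =
      arr U (\<epsilon> (A \<otimes>\<^bsub>D\<^esub> B) \<cdot>\<^bsub>D\<^esub> arr F (str2 U A B)) \<cdot>\<^bsub>C\<^esub> \<eta> (obj U A \<otimes>\<^bsub>C\<^esub> obj U B)"
    by (simp add: F2_transpose U.str2_naturality_assoc transpose_simp adj.triangle_right)
qed auto

lemma comonoidal_functor_T: "comonoidal_functor C C T"
  unfolding T_def using F'.comonoidal_functor_axioms U.comonoidal_functor_as_comonoidal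
  by (rule comonoidal_functor_comp)

text \<open>An equation between arrows into \<open>U A \<otimes> U B\<close> is tested after composition with the isomorphism
  \<open>U\<^sub>2(A, B)\<close>, which cancels the inverse occurring in \<open>T\<^sub>2\<close>.\<close>

lemma counit_T2:
  assumes [simp]: "A \<in> Ob D" "B \<in> Ob D"
  shows "str2 U A B \<cdot>\<^bsub>C\<^esub> ((arr U (\<epsilon> A) \<boxtimes>\<^bsub>C\<^esub> arr U (\<epsilon> B)) \<cdot>\<^bsub>C\<^esub> str2 T (obj U A) (obj U B)) =
    arr U (\<epsilon> (A \<otimes>\<^bsub>D\<^esub> B)) \<cdot>\<^bsub>C\<^esub> arr U (arr F (str2 U A B))"
proof -
  have "str2 U A B \<cdot>\<^bsub>C\<^esub> (arr U (\<epsilon> A) \<boxtimes>\<^bsub>C\<^esub> arr U (\<epsilon> B)) \<cdot>\<^bsub>C\<^esub> str2 T (obj U A) (obj U B) =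
      arr U ((\<epsilon> A \<boxtimes>\<^bsub>D\<^esub> \<epsilon> B) \<cdot>\<^bsub>D\<^esub> str2 F' (obj U A) (obj U B))"
    using U.str2_naturality_assoc[of "\<epsilon> A" "\<epsilon> B" "obj F (obj U A)" "obj F (obj U B)"
        "str2 T (obj U A) (obj U B)"] by simp
  then show ?thesis by (simp add: counit_F2)
qed

sublocale T: comonoidal_functor C C T
  by (rule comonoidal_functor_T)

section \<open>The monad and bimonad axioms\<close>

lemma monad_T: "monad C T \<mu> \<eta>"
proof -
  interpret TT: cat_functor C C "comp_func T T"
    by (rule cat_functor_comp; rule T.cat_functor_axioms)
  show ?thesis
  proof
    show "\<mu> Y \<cdot>\<^bsub>C\<^esub> arr (comp_func T T) f = arr T f \<cdot>\<^bsub>C\<^esub> \<mu> X" if "f \<in> hom C X Y" for f X Y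
      using that arg_cong[OF adj.counit.naturality[of "arr F f" "obj F X" "obj F Y"], of "arr U"] by auto
    show "\<mu> X \<cdot>\<^bsub>C\<^esub> arr T (\<mu> X) = \<mu> X \<cdot>\<^bsub>C\<^esub> \<mu> (obj T X)" if "X \<in> Ob C" for X
      using that arg_cong[OF adj.counit.naturality[of "\<epsilon> (obj F X)" "obj F (obj U (obj F X))" "obj F X"], of "arr U"]
      by auto
    show "\<mu> X \<cdot>\<^bsub>C\<^esub> \<eta> (obj T X) = ident C (obj T X)" if "X \<in> Ob C" for X
      using that by (simp add: adj.triangle_right)
    show "\<mu> X \<cdot>\<^bsub>C\<^esub> arr T (\<eta> X) = ident C (obj T X)" if "X \<in> Ob C" for X
      using that arg_cong[OF adj.triangle_left[of X], of "arr U"] by auto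
    show "\<eta> Y \<cdot>\<^bsub>C\<^esub> arr id_func f = arr T f \<cdot>\<^bsub>C\<^esub> \<eta> X" if "f \<in> hom C X Y" for f X Y
      using that adj.unit.naturality[of f X Y] by simp
  qed auto
qed

lemma bimonad_T: "bimonad C T \<mu> \<eta>"
proof -
  interpret monad C T \<mu> \<eta> by (rule monad_T)
  interpret TT: comonoidal_functor C C "comp_comonoidal C T T"
    by (rule comonoidal_functor_comp; rule T.comonoidal_functor_axioms)
  have id: "comonoidal_functor C C (id_mfunc C)"
    by unfold_locales auto
  interpret I: comonoidal_functor C C "id_mfunc C" by (rule id)
  show ?thesis
  proof
    show "str2 T X Y \<cdot>\<^bsub>C\<^esub> \<mu> (X \<otimes>\<^bsub>C\<^esub> Y) = (\<mu> X \<boxtimes>\<^bsub>C\<^esub> \<mu> Y) \<cdot>\<^bsub>C\<^esub> str2 (comp_comonoidal C T T) X Y"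
      if [simp]: "X \<in> Ob C" "Y \<in> Ob C" for X Y
    proof (rule U.target.iso_monic)
      let ?A = "obj F X" and ?B = "obj F Y"
      have "str2 U ?A ?B \<cdot>\<^bsub>C\<^esub> (str2 T X Y \<cdot>\<^bsub>C\<^esub> \<mu> (X \<otimes>\<^bsub>C\<^esub> Y)) =
          arr U (str2 F' X Y \<cdot>\<^bsub>D\<^esub> \<epsilon> (obj F (X \<otimes>\<^bsub>C\<^esub> Y)))"
        by simp
      \<comment> \<open>Naturality of \<open>\<epsilon>\<close> at \<open>str2 F' X Y\<close> moves
        the counit to \<open>?A \<otimes> ?B\<close>, and \<open>arr U (str2 F' X Y)\<close> is
        rewritten as \<open>str2 U ?A ?B \<cdot> str2 T X Y\<close>. This prepares the use of
        \<open>counit_T2\<close>.\<close>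
      also have "\<dots> = arr U (\<epsilon> (?A \<otimes>\<^bsub>D\<^esub> ?B)) \<cdot>\<^bsub>C\<^esub> arr U (arr F (str2 U ?A ?B \<cdot>\<^bsub>C\<^esub> str2 T X Y))"
        using adj.counit.naturality[of "str2 F' X Y" "obj F (X \<otimes>\<^bsub>C\<^esub> Y)" "?A \<otimes>\<^bsub>D\<^esub> ?B", symmetric] by simp
      also have "\<dots> = arr U (\<epsilon> (?A \<otimes>\<^bsub>D\<^esub> ?B)) \<cdot>\<^bsub>C\<^esub> arr U (arr F (str2 U ?A ?B)) \<cdot>\<^bsub>C\<^esub> arr T (str2 T X Y)"
        by (simp del: T_simps(3) add: T_simps(2))
      also have "\<dots> = str2 U ?A ?B \<cdot>\<^bsub>C\<^esub> ((\<mu> X \<boxtimes>\<^bsub>C\<^esub> \<mu> Y) \<cdot>\<^bsub>C\<^esub> str2 (comp_comonoidal C T T) X Y)"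
        by (subst counit_T2[symmetric]) (simp_all del: T_simps(3))
      finally show "str2 U ?A ?B \<cdot>\<^bsub>C\<^esub> (str2 T X Y \<cdot>\<^bsub>C\<^esub> \<mu> (X \<otimes>\<^bsub>C\<^esub> Y)) =
        str2 U ?A ?B \<cdot>\<^bsub>C\<^esub> ((\<mu> X \<boxtimes>\<^bsub>C\<^esub> \<mu> Y) \<cdot>\<^bsub>C\<^esub> str2 (comp_comonoidal C T T) X Y)" .
    qed simp_all
    show "str0 T \<cdot>\<^bsub>C\<^esub> \<mu> \<one>\<^bsub>C\<^esub> = str0 (comp_comonoidal C T T)"
    proof (rule U.target.iso_monic)
      have "str0 U \<cdot>\<^bsub>C\<^esub> (str0 T \<cdot>\<^bsub>C\<^esub> \<mu> \<one>\<^bsub>C\<^esub>) = arr U (str0 F' \<cdot>\<^bsub>D\<^esub> \<epsilon> (obj F \<one>\<^bsub>C\<^esub>))" by simp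
      also have "\<dots> = arr U (\<epsilon> \<one>\<^bsub>D\<^esub>) \<cdot>\<^bsub>C\<^esub> arr U (arr F (str0 U \<cdot>\<^bsub>C\<^esub> str0 T))"
        using adj.counit.naturality[of "str0 F'" "obj F \<one>\<^bsub>C\<^esub>" "\<one>\<^bsub>D\<^esub>", symmetric] by simp
      also have "\<dots> = arr U (\<epsilon> \<one>\<^bsub>D\<^esub> \<cdot>\<^bsub>D\<^esub> arr F (str0 U)) \<cdot>\<^bsub>C\<^esub> arr T (str0 T)"
        by (simp del: T_simps(4))
      also have "\<dots> = arr U (str0 F') \<cdot>\<^bsub>C\<^esub> arr T (str0 T)"
        by (simp only: F'_def left_adjoint_comonoidal_def with_str_simps)
      also have "\<dots> = str0 U \<cdot>\<^bsub>C\<^esub> str0 (comp_comonoidal C T T)" by simp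
      finally show "str0 U \<cdot>\<^bsub>C\<^esub> (str0 T \<cdot>\<^bsub>C\<^esub> \<mu> \<one>\<^bsub>C\<^esub>) = str0 U \<cdot>\<^bsub>C\<^esub> str0 (comp_comonoidal C T T)" .
    qed simp_all
    show "str2 T X Y \<cdot>\<^bsub>C\<^esub> \<eta> (X \<otimes>\<^bsub>C\<^esub> Y) = (\<eta> X \<boxtimes>\<^bsub>C\<^esub> \<eta> Y) \<cdot>\<^bsub>C\<^esub> str2 (id_mfunc C) X Y"
      if "X \<in> Ob C" "Y \<in> Ob C" for X Y
      using that by (simp add: F2_transpose)
    show "str0 T \<cdot>\<^bsub>C\<^esub> \<eta> \<one>\<^bsub>C\<^esub> = str0 (id_mfunc C)"
      by (simp add: F0_transpose)
    show "\<mu> Y \<cdot>\<^bsub>C\<^esub> arr (comp_comonoidal C T T) f = arr T f \<cdot>\<^bsub>C\<^esub> \<mu> X" if "f \<in> hom C X Y" for f X Y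
      using that mult.naturality[of f X Y] by simp
    show "\<eta> Y \<cdot>\<^bsub>C\<^esub> arr (id_mfunc C) f = arr T f \<cdot>\<^bsub>C\<^esub> \<eta> X" if "f \<in> hom C X Y" for f X Y
      using that unit.naturality[of f X Y] by simp
  qed auto
qed

end

section \<open>The comparison functor\<close>

text \<open>The forgetful functor reflects isomorphisms. This is what makes \<open>K\<close> strong:
  its structure arrows lie over the invertible \<open>U_2\<close> and \<open>U_0\<close>.\<close>

lemma (in bimonad) module_is_inverse:
  assumes f: "(m, f, n) \<in> Ar (module_cat C T \<mu> \<eta>)" and iso: "is_iso C f"
  shows "is_inverse (module_cat C T \<mu> \<eta>) (m, f, n) (n, inv_ar C f, m)"
proof -
  have [simp]: "f \<in> Ar C" "Dom C f = fst m" "Cod C f = fst n" "fst m \<in> Ob C" "fst n \<in> Ob C"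
    "snd m \<in> Ar C" "Dom C (snd m) = obj T (fst m)" "Cod C (snd m) = fst m"
    "snd n \<in> Ar C" "Dom C (snd n) = obj T (fst n)" "Cod C (snd n) = fst n"
    and eq: "f \<cdot>\<^bsub>C\<^esub> snd m = snd n \<cdot>\<^bsub>C\<^esub> arr T f"
    using f by (auto simp: module_cat_Ar T_modules_iff)
  note [simp] = iso
  \<comment> \<open>The identity \<open>f \<cdot> inv_ar C f\<close> is inserted under
    \<open>T\<close> so that the equation for \<open>f\<close> can be used.\<close>
  have "inv_ar C f \<cdot>\<^bsub>C\<^esub> snd n = inv_ar C f \<cdot>\<^bsub>C\<^esub> (snd n \<cdot>\<^bsub>C\<^esub> arr T (f \<cdot>\<^bsub>C\<^esub> inv_ar C f))"
    by (simp del: unit.G.arr_comp_simp)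
  also have "\<dots> = inv_ar C f \<cdot>\<^bsub>C\<^esub> ((snd n \<cdot>\<^bsub>C\<^esub> arr T f) \<cdot>\<^bsub>C\<^esub> arr T (inv_ar C f))"
    by (simp del: unit.F.source.inv_ar_simps(5))
  also have "\<dots> = snd m \<cdot>\<^bsub>C\<^esub> arr T (inv_ar C f)"
    unfolding eq[symmetric] by simp
  finally have "(n, inv_ar C f, m) \<in> Ar (module_cat C T \<mu> \<eta>)"
    using f by (simp add: module_cat_Ar)
  then show ?thesis by (simp add: is_inverse_def)
qed

context strong_monoidal_adjunction
begin

sublocale T: bimonad C T \<mu> \<eta>
  by (rule bimonad_T)

abbreviation M where "M \<equiv> module_cat C T \<mu> \<eta>"

sublocale M: strict_monoidal_category M
  by (rule T.strict_monoidal_category_module_cat)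

definition K_ob where "K_ob A = (obj U A, arr U (\<epsilon> A))"

text \<open>Since the forgetful functor is strict, \<open>U_T K = U\<close> forces the underlying
  arrows \<open>str2 U\<close> and \<open>str0 U\<close>; the modules at both ends are dictated by
  the typing.\<close>

definition K where
  "K = with_str (comparison_functor D U \<epsilon>)
     (\<lambda>A B. (tensor_module C T (K_ob A) (K_ob B), str2 U A B, K_ob (A \<otimes>\<^bsub>D\<^esub> B)))
     ((\<one>\<^bsub>C\<^esub>, str0 T), str0 U, K_ob \<one>\<^bsub>D\<^esub>)"

lemma K_ob_simps [simp]: "fst (K_ob A) = obj U A" "snd (K_ob A) = arr U (\<epsilon> A)"
  by (simp_all add: K_ob_def)

lemma K_simps [simp]:
  "obj K A = K_ob A" "arr K f = (K_ob (Dom D f), arr U f, K_ob (Cod D f))"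
  "str2 K A B = (tensor_module C T (K_ob A) (K_ob B), str2 U A B, K_ob (A \<otimes>\<^bsub>D\<^esub> B))"
  "str0 K = ((\<one>\<^bsub>C\<^esub>, str0 T), str0 U, K_ob \<one>\<^bsub>D\<^esub>)"
  by (simp_all add: K_def K_ob_def comparison_functor_def)

text \<open>Associativity of the action is naturality of \<open>\<epsilon>\<close> at the arrow
  \<open>\<epsilon> A\<close> itself, and the unit law is a triangle identity.\<close>

lemma K_ob_in [simp]:
  assumes "A \<in> Ob D" shows "K_ob A \<in> T_modules C T \<mu> \<eta>"
proof -
  have "arr U (\<epsilon> A \<cdot>\<^bsub>D\<^esub> arr F (arr U (\<epsilon> A))) = arr U (\<epsilon> A \<cdot>\<^bsub>D\<^esub> \<epsilon> (obj F (obj U A)))"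
    using assms adj.counit.naturality[of "\<epsilon> A" "obj F (obj U A)" A] by simp
  then show ?thesis using assms by (simp add: T_modules_iff adj.triangle_right)
qed

lemma K_arr_in:
  assumes "f \<in> Ar D" shows "arr K f \<in> Ar M"
proof -
  have "arr U (f \<cdot>\<^bsub>D\<^esub> \<epsilon> (Dom D f)) = arr U (\<epsilon> (Cod D f) \<cdot>\<^bsub>D\<^esub> arr F (arr U f))"
    using assms adj.counit.naturality[of f "Dom D f" "Cod D f"] by simp
  then show ?thesis using assms by (simp add: module_cat_Ar)
qed

text \<open>Compatibility of \<open>U_2\<close> with the actions is exactly
  \<open>counit_T2\<close>; \<open>T_2\<close> is kept folded so that this equation matches.\<close>

lemma K2_in:
  assumes "A \<in> Ob D" "B \<in> Ob D" shows "str2 K A B \<in> Ar M"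
  using assms counit_T2[OF assms] by (simp add: module_cat_Ar T.tensor_module_in del: T_simps(3,4))

lemma K0_in: "str0 K \<in> Ar M"
proof -
  have "str0 U \<cdot>\<^bsub>C\<^esub> str0 T = arr U (\<epsilon> \<one>\<^bsub>D\<^esub> \<cdot>\<^bsub>D\<^esub> arr F (str0 U))"
    by (simp add: F'_def left_adjoint_comonoidal_def)
  then show ?thesis using T.unit_module_in by (simp add: module_cat_Ar)
qed

lemma K2_is_inverse:
  "A \<in> Ob D \<Longrightarrow> B \<in> Ob D \<Longrightarrow> is_inverse M (str2 K A B)
     (K_ob (A \<otimes>\<^bsub>D\<^esub> B), inv_ar C (str2 U A B), tensor_module C T (K_ob A) (K_ob B))"
  using T.module_is_inverse K2_in[of A B] by simp

lemma K0_is_inverse: "is_inverse M (str0 K) (K_ob \<one>\<^bsub>D\<^esub>, inv_ar C (str0 U), (\<one>\<^bsub>C\<^esub>, str0 T))"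
  using T.module_is_inverse K0_in by simp

text \<open>Each equation of module arrows consists of the equation of \<open>U\<close> for the
  underlying arrows and equalities of the modules at the ends, supplied by the strictness of the
  tensor product of modules.\<close>

lemma strong_monoidal_K: "strong_monoidal_functor D M K"
proof
  show "obj K X \<in> Ob M" if "X \<in> Ob D" for X using that by simp
  show "arr K f \<in> hom M (obj K X) (obj K Y)" if "f \<in> hom D X Y" for f X Y
    using that K_arr_in[of f] by auto
  show "arr K (ident D X) = ident M (obj K X)" if "X \<in> Ob D" for X
    using that by simp
  show "arr K (g \<cdot>\<^bsub>D\<^esub> f) = arr K g \<cdot>\<^bsub>M\<^esub> arr K f" if "f \<in> hom D X Y" "g \<in> hom D Y Z" for f g X Y Z
    using that by auto
  show "str2 K X Y \<in> hom M (obj K X \<otimes>\<^bsub>M\<^esub> obj K Y) (obj K (X \<otimes>\<^bsub>D\<^esub> Y))"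
    if "X \<in> Ob D" "Y \<in> Ob D" for X Y
    using that K2_in[OF that] by simp
  show "str0 K \<in> hom M \<one>\<^bsub>M\<^esub> (obj K \<one>\<^bsub>D\<^esub>)"
    using K0_in by (simp del: T_simps)
  show "arr K (f \<boxtimes>\<^bsub>D\<^esub> g) \<cdot>\<^bsub>M\<^esub> str2 K X Y = str2 K X' Y' \<cdot>\<^bsub>M\<^esub> (arr K f \<boxtimes>\<^bsub>M\<^esub> arr K g)"
    if "f \<in> hom D X X'" "g \<in> hom D Y Y'" for f X X' g Y Y'
    using that by (auto simp: U.str2_naturality)
  show "str2 K (X \<otimes>\<^bsub>D\<^esub> Y) Z \<cdot>\<^bsub>M\<^esub> (str2 K X Y \<boxtimes>\<^bsub>M\<^esub> ident M (obj K Z)) =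
      str2 K X (Y \<otimes>\<^bsub>D\<^esub> Z) \<cdot>\<^bsub>M\<^esub> (ident M (obj K X) \<boxtimes>\<^bsub>M\<^esub> str2 K Y Z)"
    if "X \<in> Ob D" "Y \<in> Ob D" "Z \<in> Ob D" for X Y Z
    using that by (simp add: U.str_assoc T.tensor_module_assoc)
  show "str2 K X \<one>\<^bsub>D\<^esub> \<cdot>\<^bsub>M\<^esub> (ident M (obj K X) \<boxtimes>\<^bsub>M\<^esub> str0 K) = ident M (obj K X)" if "X \<in> Ob D" for X
    using that T.tensor_unit_module[of "K_ob X"] by (simp add: U.str_unit_right del: T_simps)
  show "str2 K \<one>\<^bsub>D\<^esub> X \<cdot>\<^bsub>M\<^esub> (str0 K \<boxtimes>\<^bsub>M\<^esub> ident M (obj K X)) = ident M (obj K X)" if "X \<in> Ob D" for X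
    using that T.tensor_unit_module[of "K_ob X"] by (simp add: U.str_unit_left del: T_simps)
  show "is_iso M (str2 K X Y)" if "X \<in> Ob D" "Y \<in> Ob D" for X Y
    using K2_in[OF that] K2_is_inverse[OF that] unfolding is_iso_def by blast
  show "is_iso M (str0 K)"
    using K0_in K0_is_inverse unfolding is_iso_def by blast
qed

lemma forgetful_K: "mfunc_eq D (comp_monoidal C (forgetful C) K) U"
  by (simp add: mfunc_eq_def forgetful_def K_ob_def tensor_module_def)

text \<open>The inverse of \<open>K_2\<close> lies over the inverse of \<open>U_2\<close>. Followed
  after \<open>K(F_2)\<close> it has underlying arrow \<open>T_2\<close>, by the very definition of
  \<open>T_2\<close>; the same holds for \<open>T_0\<close>.\<close>

lemma free_module_K: "mfunc_eq C (comp_comonoidal M (as_comonoidal M K) F') (free_module C T \<mu>)"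
proof -
  have "inv_ar M (str2 K A B) = (K_ob (A \<otimes>\<^bsub>D\<^esub> B), inv_ar C (str2 U A B), tensor_module C T (K_ob A) (K_ob B))"
    if "A \<in> Ob D" "B \<in> Ob D" for A B
    using M.inv_ar_eqI K2_in K2_is_inverse that by blast
  moreover have "inv_ar M (str0 K) = (K_ob \<one>\<^bsub>D\<^esub>, inv_ar C (str0 U), (\<one>\<^bsub>C\<^esub>, str0 T))"
    using M.inv_ar_eqI K0_in K0_is_inverse by blast
  ultimately show ?thesis
    by (simp add: mfunc_eq_def free_module_def K_ob_def del: K_simps(3,4))
qed

end

section \<open>Duals\<close>

text \<open>Duality data for a single pair of objects, detached from any choice of duals, so that it
  also covers the image under \<open>U\<close> of a chosen dual.\<close>

locale left_dual_pair = strict_monoidal_category C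
  for C :: "('o, 'a, 'z) moncat_scheme" (structure) +
  fixes X Y :: 'o and e c :: 'a
  assumes objs [simp]: "X \<in> Ob C" "Y \<in> Ob C"
    and ev_hom: "e \<in> hom C (Y \<otimes> X) \<one>" and coev_hom: "c \<in> hom C \<one> (X \<otimes> Y)"
    and zigzag: "(ident C X \<boxtimes> e) \<cdot> (c \<boxtimes> ident C X) = ident C X"
    and zigzag_dual: "(e \<boxtimes> ident C Y) \<cdot> (ident C Y \<boxtimes> c) = ident C Y"
begin

lemma ev_coev_simps [simp]:
  "e \<in> Ar C" "Dom C e = Y \<otimes> X" "Cod C e = \<one>" "c \<in> Ar C" "Dom C c = \<one>" "Cod C c = X \<otimes> Y"
  using ev_hom coev_hom by auto

text \<open>One direction of the bijection between arrows from \<open>Z \<otimes> X\<close> to the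
  unit object and arrows from \<open>Z\<close> to \<open>Y\<close>; the other direction tensors with
  \<open>ident C X\<close> and composes with \<open>e\<close>.\<close>

definition lift where "lift Z g = (g \<boxtimes> ident C Y) \<cdot> (ident C Z \<boxtimes> c)"

lemma lift_simps [simp]:
  assumes "g \<in> Ar C" "Dom C g = Z \<otimes> X" "Cod C g = \<one>" "Z \<in> Ob C"
  shows "lift Z g \<in> Ar C" "Dom C (lift Z g) = Z" "Cod C (lift Z g) = Y"
  using assms by (simp_all add: lift_def)

text \<open>Sliding \<open>e\<close> past \<open>g\<close> by interchange leaves \<open>g\<close>
  after the first zigzag tensored with \<open>ident C Z\<close>.\<close>

lemma ev_lift:
  assumes [simp]: "g \<in> Ar C" "Dom C g = Z \<otimes> X" "Cod C g = \<one>" "Z \<in> Ob C"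
  shows "e \<cdot> (lift Z g \<boxtimes> ident C X) = g"
proof -
  have "e \<cdot> (lift Z g \<boxtimes> ident C X) =
      e \<cdot> (((g \<boxtimes> ident C Y) \<boxtimes> ident C X) \<cdot> ((ident C Z \<boxtimes> c) \<boxtimes> ident C X))"
    by (simp add: lift_def del: tensor_ident)
  also have "\<dots> = e \<cdot> ((g \<boxtimes> ident C (Y \<otimes> X)) \<cdot> (ident C Z \<boxtimes> (c \<boxtimes> ident C X)))"
    using tensor_ar_assoc[of g "ident C Y" "ident C X"] tensor_ar_assoc[of "ident C Z" c "ident C X"] by simp
  \<comment> \<open>The explicit factor \<open>ident C \<one>\<close> puts \<open>e\<close> into
    tensor form, so that interchange can exchange it with \<open>g\<close>.\<close>
  also have "\<dots> = ((ident C \<one> \<boxtimes> e) \<cdot> (g \<boxtimes> ident C (Y \<otimes> X))) \<cdot> (ident C Z \<boxtimes> (c \<boxtimes> ident C X))"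
    by (simp del: comp_tensor comp_tensor_assoc)
  also have "\<dots> = ((g \<boxtimes> ident C \<one>) \<cdot> ((ident C Z \<boxtimes> ident C X) \<boxtimes> e)) \<cdot> (ident C Z \<boxtimes> (c \<boxtimes> ident C X))"
    by (simp del: unit_ar_left unit_ar_right)
  also have "\<dots> = g \<cdot> ((ident C Z \<boxtimes> (ident C X \<boxtimes> e)) \<cdot> (ident C Z \<boxtimes> (c \<boxtimes> ident C X)))"
    by (subst tensor_ar_assoc) (simp_all del: comp_tensor comp_tensor_assoc)
  also have "\<dots> = g" by (simp add: zigzag)
  finally show ?thesis .
qed

lemma lift_ev:
  assumes [simp]: "h \<in> Ar C" "Dom C h = Z" "Cod C h = Y"
  shows "lift Z (e \<cdot> (h \<boxtimes> ident C X)) = h"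
proof -
  have [simp]: "Z \<in> Ob C" using Dom_in[OF assms(1)] by simp
  have "lift Z (e \<cdot> (h \<boxtimes> ident C X)) =
      (e \<boxtimes> ident C Y) \<cdot> (((h \<boxtimes> ident C X) \<boxtimes> ident C Y) \<cdot> (ident C Z \<boxtimes> c))"
    by (simp add: lift_def)
  also have "\<dots> = (e \<boxtimes> ident C Y) \<cdot> ((h \<boxtimes> ident C (X \<otimes> Y)) \<cdot> (ident C Z \<boxtimes> c))"
    using tensor_ar_assoc[of h "ident C X" "ident C Y"] by simp
  also have "\<dots> = ((e \<boxtimes> ident C Y) \<cdot> (ident C Y \<boxtimes> c)) \<cdot> (h \<boxtimes> ident C \<one>)"
    by (simp del: unit_ar_right)
  also have "\<dots> = h" unfolding zigzag_dual by simp
  finally show ?thesis .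
qed

text \<open>Evaluation is injective because \<open>lift\<close> undoes it. Equations between arrows
  into a dual are thereby reduced to the evaluation equations that characterise these
  arrows.\<close>

lemma dual_hom_eqI:
  assumes "h \<in> Ar C" "h' \<in> Ar C" "Cod C h = Y" "Cod C h' = Y" "Dom C h = Dom C h'"
    "e \<cdot> (h \<boxtimes> ident C X) = e \<cdot> (h' \<boxtimes> ident C X)"
  shows "h = h'"
  using lift_ev[OF assms(1) refl assms(3)] lift_ev[OF assms(2) refl assms(4)] assms(5,6) by metis

end

text \<open>By \<open>lift_ev\<close>, \<open>h\<close> is the lift of the common value in
  \<open>mate\<close>. Substituting this and exchanging \<open>c\<close> with \<open>c'\<close>
  produces the zigzag of the second pair. Applied to \<open>\<alpha>\<close> and
  \<open>\<tau>\<close>, it spares separate coevaluation computations.\<close>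

lemma mate_coev:
  fixes C (structure)
  assumes "left_dual_pair C X Y e c" "left_dual_pair C X' Y' e' c'"
    and [simp]: "f \<in> Ar C" "Dom C f = X" "Cod C f = X'" "h \<in> Ar C" "Dom C h = Y'" "Cod C h = Y"
    and mate: "e \<cdot> (h \<boxtimes> ident C X) = e' \<cdot> (ident C Y' \<boxtimes> f)"
  shows "(ident C X' \<boxtimes> h) \<cdot> c' = (f \<boxtimes> ident C Y) \<cdot> c"
proof -
  interpret P: left_dual_pair C X Y e c by fact
  interpret P': left_dual_pair C X' Y' e' c' by fact
  let ?i = "ident C"
  let ?g = "e' \<cdot> (?i Y' \<boxtimes> f)"
  have h: "h = (?g \<boxtimes> ?i Y) \<cdot> (?i Y' \<boxtimes> c)"
    using P.lift_ev[of h Y'] unfolding mate by (simp add: P.lift_def)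
  have "(?i X' \<boxtimes> h) \<cdot> c' = (?i X' \<boxtimes> (?g \<boxtimes> ?i Y)) \<cdot> ((?i X' \<boxtimes> (?i Y' \<boxtimes> c)) \<cdot> c')"
    by (subst h) simp
  also have "\<dots> = ((?i X' \<boxtimes> ?g) \<boxtimes> ?i Y) \<cdot> ((?i (X' \<otimes> Y') \<boxtimes> c) \<cdot> (c' \<boxtimes> ?i \<one>))"
    by (simp add: P.tensor_ar_assoc[symmetric] del: P.comp_tensor P.comp_tensor_assoc)
  \<comment> \<open>The two coevaluations act on disjoint tensor factors, so their order can be
    exchanged; \<open>c\<close> now comes first.\<close>
  also have "\<dots> = ((?i X' \<boxtimes> ?g) \<boxtimes> ?i Y) \<cdot> ((c' \<boxtimes> (?i X \<boxtimes> ?i Y)) \<cdot> (?i \<one> \<boxtimes> c))"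
    by (simp del: P.comp_tensor_assoc P.unit_ar_right P.unit_ar_left)
  also have "\<dots> = (((?i X' \<boxtimes> ?g) \<cdot> (c' \<boxtimes> ?i X)) \<boxtimes> ?i Y) \<cdot> c"
    by (subst P.tensor_ar_assoc[symmetric]) simp_all
  \<comment> \<open>From here only the factor tensored with \<open>ident C Y\<close> in front of
    \<open>c\<close> is rewritten; it collapses to \<open>f\<close> by the zigzag of the second
    pair.\<close>
  also have "(?i X' \<boxtimes> ?g) \<cdot> (c' \<boxtimes> ?i X) = (?i X' \<boxtimes> e') \<cdot> ((?i X' \<boxtimes> (?i Y' \<boxtimes> f)) \<cdot> (c' \<boxtimes> ?i X))"
    by simp
  also have "\<dots> = (?i X' \<boxtimes> e') \<cdot> ((?i (X' \<otimes> Y') \<boxtimes> f) \<cdot> (c' \<boxtimes> ?i X))"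
    by (subst P.tensor_ar_assoc[symmetric]) (simp_all)
  also have "\<dots> = ((?i X' \<boxtimes> e') \<cdot> (c' \<boxtimes> ?i X')) \<cdot> (?i \<one> \<boxtimes> f)"
    by (simp del: P.unit_ar_left)
  also have "\<dots> = f" unfolding P'.zigzag by simp
  finally show ?thesis .
qed

text \<open>Interchange splits \<open>(h \<cdot> u) \<boxtimes> g\<close> as
  \<open>h \<boxtimes> ident C X\<close> after \<open>u \<boxtimes> g\<close>, the direction
  opposite to \<open>comp_tensor\<close>. It applies an evaluation equation for \<open>h\<close> in
  the presence of further factors.\<close>

lemma (in strict_monoidal_category) comp_tensor_left:
  assumes "e \<cdot> (h \<boxtimes> ident C X) = k" "e \<in> Ar C" "h \<in> Ar C" "u \<in> Ar C" "g \<in> Ar C" "X \<in> Ob C"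
    "Dom C e = Cod C h \<otimes> X" "Dom C h = Cod C u" "Cod C g = X"
  shows "e \<cdot> ((h \<cdot> u) \<boxtimes> g) = k \<cdot> (u \<boxtimes> g)"
  using assms by auto

text \<open>Strong monoidal functors preserve duals. After \<open>swap\<close>, naturality collects
  the images of \<open>e\<close> and \<open>c\<close> into the image of a zigzag, and the unit laws
  absorb what remains at the two ends.\<close>

lemma (in strong_monoidal_functor) left_dual_pair_image:
  assumes "left_dual_pair C X Y e c"
  shows "left_dual_pair D (obj F X) (obj F Y) (inv_ar D (str0 F) \<cdot>\<^bsub>D\<^esub> (arr F e \<cdot>\<^bsub>D\<^esub> str2 F Y X))
    (inv_ar D (str2 F X Y) \<cdot>\<^bsub>D\<^esub> (arr F c \<cdot>\<^bsub>D\<^esub> str0 F))"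
proof -
  interpret P: left_dual_pair C X Y e c by fact
  interpret V: comonoidal_functor C D "as_comonoidal D F" by (rule comonoidal_functor_as_comonoidal)
  note str2_iso [simp] str0_iso [simp]
  let ?V2 = "\<lambda>X Y. inv_ar D (str2 F X Y)" and ?V0 = "inv_ar D (str0 F)"
  let ?i = "\<lambda>X. ident D (obj F X)"
  \<comment> \<open>The associativity axiom with one structure arrow on each side inverted: it
    exchanges an \<open>F_2\<close> with the inverse of another one.\<close>
  have swap: "(str2 F W X \<boxtimes>\<^bsub>D\<^esub> ?i Z) \<cdot>\<^bsub>D\<^esub> (?i W \<boxtimes>\<^bsub>D\<^esub> ?V2 X Z) = ?V2 (W \<otimes>\<^bsub>C\<^esub> X) Z \<cdot>\<^bsub>D\<^esub> str2 F W (X \<otimes>\<^bsub>C\<^esub> Z)"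
    "(?i W \<boxtimes>\<^bsub>D\<^esub> str2 F X Z) \<cdot>\<^bsub>D\<^esub> (?V2 W X \<boxtimes>\<^bsub>D\<^esub> ?i Z) = ?V2 W (X \<otimes>\<^bsub>C\<^esub> Z) \<cdot>\<^bsub>D\<^esub> str2 F (W \<otimes>\<^bsub>C\<^esub> X) Z"
    if [simp]: "W \<in> Ob C" "X \<in> Ob C" "Z \<in> Ob C" for W X Z
  proof -
    have "?V2 (W \<otimes>\<^bsub>C\<^esub> X) Z \<cdot>\<^bsub>D\<^esub> (str2 F (W \<otimes>\<^bsub>C\<^esub> X) Z \<cdot>\<^bsub>D\<^esub> (str2 F W X \<boxtimes>\<^bsub>D\<^esub> ?i Z)) \<cdot>\<^bsub>D\<^esub> (?i W \<boxtimes>\<^bsub>D\<^esub> ?V2 X Z) =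
        ?V2 (W \<otimes>\<^bsub>C\<^esub> X) Z \<cdot>\<^bsub>D\<^esub> (str2 F W (X \<otimes>\<^bsub>C\<^esub> Z) \<cdot>\<^bsub>D\<^esub> (?i W \<boxtimes>\<^bsub>D\<^esub> str2 F X Z)) \<cdot>\<^bsub>D\<^esub> (?i W \<boxtimes>\<^bsub>D\<^esub> ?V2 X Z)"
      by (simp only: str_assoc that)
    then show "(str2 F W X \<boxtimes>\<^bsub>D\<^esub> ?i Z) \<cdot>\<^bsub>D\<^esub> (?i W \<boxtimes>\<^bsub>D\<^esub> ?V2 X Z) = ?V2 (W \<otimes>\<^bsub>C\<^esub> X) Z \<cdot>\<^bsub>D\<^esub> str2 F W (X \<otimes>\<^bsub>C\<^esub> Z)"
      by simp
    have "?V2 W (X \<otimes>\<^bsub>C\<^esub> Z) \<cdot>\<^bsub>D\<^esub> (str2 F (W \<otimes>\<^bsub>C\<^esub> X) Z \<cdot>\<^bsub>D\<^esub> (str2 F W X \<boxtimes>\<^bsub>D\<^esub> ?i Z)) \<cdot>\<^bsub>D\<^esub> (?V2 W X \<boxtimes>\<^bsub>D\<^esub> ?i Z) =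
        ?V2 W (X \<otimes>\<^bsub>C\<^esub> Z) \<cdot>\<^bsub>D\<^esub> (str2 F W (X \<otimes>\<^bsub>C\<^esub> Z) \<cdot>\<^bsub>D\<^esub> (?i W \<boxtimes>\<^bsub>D\<^esub> str2 F X Z)) \<cdot>\<^bsub>D\<^esub> (?V2 W X \<boxtimes>\<^bsub>D\<^esub> ?i Z)"
      by (simp only: str_assoc that)
    then show "(?i W \<boxtimes>\<^bsub>D\<^esub> str2 F X Z) \<cdot>\<^bsub>D\<^esub> (?V2 W X \<boxtimes>\<^bsub>D\<^esub> ?i Z) = ?V2 W (X \<otimes>\<^bsub>C\<^esub> Z) \<cdot>\<^bsub>D\<^esub> str2 F (W \<otimes>\<^bsub>C\<^esub> X) Z"
      by simp
  qed
  show ?thesis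
  proof
    have n: "(?i X \<boxtimes>\<^bsub>D\<^esub> arr F e) \<cdot>\<^bsub>D\<^esub> ?V2 X (Y \<otimes>\<^bsub>C\<^esub> X) = ?V2 X \<one>\<^bsub>C\<^esub> \<cdot>\<^bsub>D\<^esub> arr F (ident C X \<boxtimes>\<^bsub>C\<^esub> e)"
      "str2 F (X \<otimes>\<^bsub>C\<^esub> Y) X \<cdot>\<^bsub>D\<^esub> (arr F c \<boxtimes>\<^bsub>D\<^esub> ?i X) = arr F (c \<boxtimes>\<^bsub>C\<^esub> ident C X) \<cdot>\<^bsub>D\<^esub> str2 F \<one>\<^bsub>C\<^esub> X"
      using V.str2_naturality[of "ident C X" e X "\<one>\<^bsub>C\<^esub>"] str2_naturality[of c "ident C X" "\<one>\<^bsub>C\<^esub>" X] by simp_all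
    have "(?i X \<boxtimes>\<^bsub>D\<^esub> (?V0 \<cdot>\<^bsub>D\<^esub> (arr F e \<cdot>\<^bsub>D\<^esub> str2 F Y X))) \<cdot>\<^bsub>D\<^esub> ((?V2 X Y \<cdot>\<^bsub>D\<^esub> (arr F c \<cdot>\<^bsub>D\<^esub> str0 F)) \<boxtimes>\<^bsub>D\<^esub> ?i X) =
        (?i X \<boxtimes>\<^bsub>D\<^esub> ?V0) \<cdot>\<^bsub>D\<^esub> (?i X \<boxtimes>\<^bsub>D\<^esub> arr F e) \<cdot>\<^bsub>D\<^esub>
        ((?i X \<boxtimes>\<^bsub>D\<^esub> str2 F Y X) \<cdot>\<^bsub>D\<^esub> (?V2 X Y \<boxtimes>\<^bsub>D\<^esub> ?i X)) \<cdot>\<^bsub>D\<^esub> (arr F c \<boxtimes>\<^bsub>D\<^esub> ?i X) \<cdot>\<^bsub>D\<^esub> (str0 F \<boxtimes>\<^bsub>D\<^esub> ?i X)"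
      by simp
    also have "\<dots> = (?i X \<boxtimes>\<^bsub>D\<^esub> ?V0) \<cdot>\<^bsub>D\<^esub> ((?i X \<boxtimes>\<^bsub>D\<^esub> arr F e) \<cdot>\<^bsub>D\<^esub> ?V2 X (Y \<otimes>\<^bsub>C\<^esub> X)) \<cdot>\<^bsub>D\<^esub>
        (str2 F (X \<otimes>\<^bsub>C\<^esub> Y) X \<cdot>\<^bsub>D\<^esub> (arr F c \<boxtimes>\<^bsub>D\<^esub> ?i X)) \<cdot>\<^bsub>D\<^esub> (str0 F \<boxtimes>\<^bsub>D\<^esub> ?i X)"
      unfolding swap(2)[OF P.objs P.objs(1)] by simp
    also have "\<dots> = ((?i X \<boxtimes>\<^bsub>D\<^esub> ?V0) \<cdot>\<^bsub>D\<^esub> ?V2 X \<one>\<^bsub>C\<^esub>) \<cdot>\<^bsub>D\<^esub> arr F ((ident C X \<boxtimes>\<^bsub>C\<^esub> e) \<cdot>\<^bsub>C\<^esub> (c \<boxtimes>\<^bsub>C\<^esub> ident C X)) \<cdot>\<^bsub>D\<^esub>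
        (str2 F \<one>\<^bsub>C\<^esub> X \<cdot>\<^bsub>D\<^esub> (str0 F \<boxtimes>\<^bsub>D\<^esub> ?i X))"
      unfolding n by simp
    also have "\<dots> = ?i X"
      unfolding P.zigzag using V.str_counit_right[of X] str_unit_left[of X] by simp
    finally show "(?i X \<boxtimes>\<^bsub>D\<^esub> (?V0 \<cdot>\<^bsub>D\<^esub> (arr F e \<cdot>\<^bsub>D\<^esub> str2 F Y X))) \<cdot>\<^bsub>D\<^esub>
      ((?V2 X Y \<cdot>\<^bsub>D\<^esub> (arr F c \<cdot>\<^bsub>D\<^esub> str0 F)) \<boxtimes>\<^bsub>D\<^esub> ?i X) = ?i X" .
    have n': "(arr F e \<boxtimes>\<^bsub>D\<^esub> ?i Y) \<cdot>\<^bsub>D\<^esub> ?V2 (Y \<otimes>\<^bsub>C\<^esub> X) Y = ?V2 \<one>\<^bsub>C\<^esub> Y \<cdot>\<^bsub>D\<^esub> arr F (e \<boxtimes>\<^bsub>C\<^esub> ident C Y)"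
      "str2 F Y (X \<otimes>\<^bsub>C\<^esub> Y) \<cdot>\<^bsub>D\<^esub> (?i Y \<boxtimes>\<^bsub>D\<^esub> arr F c) = arr F (ident C Y \<boxtimes>\<^bsub>C\<^esub> c) \<cdot>\<^bsub>D\<^esub> str2 F Y \<one>\<^bsub>C\<^esub>"
      using V.str2_naturality[of e "ident C Y" "\<one>\<^bsub>C\<^esub>" Y] str2_naturality[of "ident C Y" c Y "\<one>\<^bsub>C\<^esub>"] by simp_all
    have "((?V0 \<cdot>\<^bsub>D\<^esub> (arr F e \<cdot>\<^bsub>D\<^esub> str2 F Y X)) \<boxtimes>\<^bsub>D\<^esub> ?i Y) \<cdot>\<^bsub>D\<^esub> (?i Y \<boxtimes>\<^bsub>D\<^esub> (?V2 X Y \<cdot>\<^bsub>D\<^esub> (arr F c \<cdot>\<^bsub>D\<^esub> str0 F))) =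
        (?V0 \<boxtimes>\<^bsub>D\<^esub> ?i Y) \<cdot>\<^bsub>D\<^esub> (arr F e \<boxtimes>\<^bsub>D\<^esub> ?i Y) \<cdot>\<^bsub>D\<^esub>
        ((str2 F Y X \<boxtimes>\<^bsub>D\<^esub> ?i Y) \<cdot>\<^bsub>D\<^esub> (?i Y \<boxtimes>\<^bsub>D\<^esub> ?V2 X Y)) \<cdot>\<^bsub>D\<^esub> (?i Y \<boxtimes>\<^bsub>D\<^esub> arr F c) \<cdot>\<^bsub>D\<^esub> (?i Y \<boxtimes>\<^bsub>D\<^esub> str0 F)"
      by simp
    also have "\<dots> = (?V0 \<boxtimes>\<^bsub>D\<^esub> ?i Y) \<cdot>\<^bsub>D\<^esub> ((arr F e \<boxtimes>\<^bsub>D\<^esub> ?i Y) \<cdot>\<^bsub>D\<^esub> ?V2 (Y \<otimes>\<^bsub>C\<^esub> X) Y) \<cdot>\<^bsub>D\<^esub>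
        (str2 F Y (X \<otimes>\<^bsub>C\<^esub> Y) \<cdot>\<^bsub>D\<^esub> (?i Y \<boxtimes>\<^bsub>D\<^esub> arr F c)) \<cdot>\<^bsub>D\<^esub> (?i Y \<boxtimes>\<^bsub>D\<^esub> str0 F)"
      unfolding swap(1)[OF P.objs(2) P.objs] by simp
    also have "\<dots> = ((?V0 \<boxtimes>\<^bsub>D\<^esub> ?i Y) \<cdot>\<^bsub>D\<^esub> ?V2 \<one>\<^bsub>C\<^esub> Y) \<cdot>\<^bsub>D\<^esub> arr F ((e \<boxtimes>\<^bsub>C\<^esub> ident C Y) \<cdot>\<^bsub>C\<^esub> (ident C Y \<boxtimes>\<^bsub>C\<^esub> c)) \<cdot>\<^bsub>D\<^esub>
        (str2 F Y \<one>\<^bsub>C\<^esub> \<cdot>\<^bsub>D\<^esub> (?i Y \<boxtimes>\<^bsub>D\<^esub> str0 F))"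
      unfolding n' by simp
    also have "\<dots> = ?i Y"
      unfolding P.zigzag_dual using V.str_counit_left[of Y] str_unit_right[of Y] by simp
    finally show "((?V0 \<cdot>\<^bsub>D\<^esub> (arr F e \<cdot>\<^bsub>D\<^esub> str2 F Y X)) \<boxtimes>\<^bsub>D\<^esub> ?i Y) \<cdot>\<^bsub>D\<^esub>
      (?i Y \<boxtimes>\<^bsub>D\<^esub> (?V2 X Y \<cdot>\<^bsub>D\<^esub> (arr F c \<cdot>\<^bsub>D\<^esub> str0 F))) = ?i Y" .
  qed simp_all
qed

section \<open>The left antipode\<close>

context left_autonomous
begin

lemma dual_simps [simp]:
  assumes "X \<in> Ob C"
  shows "dual d X \<in> Ob C" "ev d X \<in> Ar C" "Dom C (ev d X) = dual d X \<otimes> X" "Cod C (ev d X) = \<one>"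
    "coev d X \<in> Ar C" "Dom C (coev d X) = \<one>" "Cod C (coev d X) = X \<otimes> dual d X"
  using assms dual_in ev_in[OF assms] coev_in[OF assms] by auto

lemma left_dual_pair: "X \<in> Ob C \<Longrightarrow> left_dual_pair C X (dual d X) (ev d X) (coev d X)"
  by unfold_locales (simp_all add: zigzag zigzag_dual)

lemma left_dual_ar_simps [simp]:
  assumes "f \<in> Ar C"
  shows "left_dual_ar C d f \<in> Ar C" "Dom C (left_dual_ar C d f) = dual d (Cod C f)"
    "Cod C (left_dual_ar C d f) = dual d (Dom C f)"
  using assms by (simp_all add: left_dual_ar_def tensor_ar_assoc)

text \<open>Up to interchange, \<open>left_dual_ar C d f\<close> is the lift of the right-hand side;
  all later reasoning about dual arrows uses this equation in place of the defining formula.\<close>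

lemma ev_left_dual_ar:
  assumes [simp]: "f \<in> Ar C"
  shows "ev d (Dom C f) \<cdot> (left_dual_ar C d f \<boxtimes> ident C (Dom C f)) =
    ev d (Cod C f) \<cdot> (ident C (dual d (Cod C f)) \<boxtimes> f)"
proof -
  interpret P: left_dual_pair C "Dom C f" "dual d (Dom C f)" "ev d (Dom C f)" "coev d (Dom C f)"
    by (rule left_dual_pair) simp
  have "left_dual_ar C d f = P.lift (dual d (Cod C f)) (ev d (Cod C f) \<cdot> (ident C (dual d (Cod C f)) \<boxtimes> f))"
    by (simp add: P.lift_def left_dual_ar_def)
  then show ?thesis by (simp add: P.ev_lift)
qed

end

locale left_autonomous_adjunction = strong_monoidal_adjunction C D U F \<eta> \<epsilon> +
  dC: left_autonomous C dC + dD: left_autonomous D dD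
  for C :: "('o, 'a) moncat" and D :: "('p, 'b) moncat"
    and U :: "('p, 'b, 'o, 'a) mfunc" and F :: "('o, 'a, 'p, 'b) func"
    and \<eta> :: "'o \<Rightarrow> 'a" and \<epsilon> :: "'p \<Rightarrow> 'b" and dC :: "('o, 'a) duals" and dD :: "('p, 'b) duals"
begin

section \<open>Images of chosen duals and their comparison with the chosen duals in
  \<open>C\<close>\<close>

definition evU where
  "evU A = inv_ar C (str0 U) \<cdot>\<^bsub>C\<^esub> (arr U (ev dD A) \<cdot>\<^bsub>C\<^esub> str2 U (dual dD A) A)"

definition coevU where
  "coevU A = inv_ar C (str2 U A (dual dD A)) \<cdot>\<^bsub>C\<^esub> (arr U (coev dD A) \<cdot>\<^bsub>C\<^esub> str0 U)"

lemma image_pair: "A \<in> Ob D \<Longrightarrow> left_dual_pair C (obj U A) (obj U (dual dD A)) (evU A) (coevU A)"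
  unfolding evU_def coevU_def by (rule U.left_dual_pair_image) (rule dD.left_dual_pair)

lemma evU_simps [simp]:
  assumes "A \<in> Ob D"
  shows "evU A \<in> Ar C" "Dom C (evU A) = obj U (dual dD A) \<otimes>\<^bsub>C\<^esub> obj U A" "Cod C (evU A) = \<one>\<^bsub>C\<^esub>"
    "coevU A \<in> Ar C" "Dom C (coevU A) = \<one>\<^bsub>C\<^esub>" "Cod C (coevU A) = obj U A \<otimes>\<^bsub>C\<^esub> obj U (dual dD A)"
  using left_dual_pair.ev_coev_simps[OF image_pair[OF assms]] by auto

text \<open>With the images under \<open>U\<close> serving as duals, \<open>U\<close> of the dual of
  \<open>k\<close> is the dual of \<open>U k\<close>: the corresponding equation in \<open>D\<close>
  is transported by naturality of \<open>U_2\<close>.\<close>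

lemma evU_natural:
  assumes [simp]: "k \<in> Ar D" "Dom D k = A" "Cod D k = B"
  shows "evU A \<cdot>\<^bsub>C\<^esub> (arr U (left_dual_ar D dD k) \<boxtimes>\<^bsub>C\<^esub> ident C (obj U A)) =
    evU B \<cdot>\<^bsub>C\<^esub> (ident C (obj U (dual dD B)) \<boxtimes>\<^bsub>C\<^esub> arr U k)"
proof -
  have [simp]: "A \<in> Ob D" "B \<in> Ob D" using U.source.Dom_in[of k] U.source.Cod_in[of k] by simp_all
  have "arr U (ev dD A) \<cdot>\<^bsub>C\<^esub> (str2 U (dual dD A) A \<cdot>\<^bsub>C\<^esub> (arr U (left_dual_ar D dD k) \<boxtimes>\<^bsub>C\<^esub> ident C (obj U A))) =
      arr U (ev dD A \<cdot>\<^bsub>D\<^esub> (left_dual_ar D dD k \<boxtimes>\<^bsub>D\<^esub> ident D A)) \<cdot>\<^bsub>C\<^esub> str2 U (dual dD B) A"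
    using U.str2_naturality[of "left_dual_ar D dD k" "ident D A" "dual dD B" A] by simp
  also have "\<dots> = arr U (ev dD B \<cdot>\<^bsub>D\<^esub> (ident D (dual dD B) \<boxtimes>\<^bsub>D\<^esub> k)) \<cdot>\<^bsub>C\<^esub> str2 U (dual dD B) A"
    using dD.ev_left_dual_ar[of k] by simp
  also have "\<dots> = arr U (ev dD B) \<cdot>\<^bsub>C\<^esub> (str2 U (dual dD B) B \<cdot>\<^bsub>C\<^esub> (ident C (obj U (dual dD B)) \<boxtimes>\<^bsub>C\<^esub> arr U k))"
    using U.str2_naturality[of "ident D (dual dD B)" k "dual dD B" A] by simp
  finally show ?thesis by (simp add: evU_def)
qed

text \<open>\<open>\<alpha> A\<close> is the canonical isomorphism from the chosen dual of \<open>U A\<close> to the image under \<open>U\<close> of the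
  chosen dual of \<open>A\<close>, and \<open>\<beta> A\<close> corresponds to it under the adjunction. \<open>\<tau> X\<close> is the dual of \<open>\<eta> X\<close>
  when \<open>U\<close> of the dual of \<open>F X\<close> serves as the dual of \<open>U (F X)\<close>.\<close>

definition \<alpha> where
  "\<alpha> A = (ev dC (obj U A) \<boxtimes>\<^bsub>C\<^esub> ident C (obj U (dual dD A))) \<cdot>\<^bsub>C\<^esub>
     (ident C (dual dC (obj U A)) \<boxtimes>\<^bsub>C\<^esub> coevU A)"

definition \<beta> where "\<beta> A = \<epsilon> (dual dD A) \<cdot>\<^bsub>D\<^esub> arr F (\<alpha> A)"

definition \<tau> where
  "\<tau> X = ((evU (obj F X) \<cdot>\<^bsub>C\<^esub> (ident C (obj U (dual dD (obj F X))) \<boxtimes>\<^bsub>C\<^esub> \<eta> X)) \<boxtimes>\<^bsub>C\<^esub> ident C (dual dC X)) \<cdot>\<^bsub>C\<^esub>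
     (ident C (obj U (dual dD (obj F X))) \<boxtimes>\<^bsub>C\<^esub> coev dC X)"

text \<open>The first factor applied, \<open>arr U (\<beta> (obj F X))\<close>, leads from
  \<open>T\<close> of the dual of \<open>T X\<close> to \<open>U\<close> of the dual of
  \<open>F X\<close>; \<open>\<tau> X\<close> then descends to the dual of \<open>X\<close>.\<close>

definition antipode where "antipode X = \<tau> X \<cdot>\<^bsub>C\<^esub> arr U (\<beta> (obj F X))"

lemma \<alpha>_simps [simp]:
  assumes "A \<in> Ob D"
  shows "\<alpha> A \<in> Ar C" "Dom C (\<alpha> A) = dual dC (obj U A)" "Cod C (\<alpha> A) = obj U (dual dD A)"
  using assms by (simp_all add: \<alpha>_def)

lemma \<beta>_simps [simp]:
  assumes "A \<in> Ob D"
  shows "\<beta> A \<in> Ar D" "Dom D (\<beta> A) = obj F (dual dC (obj U A))" "Cod D (\<beta> A) = dual dD A"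
  using assms by (simp_all add: \<beta>_def)

lemma \<tau>_simps [simp]:
  assumes "X \<in> Ob C"
  shows "\<tau> X \<in> Ar C" "Dom C (\<tau> X) = obj U (dual dD (obj F X))" "Cod C (\<tau> X) = dual dC X"
  using assms by (simp_all add: \<tau>_def)

lemma ev_\<alpha>:
  assumes [simp]: "A \<in> Ob D"
  shows "evU A \<cdot>\<^bsub>C\<^esub> (\<alpha> A \<boxtimes>\<^bsub>C\<^esub> ident C (obj U A)) = ev dC (obj U A)"
proof -
  interpret P: left_dual_pair C "obj U A" "obj U (dual dD A)" "evU A" "coevU A"
    by (rule image_pair) fact
  show ?thesis using P.ev_lift[of "ev dC (obj U A)" "dual dC (obj U A)"] by (simp add: P.lift_def \<alpha>_def)
qed

text \<open>By \<open>ev_\<alpha>\<close>, \<open>\<alpha> A\<close> is the mate of an identity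
  arrow, so \<open>mate_coev\<close> applies.\<close>

lemma coev_\<alpha>:
  assumes [simp]: "A \<in> Ob D"
  shows "(ident C (obj U A) \<boxtimes>\<^bsub>C\<^esub> \<alpha> A) \<cdot>\<^bsub>C\<^esub> coev dC (obj U A) = coevU A"
  using mate_coev[OF image_pair dC.left_dual_pair, of A "obj U A" "ident C (obj U A)" "\<alpha> A"]
  by (simp add: ev_\<alpha>)

lemma ev_\<tau>:
  assumes [simp]: "X \<in> Ob C"
  shows "ev dC X \<cdot>\<^bsub>C\<^esub> (\<tau> X \<boxtimes>\<^bsub>C\<^esub> ident C X) =
    evU (obj F X) \<cdot>\<^bsub>C\<^esub> (ident C (obj U (dual dD (obj F X))) \<boxtimes>\<^bsub>C\<^esub> \<eta> X)"
proof -
  interpret P: left_dual_pair C X "dual dC X" "ev dC X" "coev dC X"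
    by (rule dC.left_dual_pair) fact
  show ?thesis
    using P.ev_lift[of "evU (obj F X) \<cdot>\<^bsub>C\<^esub> (ident C (obj U (dual dD (obj F X))) \<boxtimes>\<^bsub>C\<^esub> \<eta> X)"
        "obj U (dual dD (obj F X))"]
    by (simp add: P.lift_def \<tau>_def)
qed

text \<open>\<open>ev_\<tau>\<close> says that \<open>\<tau> X\<close> and \<open>\<eta> X\<close>
  are mates for the chosen pair and the image pair.\<close>

lemma coev_\<tau>:
  assumes [simp]: "X \<in> Ob C"
  shows "(ident C (obj U (obj F X)) \<boxtimes>\<^bsub>C\<^esub> \<tau> X) \<cdot>\<^bsub>C\<^esub> coevU (obj F X) =
    (\<eta> X \<boxtimes>\<^bsub>C\<^esub> ident C (dual dC X)) \<cdot>\<^bsub>C\<^esub> coev dC X"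
  by (rule mate_coev[OF dC.left_dual_pair image_pair]) (simp_all add: ev_\<tau>)

text \<open>Tested against \<open>evU A\<close>, both composites give \<open>evU B\<close> after
  \<open>\<alpha> B \<boxtimes> arr U k\<close>.\<close>

lemma \<alpha>_natural:
  assumes [simp]: "k \<in> Ar D" "Dom D k = A" "Cod D k = B"
  shows "\<alpha> A \<cdot>\<^bsub>C\<^esub> left_dual_ar C dC (arr U k) = arr U (left_dual_ar D dD k) \<cdot>\<^bsub>C\<^esub> \<alpha> B"
proof -
  have [simp]: "A \<in> Ob D" "B \<in> Ob D" using U.source.Dom_in[of k] U.source.Cod_in[of k] by simp_all
  interpret P: left_dual_pair C "obj U A" "obj U (dual dD A)" "evU A" "coevU A"
    by (rule image_pair) fact
  let ?i = "ident C"
  have "evU A \<cdot>\<^bsub>C\<^esub> ((\<alpha> A \<cdot>\<^bsub>C\<^esub> left_dual_ar C dC (arr U k)) \<boxtimes>\<^bsub>C\<^esub> ?i (obj U A)) =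
      ev dC (obj U A) \<cdot>\<^bsub>C\<^esub> (left_dual_ar C dC (arr U k) \<boxtimes>\<^bsub>C\<^esub> ?i (obj U A))"
    by (rule U.target.comp_tensor_left[OF ev_\<alpha>]) simp_all
  also have "\<dots> = ev dC (obj U B) \<cdot>\<^bsub>C\<^esub> (?i (dual dC (obj U B)) \<boxtimes>\<^bsub>C\<^esub> arr U k)"
    using dC.ev_left_dual_ar[of "arr U k"] by simp
  also have "\<dots> = evU B \<cdot>\<^bsub>C\<^esub> ((\<alpha> B \<cdot>\<^bsub>C\<^esub> ?i (dual dC (obj U B))) \<boxtimes>\<^bsub>C\<^esub> arr U k)"
    by (rule U.target.comp_tensor_left[OF ev_\<alpha>, symmetric]) simp_all
  also have "\<dots> = evU B \<cdot>\<^bsub>C\<^esub> (?i (obj U (dual dD B)) \<boxtimes>\<^bsub>C\<^esub> arr U k) \<cdot>\<^bsub>C\<^esub> (\<alpha> B \<boxtimes>\<^bsub>C\<^esub> ?i (obj U A))"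
    by simp
  also have "\<dots> = evU A \<cdot>\<^bsub>C\<^esub> ((arr U (left_dual_ar D dD k) \<cdot>\<^bsub>C\<^esub> \<alpha> B) \<boxtimes>\<^bsub>C\<^esub> ?i (obj U A))"
    by (rule U.target.comp_tensor_left[OF evU_natural, symmetric]) simp_all
  finally have eq: "evU A \<cdot>\<^bsub>C\<^esub> ((\<alpha> A \<cdot>\<^bsub>C\<^esub> left_dual_ar C dC (arr U k)) \<boxtimes>\<^bsub>C\<^esub> ?i (obj U A)) =
      evU A \<cdot>\<^bsub>C\<^esub> ((arr U (left_dual_ar D dD k) \<cdot>\<^bsub>C\<^esub> \<alpha> B) \<boxtimes>\<^bsub>C\<^esub> ?i (obj U A))" .
  show ?thesis by (rule P.dual_hom_eqI[OF _ _ _ _ _ eq]) simp_all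
qed

lemma \<beta>_natural:
  assumes [simp]: "k \<in> Ar D" "Dom D k = A" "Cod D k = B"
  shows "\<beta> A \<cdot>\<^bsub>D\<^esub> arr F (left_dual_ar C dC (arr U k)) = left_dual_ar D dD k \<cdot>\<^bsub>D\<^esub> \<beta> B"
proof -
  have [simp]: "A \<in> Ob D" "B \<in> Ob D" using U.source.Dom_in[of k] U.source.Cod_in[of k] by simp_all
  have "\<beta> A \<cdot>\<^bsub>D\<^esub> arr F (left_dual_ar C dC (arr U k)) =
      \<epsilon> (dual dD A) \<cdot>\<^bsub>D\<^esub> arr F (\<alpha> A \<cdot>\<^bsub>C\<^esub> left_dual_ar C dC (arr U k))"
    by (simp add: \<beta>_def)
  also have "\<dots> = left_dual_ar D dD k \<cdot>\<^bsub>D\<^esub> \<beta> B"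
    using adj.counit.naturality_assoc[of "left_dual_ar D dD k" "dual dD B" "dual dD A" "arr F (\<alpha> B)"]
    by (simp add: \<alpha>_natural \<beta>_def)
  finally show ?thesis .
qed

text \<open>Tested against \<open>ev dC X\<close>, both composites give \<open>evU (obj F Y)\<close>
  after the identity tensored with \<open>\<eta> Y \<cdot> f\<close>; naturality of
  \<open>\<eta>\<close> links the two.\<close>

lemma \<tau>_natural:
  assumes [simp]: "f \<in> Ar C" "Dom C f = X" "Cod C f = Y"
  shows "\<tau> X \<cdot>\<^bsub>C\<^esub> arr U (left_dual_ar D dD (arr F f)) = left_dual_ar C dC f \<cdot>\<^bsub>C\<^esub> \<tau> Y"
proof -
  have [simp]: "X \<in> Ob C" "Y \<in> Ob C" using U.target.Dom_in[of f] U.target.Cod_in[of f] by simp_all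
  interpret P: left_dual_pair C X "dual dC X" "ev dC X" "coev dC X"
    by (rule dC.left_dual_pair) fact
  let ?i = "ident C" and ?k = "left_dual_ar D dD (arr F f)"
  have dual_f: "ev dC X \<cdot>\<^bsub>C\<^esub> (left_dual_ar C dC f \<boxtimes>\<^bsub>C\<^esub> ?i X) = ev dC Y \<cdot>\<^bsub>C\<^esub> (?i (dual dC Y) \<boxtimes>\<^bsub>C\<^esub> f)"
    using dC.ev_left_dual_ar[of f] by simp
  have "ev dC X \<cdot>\<^bsub>C\<^esub> ((\<tau> X \<cdot>\<^bsub>C\<^esub> arr U ?k) \<boxtimes>\<^bsub>C\<^esub> ?i X) =
      evU (obj F X) \<cdot>\<^bsub>C\<^esub> (ident C (obj U (dual dD (obj F X))) \<boxtimes>\<^bsub>C\<^esub> \<eta> X) \<cdot>\<^bsub>C\<^esub> (arr U ?k \<boxtimes>\<^bsub>C\<^esub> ?i X)"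
    by (rule U.target.comp_tensor_left[OF ev_\<tau>]) simp_all
  also have "\<dots> = evU (obj F X) \<cdot>\<^bsub>C\<^esub> ((arr U ?k \<cdot>\<^bsub>C\<^esub> ?i (obj U (dual dD (obj F Y)))) \<boxtimes>\<^bsub>C\<^esub> \<eta> X)"
    by simp
  also have "\<dots> = evU (obj F Y) \<cdot>\<^bsub>C\<^esub> (?i (obj U (dual dD (obj F Y))) \<boxtimes>\<^bsub>C\<^esub> arr U (arr F f)) \<cdot>\<^bsub>C\<^esub>
      (?i (obj U (dual dD (obj F Y))) \<boxtimes>\<^bsub>C\<^esub> \<eta> X)"
    by (rule U.target.comp_tensor_left[OF evU_natural]) simp_all
  also have "\<dots> = evU (obj F Y) \<cdot>\<^bsub>C\<^esub> (?i (obj U (dual dD (obj F Y))) \<boxtimes>\<^bsub>C\<^esub> \<eta> Y) \<cdot>\<^bsub>C\<^esub>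
      (?i (obj U (dual dD (obj F Y))) \<boxtimes>\<^bsub>C\<^esub> f)"
    using adj.unit.naturality[of f X Y] by simp
  also have "\<dots> = ev dC Y \<cdot>\<^bsub>C\<^esub> ((\<tau> Y \<cdot>\<^bsub>C\<^esub> ?i (obj U (dual dD (obj F Y)))) \<boxtimes>\<^bsub>C\<^esub> f)"
    by (rule U.target.comp_tensor_left[OF ev_\<tau>, symmetric]) simp_all
  also have "\<dots> = ev dC Y \<cdot>\<^bsub>C\<^esub> (?i (dual dC Y) \<boxtimes>\<^bsub>C\<^esub> f) \<cdot>\<^bsub>C\<^esub> (\<tau> Y \<boxtimes>\<^bsub>C\<^esub> ?i X)"
    by simp
  also have "\<dots> = ev dC X \<cdot>\<^bsub>C\<^esub> ((left_dual_ar C dC f \<cdot>\<^bsub>C\<^esub> \<tau> Y) \<boxtimes>\<^bsub>C\<^esub> ?i X)"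
    by (rule U.target.comp_tensor_left[OF dual_f, symmetric]) simp_all
  finally have eq: "ev dC X \<cdot>\<^bsub>C\<^esub> ((\<tau> X \<cdot>\<^bsub>C\<^esub> arr U ?k) \<boxtimes>\<^bsub>C\<^esub> ?i X) =
      ev dC X \<cdot>\<^bsub>C\<^esub> ((left_dual_ar C dC f \<cdot>\<^bsub>C\<^esub> \<tau> Y) \<boxtimes>\<^bsub>C\<^esub> ?i X)" .
  show ?thesis by (rule P.dual_hom_eqI[OF _ _ _ _ _ eq]) simp_all
qed

lemma \<beta>_transpose:
  assumes [simp]: "A \<in> Ob D"
  shows "arr U (\<beta> A) \<cdot>\<^bsub>C\<^esub> \<eta> (dual dC (obj U A)) = \<alpha> A"
  by (simp add: \<beta>_def transpose_simp)

text \<open>Both transposes are \<open>str0 U \<cdot> ev dC (obj U A)\<close>, on the left by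
  \<open>ev_\<alpha>\<close> and on the right by \<open>F0_transpose\<close>. The evaluation axiom
  of the antipode will come from the case \<open>A = F X\<close>.\<close>

lemma ev_F2:
  assumes [simp]: "A \<in> Ob D"
  shows "ev dD A \<cdot>\<^bsub>D\<^esub> ((\<beta> A \<boxtimes>\<^bsub>D\<^esub> \<epsilon> A) \<cdot>\<^bsub>D\<^esub> str2 F' (dual dC (obj U A)) (obj U A)) =
    str0 F' \<cdot>\<^bsub>D\<^esub> arr F (ev dC (obj U A))"
proof (rule transpose_inject)
  let ?X = "dual dC (obj U A) \<otimes>\<^bsub>C\<^esub> obj U A"
  have "arr U (ev dD A \<cdot>\<^bsub>D\<^esub> ((\<beta> A \<boxtimes>\<^bsub>D\<^esub> \<epsilon> A) \<cdot>\<^bsub>D\<^esub> str2 F' (dual dC (obj U A)) (obj U A))) \<cdot>\<^bsub>C\<^esub> \<eta> ?X =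
      arr U (ev dD A) \<cdot>\<^bsub>C\<^esub> (str2 U (dual dD A) A \<cdot>\<^bsub>C\<^esub> (\<alpha> A \<boxtimes>\<^bsub>C\<^esub> ident C (obj U A)))"
    by (simp add: F2_transpose U.str2_naturality_assoc \<beta>_transpose adj.triangle_right)
  also have "\<dots> = str0 U \<cdot>\<^bsub>C\<^esub> (evU A \<cdot>\<^bsub>C\<^esub> (\<alpha> A \<boxtimes>\<^bsub>C\<^esub> ident C (obj U A)))"
    by (simp add: evU_def)
  also have "\<dots> = arr U (str0 F') \<cdot>\<^bsub>C\<^esub> \<eta> \<one>\<^bsub>C\<^esub> \<cdot>\<^bsub>C\<^esub> ev dC (obj U A)"
    by (simp only: ev_\<alpha> F0_transpose assms)
  also have "\<dots> = arr U (str0 F' \<cdot>\<^bsub>D\<^esub> arr F (ev dC (obj U A))) \<cdot>\<^bsub>C\<^esub> \<eta> ?X"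
    using adj.unit.naturality[of "ev dC (obj U A)" ?X "\<one>\<^bsub>C\<^esub>"] by simp
  finally show "arr U (ev dD A \<cdot>\<^bsub>D\<^esub> ((\<beta> A \<boxtimes>\<^bsub>D\<^esub> \<epsilon> A) \<cdot>\<^bsub>D\<^esub> str2 F' (dual dC (obj U A)) (obj U A))) \<cdot>\<^bsub>C\<^esub> \<eta> ?X =
      arr U (str0 F' \<cdot>\<^bsub>D\<^esub> arr F (ev dC (obj U A))) \<cdot>\<^bsub>C\<^esub> \<eta> ?X" .
qed simp_all

text \<open>Both transposes are \<open>arr U (coev dD A) \<cdot> str0 U\<close>, by
  \<open>coev_\<alpha>\<close> on the left. The case \<open>A = F X\<close> yields the coevaluation
  axiom.\<close>

lemma coev_F2:
  assumes [simp]: "A \<in> Ob D"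
  shows "(\<epsilon> A \<boxtimes>\<^bsub>D\<^esub> \<beta> A) \<cdot>\<^bsub>D\<^esub> (str2 F' (obj U A) (dual dC (obj U A)) \<cdot>\<^bsub>D\<^esub> arr F (coev dC (obj U A))) =
    coev dD A \<cdot>\<^bsub>D\<^esub> str0 F'"
proof (rule transpose_inject)
  let ?X = "obj U A \<otimes>\<^bsub>C\<^esub> dual dC (obj U A)"
  have "arr U ((\<epsilon> A \<boxtimes>\<^bsub>D\<^esub> \<beta> A) \<cdot>\<^bsub>D\<^esub> (str2 F' (obj U A) (dual dC (obj U A)) \<cdot>\<^bsub>D\<^esub> arr F (coev dC (obj U A)))) \<cdot>\<^bsub>C\<^esub> \<eta> \<one>\<^bsub>C\<^esub> =
      arr U (\<epsilon> A \<boxtimes>\<^bsub>D\<^esub> \<beta> A) \<cdot>\<^bsub>C\<^esub> ((arr U (str2 F' (obj U A) (dual dC (obj U A))) \<cdot>\<^bsub>C\<^esub> \<eta> ?X) \<cdot>\<^bsub>C\<^esub> coev dC (obj U A))"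
    using adj.unit.naturality[of "coev dC (obj U A)" "\<one>\<^bsub>C\<^esub>" ?X] by simp
  also have "\<dots> = str2 U A (dual dD A) \<cdot>\<^bsub>C\<^esub> ((ident C (obj U A) \<boxtimes>\<^bsub>C\<^esub> \<alpha> A) \<cdot>\<^bsub>C\<^esub> coev dC (obj U A))"
    by (subst F2_transpose) (simp_all add: U.str2_naturality_assoc \<beta>_transpose adj.triangle_right)
  also have "\<dots> = arr U (coev dD A) \<cdot>\<^bsub>C\<^esub> str0 U"
    by (simp add: coev_\<alpha>) (simp add: coevU_def)
  also have "\<dots> = arr U (coev dD A \<cdot>\<^bsub>D\<^esub> str0 F') \<cdot>\<^bsub>C\<^esub> \<eta> \<one>\<^bsub>C\<^esub>"
    by (simp add: F0_transpose)
  finally show "arr U ((\<epsilon> A \<boxtimes>\<^bsub>D\<^esub> \<beta> A) \<cdot>\<^bsub>D\<^esub> (str2 F' (obj U A) (dual dC (obj U A)) \<cdot>\<^bsub>D\<^esub>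
      arr F (coev dC (obj U A)))) \<cdot>\<^bsub>C\<^esub> \<eta> \<one>\<^bsub>C\<^esub> = arr U (coev dD A \<cdot>\<^bsub>D\<^esub> str0 F') \<cdot>\<^bsub>C\<^esub> \<eta> \<one>\<^bsub>C\<^esub>" .
qed simp_all

lemma antipode_simps [simp]:
  assumes "X \<in> Ob C"
  shows "antipode X \<in> Ar C" "Dom C (antipode X) = obj T (dual dC (obj T X))" "Cod C (antipode X) = dual dC X"
  using assms by (simp_all add: antipode_def)

text \<open>Naturality of \<open>\<beta>\<close> turns the dual of \<open>\<mu>\<close> into
  \<open>U\<close> of the dual of \<open>\<epsilon>\<close>. By \<open>evU_natural\<close> this
  passes to the other tensor factor as \<open>U \<epsilon>\<close>, where it meets the
  \<open>\<eta>\<close> contained in \<open>\<tau>\<close> and cancels by the triangle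
  identity.\<close>

lemma ev_antipode:
  assumes [simp]: "X \<in> Ob C"
  shows "ev dC (obj T X) \<cdot>\<^bsub>C\<^esub> ((antipode (obj T X) \<cdot>\<^bsub>C\<^esub> arr T (left_dual_ar C dC (\<mu> X))) \<boxtimes>\<^bsub>C\<^esub> ident C (obj T X)) =
    evU (obj F X) \<cdot>\<^bsub>C\<^esub> (arr U (\<beta> (obj F X)) \<boxtimes>\<^bsub>C\<^esub> ident C (obj T X))"
proof -
  let ?A = "obj F X" and ?i = "ident C"
  let ?B = "obj F (obj U ?A)" and ?k = "left_dual_ar D dD (\<epsilon> (obj F X))"
  let ?u = "arr U ?k \<cdot>\<^bsub>C\<^esub> arr U (\<beta> ?A)"
  have "antipode (obj T X) \<cdot>\<^bsub>C\<^esub> arr T (left_dual_ar C dC (\<mu> X)) =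
      \<tau> (obj U ?A) \<cdot>\<^bsub>C\<^esub> arr U (\<beta> ?B \<cdot>\<^bsub>D\<^esub> arr F (left_dual_ar C dC (arr U (\<epsilon> ?A))))"
    by (simp add: antipode_def)
  also have "\<dots> = \<tau> (obj U ?A) \<cdot>\<^bsub>C\<^esub> ?u"
    using \<beta>_natural[of "\<epsilon> ?A" ?B ?A] by simp
  finally have "ev dC (obj T X) \<cdot>\<^bsub>C\<^esub>
      ((antipode (obj T X) \<cdot>\<^bsub>C\<^esub> arr T (left_dual_ar C dC (\<mu> X))) \<boxtimes>\<^bsub>C\<^esub> ?i (obj T X)) =
      ev dC (obj U ?A) \<cdot>\<^bsub>C\<^esub> ((\<tau> (obj U ?A) \<cdot>\<^bsub>C\<^esub> ?u) \<boxtimes>\<^bsub>C\<^esub> ?i (obj U ?A))"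
    by simp
  also have "\<dots> = evU ?B \<cdot>\<^bsub>C\<^esub> (?i (obj U (dual dD ?B)) \<boxtimes>\<^bsub>C\<^esub> \<eta> (obj U ?A)) \<cdot>\<^bsub>C\<^esub> (?u \<boxtimes>\<^bsub>C\<^esub> ?i (obj U ?A))"
    by (rule U.target.comp_tensor_left[OF ev_\<tau>]) simp_all
  also have "\<dots> = evU ?B \<cdot>\<^bsub>C\<^esub> (?u \<boxtimes>\<^bsub>C\<^esub> \<eta> (obj U ?A))"
    by simp
  also have "\<dots> = evU ?A \<cdot>\<^bsub>C\<^esub> (?i (obj U (dual dD ?A)) \<boxtimes>\<^bsub>C\<^esub> arr U (\<epsilon> ?A)) \<cdot>\<^bsub>C\<^esub> (arr U (\<beta> ?A) \<boxtimes>\<^bsub>C\<^esub> \<eta> (obj U ?A))"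
    by (rule U.target.comp_tensor_left[OF evU_natural]) simp_all
  also have "\<dots> = evU ?A \<cdot>\<^bsub>C\<^esub> (arr U (\<beta> ?A) \<boxtimes>\<^bsub>C\<^esub> ?i (obj T X))"
    by (simp add: adj.triangle_right)
  finally show ?thesis .
qed

lemma left_antipode_antipode: "left_antipode C dC T \<mu> \<eta> antipode"
proof
  show "antipode X \<in> hom C (obj T (dual dC (obj T X))) (dual dC X)" if "X \<in> Ob C" for X
    using that by simp
  show "antipode X \<cdot>\<^bsub>C\<^esub> arr T (left_dual_ar C dC (arr T f)) = left_dual_ar C dC f \<cdot>\<^bsub>C\<^esub> antipode Y"
    if f: "f \<in> hom C X Y" for f X Y
  proof -
    have [simp]: "X \<in> Ob C" "Y \<in> Ob C" "f \<in> Ar C" "Dom C f = X" "Cod C f = Y" using f by auto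
    have "antipode X \<cdot>\<^bsub>C\<^esub> arr T (left_dual_ar C dC (arr T f)) =
        \<tau> X \<cdot>\<^bsub>C\<^esub> arr U (\<beta> (obj F X) \<cdot>\<^bsub>D\<^esub> arr F (left_dual_ar C dC (arr U (arr F f))))"
      by (simp add: antipode_def)
    also have "\<dots> = (\<tau> X \<cdot>\<^bsub>C\<^esub> arr U (left_dual_ar D dD (arr F f))) \<cdot>\<^bsub>C\<^esub> arr U (\<beta> (obj F Y))"
      using \<beta>_natural[of "arr F f" "obj F X" "obj F Y"] by simp
    also have "\<dots> = left_dual_ar C dC f \<cdot>\<^bsub>C\<^esub> antipode Y"
      using \<tau>_natural[of f X Y] by (simp add: antipode_def)
    finally show ?thesis .
  qed
  show "str0 T \<cdot>\<^bsub>C\<^esub> arr T (ev dC X) \<cdot>\<^bsub>C\<^esub> arr T (left_dual_ar C dC (\<eta> X) \<boxtimes>\<^bsub>C\<^esub> ident C X) =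
      ev dC (obj T X) \<cdot>\<^bsub>C\<^esub> ((antipode (obj T X) \<cdot>\<^bsub>C\<^esub> arr T (left_dual_ar C dC (\<mu> X))) \<boxtimes>\<^bsub>C\<^esub> ident C (obj T X)) \<cdot>\<^bsub>C\<^esub>
        str2 T (dual dC (obj T X)) X"
    if [simp]: "X \<in> Ob C" for X
  proof -
    let ?A = "obj F X" and ?W = "dual dC (obj U (obj F X))"
    have "str0 T \<cdot>\<^bsub>C\<^esub> arr T (ev dC X) \<cdot>\<^bsub>C\<^esub> arr T (left_dual_ar C dC (\<eta> X) \<boxtimes>\<^bsub>C\<^esub> ident C X) =
        str0 T \<cdot>\<^bsub>C\<^esub> arr T (ev dC X \<cdot>\<^bsub>C\<^esub> (left_dual_ar C dC (\<eta> X) \<boxtimes>\<^bsub>C\<^esub> ident C X))"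
      by simp
    also have "\<dots> = str0 T \<cdot>\<^bsub>C\<^esub> arr T (ev dC (obj U ?A) \<cdot>\<^bsub>C\<^esub> (ident C ?W \<boxtimes>\<^bsub>C\<^esub> \<eta> X))"
      using dC.ev_left_dual_ar[of "\<eta> X"] by simp
    also have "\<dots> = inv_ar C (str0 U) \<cdot>\<^bsub>C\<^esub>
        arr U ((str0 F' \<cdot>\<^bsub>D\<^esub> arr F (ev dC (obj U ?A))) \<cdot>\<^bsub>D\<^esub> arr F (ident C ?W \<boxtimes>\<^bsub>C\<^esub> \<eta> X))"
      by simp
    \<comment> \<open>\<open>ev_F2\<close> read backwards introduces
      \<open>\<beta> \<boxtimes> \<epsilon>\<close>. Naturality of \<open>F_2\<close> then brings
      \<open>F \<eta>\<close> next to \<open>\<epsilon>\<close>, and the triangle identity leaves an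
      identity in the second factor.\<close>
    also have "\<dots> = inv_ar C (str0 U) \<cdot>\<^bsub>C\<^esub> arr U (ev dD ?A \<cdot>\<^bsub>D\<^esub> ((\<beta> ?A \<boxtimes>\<^bsub>D\<^esub> ident D ?A) \<cdot>\<^bsub>D\<^esub> str2 F' ?W X))"
      using F'.str2_naturality[of "ident C ?W" "\<eta> X" ?W "obj U ?A"]
      by (subst ev_F2[symmetric]) (simp_all add: adj.triangle_left)
    also have "\<dots> = evU ?A \<cdot>\<^bsub>C\<^esub> (arr U (\<beta> ?A) \<boxtimes>\<^bsub>C\<^esub> ident C (obj T X)) \<cdot>\<^bsub>C\<^esub> str2 T ?W X"
      using U.str2_naturality_assoc[of "\<beta> ?A" "ident D ?A" "obj F ?W" ?A "str2 T ?W X"]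
      by (simp add: evU_def)
    finally show ?thesis using ev_antipode[OF that] by (simp only: T_simps(1))
  qed
  show "(\<eta> X \<boxtimes>\<^bsub>C\<^esub> ident C (dual dC X)) \<cdot>\<^bsub>C\<^esub> coev dC X \<cdot>\<^bsub>C\<^esub> str0 T =
      (\<mu> X \<boxtimes>\<^bsub>C\<^esub> antipode X) \<cdot>\<^bsub>C\<^esub> str2 T (obj T X) (dual dC (obj T X)) \<cdot>\<^bsub>C\<^esub> arr T (coev dC (obj T X))"
    if [simp]: "X \<in> Ob C" for X
  proof -
    let ?A = "obj F X" and ?W = "dual dC (obj U (obj F X))"
    let ?V2 = "inv_ar C (str2 U ?A (dual dD ?A))" and ?\<tau> = "ident C (obj U ?A) \<boxtimes>\<^bsub>C\<^esub> \<tau> X"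
    \<comment> \<open>Replacing the chosen coevaluation by the image one exposes
      \<open>arr U (coev dD ?A)\<close>, to which \<open>coev_F2\<close> applies.\<close>
    have "(\<eta> X \<boxtimes>\<^bsub>C\<^esub> ident C (dual dC X)) \<cdot>\<^bsub>C\<^esub> coev dC X \<cdot>\<^bsub>C\<^esub> str0 T = ?\<tau> \<cdot>\<^bsub>C\<^esub> coevU ?A \<cdot>\<^bsub>C\<^esub> str0 T"
      by (simp only: coev_\<tau> that)
    also have "\<dots> = ?\<tau> \<cdot>\<^bsub>C\<^esub> (?V2 \<cdot>\<^bsub>C\<^esub> arr U (coev dD ?A \<cdot>\<^bsub>D\<^esub> str0 F'))"
      by (simp add: coevU_def)
    \<comment> \<open>\<open>coev_F2\<close> backwards supplies both missing ingredients:
      \<open>U \<epsilon>\<close> is \<open>\<mu> X\<close>, and \<open>U \<beta>\<close> followed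
      by \<open>\<tau>\<close> is the antipode.\<close>
    also have "\<dots> = ?\<tau> \<cdot>\<^bsub>C\<^esub> (?V2 \<cdot>\<^bsub>C\<^esub> (arr U (\<epsilon> ?A \<boxtimes>\<^bsub>D\<^esub> \<beta> ?A) \<cdot>\<^bsub>C\<^esub> (arr U (str2 F' (obj U ?A) ?W) \<cdot>\<^bsub>C\<^esub>
        arr T (coev dC (obj U ?A)))))"
      by (subst coev_F2[symmetric]) simp_all
    also have "\<dots> = ?\<tau> \<cdot>\<^bsub>C\<^esub> ((arr U (\<epsilon> ?A) \<boxtimes>\<^bsub>C\<^esub> arr U (\<beta> ?A)) \<cdot>\<^bsub>C\<^esub>
        (str2 T (obj U ?A) ?W \<cdot>\<^bsub>C\<^esub> arr T (coev dC (obj U ?A))))"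
      using U.str2_naturality_assoc[of "\<epsilon> ?A" "\<beta> ?A" "obj F (obj U ?A)" "obj F ?W"
          "str2 T (obj U ?A) ?W \<cdot>\<^bsub>C\<^esub> arr T (coev dC (obj U ?A))"]
      by simp
    also have "\<dots> = (\<mu> X \<boxtimes>\<^bsub>C\<^esub> antipode X) \<cdot>\<^bsub>C\<^esub> str2 T (obj T X) (dual dC (obj T X)) \<cdot>\<^bsub>C\<^esub>
        arr T (coev dC (obj T X))"
      by (simp add: antipode_def)
    finally show ?thesis .
  qed
qed

end

section \<open>Right duals by reversing the tensor product\<close>

text \<open>Only the tensor product is reversed, not composition: right duals become left duals
  while \<open>F\<close>, \<open>\<eta>\<close> and \<open>\<epsilon>\<close> serve
  unchanged.\<close>

definition rev_cat :: "('o, 'a) moncat \<Rightarrow> ('o, 'a) moncat" where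
  "rev_cat C = C\<lparr>tensor_ob := \<lambda>X Y. Y \<otimes>\<^bsub>C\<^esub> X, tensor_ar := \<lambda>f g. g \<boxtimes>\<^bsub>C\<^esub> f\<rparr>"

definition rev_mfunc :: "('o, 'a, 'p, 'b) mfunc \<Rightarrow> ('o, 'a, 'p, 'b) mfunc" where
  "rev_mfunc F = F\<lparr>str2 := \<lambda>X Y. str2 F Y X\<rparr>"

lemma rev_cat_simps [simp]:
  "Ob (rev_cat C) = Ob C" "Ar (rev_cat C) = Ar C" "Dom (rev_cat C) = Dom C" "Cod (rev_cat C) = Cod C"
  "ident (rev_cat C) = ident C" "comp_ar (rev_cat C) = comp_ar C" "unit_ob (rev_cat C) = unit_ob C"
  "X \<otimes>\<^bsub>rev_cat C\<^esub> Y = Y \<otimes>\<^bsub>C\<^esub> X" "f \<boxtimes>\<^bsub>rev_cat C\<^esub> g = g \<boxtimes>\<^bsub>C\<^esub> f"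
  by (simp_all add: rev_cat_def)

lemma rev_mfunc_simps [simp]:
  "obj (rev_mfunc F) = obj F" "arr (rev_mfunc F) = arr F" "str0 (rev_mfunc F) = str0 F"
  "str2 (rev_mfunc F) X Y = str2 F Y X"
  by (simp_all add: rev_mfunc_def)

lemma inverse_rev_cat [simp]:
  "is_inverse (rev_cat C) = is_inverse C" "is_iso (rev_cat C) = is_iso C" "inv_ar (rev_cat C) = inv_ar C"
proof -
  show i: "is_inverse (rev_cat C) = is_inverse C" by (intro ext) (simp add: is_inverse_def)
  show "is_iso (rev_cat C) = is_iso C" "inv_ar (rev_cat C) = inv_ar C"
    by (intro ext, simp add: is_iso_def inv_ar_def i)+
qed

lemma strict_monoidal_category_rev_cat:
  assumes "strict_monoidal_category C" shows "strict_monoidal_category (rev_cat C)"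
proof -
  interpret strict_monoidal_category C by fact
  show ?thesis by unfold_locales (auto simp: tensor_ar_assoc)
qed

lemma strong_monoidal_functor_rev:
  assumes "strong_monoidal_functor C D F"
  shows "strong_monoidal_functor (rev_cat C) (rev_cat D) (rev_mfunc F)"
proof -
  interpret strong_monoidal_functor C D F by fact
  interpret C: strict_monoidal_category "rev_cat C"
    by (rule strict_monoidal_category_rev_cat) (rule source.strict_monoidal_category_axioms)
  interpret D: strict_monoidal_category "rev_cat D"
    by (rule strict_monoidal_category_rev_cat) (rule target.strict_monoidal_category_axioms)
  show ?thesis
    by unfold_locales
      (auto simp: str2_naturality str_assoc str_unit_left str_unit_right str2_iso str0_iso)
qed

text \<open>None of the axioms of an adjunction mentions the tensor product.\<close>

lemma adjunction_rev:
  assumes "adjunction C D F U \<eta> \<epsilon>"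
  shows "adjunction (rev_cat C) (rev_cat D) F (rev_mfunc U) \<eta> \<epsilon>"
  using assms
  by (simp add: adjunction_def adjunction_axioms_def nat_trans_def nat_trans_axioms_def
      cat_functor_def cat_functor_axioms_def category_def)

lemma left_autonomous_rev_cat:
  assumes "right_autonomous C d" shows "left_autonomous (rev_cat C) d"
proof -
  interpret right_autonomous C d by fact
  interpret C: strict_monoidal_category "rev_cat C"
    by (rule strict_monoidal_category_rev_cat) unfold_locales
  show ?thesis
    using dual_in ev_in coev_in by unfold_locales (auto simp: zigzag zigzag_dual)
qed

lemma left_dual_ar_rev_cat:
  assumes "right_autonomous C d" and [simp]: "f \<in> Ar C"
  shows "left_dual_ar (rev_cat C) d f = right_dual_ar C d f"
proof -
  interpret right_autonomous C d by fact
  show ?thesis by (simp add: left_dual_ar_def right_dual_ar_def tensor_ar_assoc dual_in)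
qed

context strong_monoidal_adjunction
begin

lemma right_antipode_exists:
  assumes rC: "right_autonomous C dC" and rD: "right_autonomous D dD"
  shows "\<exists>s. right_antipode C dC T \<mu> \<eta> s"
proof -
  interpret rC: right_autonomous C dC by fact
  interpret R: left_autonomous_adjunction "rev_cat C" "rev_cat D" "rev_mfunc U" F \<eta> \<epsilon> dC dD
    by (intro left_autonomous_adjunction.intro strong_monoidal_adjunction.intro
        strong_monoidal_functor_rev adjunction_rev left_autonomous_rev_cat rC rD
        U.strong_monoidal_functor_axioms adj.adjunction_axioms)
  \<comment> \<open>The constructions of \<open>F'\<close> and \<open>T\<close> commute with
    reversal; the only effect is that the arguments of \<open>T_2\<close> are exchanged.\<close>
  have T [simp]: "obj R.T X = obj T X" "arr R.T f = arr T f" "str2 R.T X Y = str2 T Y X" "str0 R.T = str0 T"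
    for X Y f
    by (simp_all add: R.F'_def F'_def left_adjoint_comonoidal_def)
  have \<mu>: "R.\<mu> = \<mu>" by (intro ext) simp
  interpret R: left_antipode "rev_cat C" dC R.T \<mu> \<eta> R.antipode
    using R.left_antipode_antipode unfolding \<mu> .
  \<comment> \<open>Both monads stay folded from here on, so that the left antipode axioms translate
    to \<open>T\<close> through the rules just proved.\<close>
  note [simp del] = T_simps R.T_simps
  have "right_antipode C dC T \<mu> \<eta> R.antipode"
  proof
    show "R.antipode X \<in> hom C (obj T (dual dC (obj T X))) (dual dC X)" if "X \<in> Ob C" for X
      using R.antipode_in[of X] that by simp
    show "R.antipode X \<cdot>\<^bsub>C\<^esub> arr T (right_dual_ar C dC (arr T f)) = right_dual_ar C dC f \<cdot>\<^bsub>C\<^esub> R.antipode Y"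
      if "f \<in> hom C X Y" for f X Y
      using R.antipode_natural[of f X Y] that by (auto simp: left_dual_ar_rev_cat[OF rC])
    show "str0 T \<cdot>\<^bsub>C\<^esub> arr T (ev dC X) \<cdot>\<^bsub>C\<^esub> arr T (ident C X \<boxtimes>\<^bsub>C\<^esub> right_dual_ar C dC (\<eta> X)) =
        ev dC (obj T X) \<cdot>\<^bsub>C\<^esub> (ident C (obj T X) \<boxtimes>\<^bsub>C\<^esub> (R.antipode (obj T X) \<cdot>\<^bsub>C\<^esub> arr T (right_dual_ar C dC (\<mu> X)))) \<cdot>\<^bsub>C\<^esub>
          str2 T X (dual dC (obj T X))" if "X \<in> Ob C" for X
      using R.antipode_ev[of X] that
      by (simp add: left_dual_ar_rev_cat[OF rC] del: U.target.comp_assoc_simp)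
    show "(ident C (dual dC X) \<boxtimes>\<^bsub>C\<^esub> \<eta> X) \<cdot>\<^bsub>C\<^esub> coev dC X \<cdot>\<^bsub>C\<^esub> str0 T =
        (R.antipode X \<boxtimes>\<^bsub>C\<^esub> \<mu> X) \<cdot>\<^bsub>C\<^esub> str2 T (dual dC (obj T X)) (obj T X) \<cdot>\<^bsub>C\<^esub> arr T (coev dC (obj T X))"
      if "X \<in> Ob C" for X
      using R.antipode_coev[of X] that by (simp del: U.target.comp_assoc_simp)
  qed
  then show ?thesis by blast
qed

end

theorem theorem9p1:
  fixes C :: "('o, 'a) moncat" and D :: "('p, 'b) moncat"
    and U :: "('p, 'b, 'o, 'a) mfunc" and F :: "('o, 'a, 'p, 'b) func"
    and \<eta> :: "'o \<Rightarrow> 'a" and \<epsilon> :: "'p \<Rightarrow> 'b"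
  assumes "strict_monoidal_category C" and "strict_monoidal_category D"
    and "strong_monoidal_functor D C U"
    and "adjunction C D F U \<eta> \<epsilon>"
  shows "let F' = left_adjoint_comonoidal C D F U \<eta> \<epsilon>;
             T = comp_comonoidal C (as_comonoidal C U) F';
             \<mu> = adjunction_mult F U \<epsilon>;
             TC = module_cat C T \<mu> \<eta>
         in comonoidal_functor C D F'
          \<and> bimonad C T \<mu> \<eta>
          \<and> (\<exists>K2 K0. let K = with_str (comparison_functor D U \<epsilon>) K2 K0 in
               strong_monoidal_functor D TC K
             \<and> mfunc_eq D (comp_monoidal C (forgetful C) K) U
             \<and> mfunc_eq C (comp_comonoidal TC (as_comonoidal TC K) F') (free_module C T \<mu>))
          \<and> (\<forall>dC dD. left_autonomous C dC \<and> left_autonomous D dD \<longrightarrow> left_Hopf_monad C dC T \<mu> \<eta>)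
          \<and> (\<forall>dC dD. right_autonomous C dC \<and> right_autonomous D dD \<longrightarrow> right_Hopf_monad C dC T \<mu> \<eta>)"
proof -
  interpret strong_monoidal_adjunction C D U F \<eta> \<epsilon>
    using assms(3,4) by (rule strong_monoidal_adjunction.intro)
  have "strong_monoidal_functor D M K \<and> mfunc_eq D (comp_monoidal C (forgetful C) K) U
      \<and> mfunc_eq C (comp_comonoidal M (as_comonoidal M K) F') (free_module C T \<mu>)"
    using strong_monoidal_K forgetful_K free_module_K by blast
  \<comment> \<open>The witnesses are the structure arrows in the definition of \<open>K\<close>,
    those lying over \<open>U_2\<close> and \<open>U_0\<close>.\<close>
  then have "\<exists>K2 K0. let K = with_str (comparison_functor D U \<epsilon>) K2 K0 in
      strong_monoidal_functor D M K \<and> mfunc_eq D (comp_monoidal C (forgetful C) K) U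
      \<and> mfunc_eq C (comp_comonoidal M (as_comonoidal M K) F') (free_module C T \<mu>)"
    unfolding K_def Let_def by blast
  moreover have "left_Hopf_monad C dC T \<mu> \<eta>" if "left_autonomous C dC" "left_autonomous D dD" for dC dD
  proof -
    interpret left_autonomous_adjunction C D U F \<eta> \<epsilon> dC dD
      using strong_monoidal_adjunction_axioms that by (rule left_autonomous_adjunction.intro)
    show ?thesis
      unfolding left_Hopf_monad_def using bimonad_T that left_antipode_antipode by blast
  qed
  moreover have "right_Hopf_monad C dC T \<mu> \<eta>" if "right_autonomous C dC" "right_autonomous D dD" for dC dD
    unfolding right_Hopf_monad_def using bimonad_T that right_antipode_exists by blast
  ultimately show ?thesis
    using F'.comonoidal_functor_axioms bimonad_T unfolding Let_def T_def F'_def \<mu>_def by blast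
qed

end
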